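(* Let $\Omega\subset\mathbb R^d$ be open, $d\in\{1,2,3\}$, $T\in(0,+\infty)$, $p\in\mathbb N^*$, $\beta\in C^0(\mathbb R^p,\mathbb R)$ and $\mathbf f\in C^0(\mathbb R^p,\mathbb R^d)$. Let $(\mathcal P^{(m)},\mathcal T^{(m)})_{m\in\mathbb N}$ be a sequence of (possibly non uniform) space-time discretisations with $\delta(\mathcal P^{(m)})\to0$ and $\delta t^{(m)}\to 0$ as $m\to+\infty$. For each $m$, let $U^{(m)}\in L^\infty(\Omega\times(0,T),\mathbb R^p)$ be the associated discrete function, and let $\{(\beta^{(m)})_P^n\}$ and $\{(\mathbf F^{(m)})_\zeta^n\}$ be the associated families of real numbers and of vectors of $\mathbb R^d$ defining the discrete convection operator $\mathcal C^{(m)}(U^{(m)})$ (see context). Suppose that: (a) there exists $C^u>0$ such that $\|U^{(m)}\|_\infty\le C^u$ for all $m\in\mathbb N$; (b) there exists $\bar U\in L^\infty(\Omega\times(0,T),\mathbb R^p)$ such that $\|U^{(m)}-\bar U\|_{L^1(\Omega\times(0,T),\mathbb R^p)}\to0$ as $m\to+\infty$; (c) the family $\{(\beta^{(m)})_P^n:\ P\in\mathcal P^{(m)},\ 0\le n\le N^{(m)}-1,\ m\in\mathbb N\}$ is bounded; (d) $U_0\in L^\infty(\Omega,\mathbb R^p)$ and, as $m\to+\infty$, $$\sum_{P\in\mathcal P_{\rm int}^{(m)}}\int_P\bigl((\beta^{(m)})_P^0-\beta(U_0)(\mathbf x)\bigr)\varphi(\mathbf x)\,d\mathbf x\to0\quad\text{for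 any }\varphi\in C_c^\infty(\Omega);$$ (e) as $m\to+\infty$, for any $\varphi\in C_c^\infty(\Omega\times[0,T))$, $$\sum_{n=1}^{N^{(m)}}\sum_{P\in\mathcal P_{\rm int}^{(m)}}\int_{t_{n-1}}^{t_n}\int_P\bigl((\beta^{(m)})_P^n-\beta(U^{(m)})(\mathbf x,t)\bigr)\varphi(\mathbf x,t)\,d\mathbf x\,dt\to0;$$ (f) as $m\to+\infty$, $$\sum_{n=0}^{N^{(m)}-1}\sum_{P\in\mathcal P_{\rm int}^{(m)}}\frac{\mathrm{diam}(P)}{|P|}\sum_{\zeta\in\mathfrak F(P)}|\zeta|\int_{t_n}^{t_{n+1}}\int_P\Bigl|\bigl((\mathbf F^{(m)})_\zeta^n-\mathbf f(U^{(m)})(\mathbf x,t)\bigr)\cdot\mathbf n_{P,\zeta}\Bigr|\,d\mathbf x\,dt\to0.$$ Then, for any $\varphi\in C_c^\infty(\Omega\times[0,T))$, as $m\to+\infty$, $$\int_0^T\!\!\int_\Omega\mathcal C^{(m)}(U^{(m)})(\mathbf x,t)\,\mathcal I^{(m)}(\varphi)(\mathbf x,t)\,d\mathbf x\,dt\ \to\ -\int_\Omega\beta(U_0)(\mathbf x)\,\varphi(\mathbf x,0)\,d\mathbf x-\int_0^T\!\!\int_\Omega\Bigl(\beta(\bar U)(\mathbf x,t)\,\partial_t\varphi(\mathbf x,t)+\mathbf f(\bar U)(\mathbf x,t)\cdot\nabla\varphi(\mathbf x,t)\Bigr)d\mathbf x\,dt.$$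
   Context: Meshes. A mesh $\mathcal P$ of $\Omega$ is a finite set of disjoint open polyhedral (polygonal if $d=2$, intervals if $d=1$) bounded subsets of $\Omega$, called cells, whose union of closures is $\overline\Omega$; any pair of adjacent cells shares a whole face (not only part of it). $\delta(\mathcal P)=\max_{P\in\mathcal P}\mathrm{diam}(P)$. $\mathfrak F$ is the set of faces (edges in 2D) of the mesh and $\mathfrak F(P)$ the set of faces of the cell $P$. $\mathcal P_{\rm int}$ is the set of cells of $\mathcal P$ having no face (or edge) on $\partial\Omega$. $|P|$ and $|\zeta|$ are the $d$-dimensional measure of $P$ and the $(d-1)$-dimensional measure of $\zeta$; $\mathbf n_{P,\zeta}$ is the unit normal to $\zeta$ outward to $P$. Time discretisation. $\mathcal T$ is a partition $0=t_0<t_1<\dots<t_N=T$ of $(0,T)$, with $\delta t=\max_{0\le n\le N-1}(t_{n+1}-t_n)$. A superscript $(m)$ indicates objects attached to the $m$-th discretisation (the dependence of $t_n$ and $\mathfrak F$ on $m$ is omitted). Discrete operator. The discrete function $U$ is an element of $L^\infty(\Omega\times(0,T),\mathbb R^p)$, not necessarily piecewise constant over the cells and time steps. Given real numbers $\{\beta_P^n:\ P\in\mathcal P,\ 0\le n\le N\}$ and vectors $\{\mathbf F_\zeta^n\in\mathbb R^d:\ \zeta\in\mathfrak F,\ 0\le n\le N-1\}$ (one vector per face, shared by the two adjacent cells), related to $U$ only through the hypotheses of the claim, define, for $P\in\mathcal P$ and $0\le n\le N-1$, $$\mathcal C(U)_P^n=(\eth_t\beta)_P^n+\frac1{|P|}\sum_{\zeta\in\mathfrak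 F(P)}|\zeta|\,\mathbf F_\zeta^n\cdot\mathbf n_{P,\zeta},\qquad(\eth_t\beta)_P^n=\frac{\beta_P^{n+1}-\beta_P^n}{t_{n+1}-t_n},$$ and $\mathcal C(U)(\mathbf x,t)=\mathcal C(U)_P^n$ for $\mathbf x\in P$, $t\in(t_n,t_{n+1})$. Interpolate. $\mathcal I^{(m)}(\varphi)(\mathbf x,t)=\varphi_P^n$ for $\mathbf x\in P$ and $t\in(t_n,t_{n+1})$, with $\varphi_P^n=\frac1{|P|}\int_P\varphi(\mathbf x,t_n)\,d\mathbf x$ for $P\in\mathcal P^{(m)}$, $0\le n\le N^{(m)}$. Notation. $\beta(U)$ and $\mathbf f(U)$ denote the compositions $\beta\circ U$ and $\mathbf f\circ U$. $C_c^\infty(\Omega\times[0,T))$ is the set of smooth functions with compact support in $\Omega\times[0,T)$ (so not necessarily vanishing at $t=0$). *)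

theory Defs
  imports "HOL-Analysis.Analysis" "HOL-Probability.Essential_Supremum"
begin

section \<open>Function spaces\<close>

abbreviation Linfty_norm :: "'a measure \<Rightarrow> ('a \<Rightarrow> 'b::real_normed_vector) \<Rightarrow> ereal"
  where "Linfty_norm M f \<equiv> esssup M (\<lambda>x. ereal (norm (f x)))"

definition Linfty :: "'a measure \<Rightarrow> ('a \<Rightarrow> 'b::real_normed_vector) set"
  where "Linfty M = {f \<in> borel_measurable M. Linfty_norm M f < \<infinity>}"

text \<open>Functions all of whose iterated directional derivatives up to order \<open>k\<close> exist and are
  continuous on the whole space.\<close>

primrec Ck :: "nat \<Rightarrow> ('a::real_normed_vector \<Rightarrow> real) \<Rightarrow> bool" where
  "Ck 0 \<phi> \<longleftrightarrow> continuous_on UNIV \<phi>"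
| "Ck (Suc k) \<phi> \<longleftrightarrow> (\<forall>x. \<phi> differentiable (at x)) \<and>
     (\<forall>v. Ck k (\<lambda>x. frechet_derivative \<phi> (at x) v))"

definition smooth :: "('a::real_normed_vector \<Rightarrow> real) \<Rightarrow> bool"
  where "smooth \<phi> \<longleftrightarrow> (\<forall>k. Ck k \<phi>)"

definition test_functions :: "(real^'d) set \<Rightarrow> (real^'d \<Rightarrow> real) set"
  where "test_functions \<Omega> =
    {\<phi>. smooth \<phi> \<and> (\<exists>K. compact K \<and> K \<subseteq> \<Omega> \<and> (\<forall>x. x \<notin> K \<longrightarrow> \<phi> x = 0))}"

text \<open>The space \<open>C\<^sub>c\<^sup>\<infinity>(\<Omega> \<times> [0,T))\<close>. Smoothness up to \<open>t = 0\<close> means being the restriction of a smooth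
  function; the support condition only concerns that restriction, so that the values of
  \<open>\<phi>\<close> outside \<open>\<Omega> \<times> [0,T)\<close> (in particular for negative times) are irrelevant.\<close>

definition spacetime_test_functions :: "(real^'d) set \<Rightarrow> real \<Rightarrow> ((real^'d) \<times> real \<Rightarrow> real) set"
  where "spacetime_test_functions \<Omega> T =
    {\<phi>. smooth \<phi> \<and> (\<exists>K. compact K \<and> K \<subseteq> \<Omega> \<times> {0..<T} \<and>
          (\<forall>z \<in> \<Omega> \<times> {0..<T} - K. \<phi> z = 0))}"

definition time_deriv :: "((real^'d) \<times> real \<Rightarrow> real) \<Rightarrow> (real^'d) \<times> real \<Rightarrow> real"
  where "time_deriv \<phi> z = deriv (\<lambda>s. \<phi> (fst z, s)) (snd z)"

definition space_grad :: "((real^'d) \<times> real \<Rightarrow> real) \<Rightarrow> (real^'d) \<times> real \<Rightarrow> real^'d"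
  where "space_grad \<phi> z =
    (\<chi> i. frechet_derivative (\<lambda>y. \<phi> (y, snd z)) (at (fst z)) (axis i 1))"

section \<open>Polyhedral meshes\<close>

text \<open>Cells need not be convex, so a face is a finite union of convex polytopes of codimension one
  lying in a common hyperplane.\<close>

definition flat_face :: "(real^'d) set \<Rightarrow> bool"
  where "flat_face \<zeta> \<longleftrightarrow> aff_dim \<zeta> = int CARD('d) - 1 \<and>
    (\<exists>\<K>. finite \<K> \<and> \<zeta> = \<Union>\<K> \<and> (\<forall>K\<in>\<K>. polytope K \<and> aff_dim K = int CARD('d) - 1))"

text \<open>The \<open>(d-1)\<close>-dimensional measure of a subset \<open>\<zeta>\<close> of a hyperplane. Lebesgue measure on
  \<open>\<real>\<^sup>d\<close> is the product of the measure of the hyperplane and of the length along its normal \<open>n\<close>, so the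
  measure of \<open>\<zeta>\<close> is that of the right prism of height one with base \<open>\<zeta>\<close>. If \<open>d = 1\<close>, a point
  has measure one.\<close>

definition face_measure :: "(real^'d) set \<Rightarrow> real"
  where "face_measure \<zeta> =
    (let n = (SOME n. norm n = 1 \<and> (\<forall>x\<in>\<zeta>. \<forall>y\<in>\<zeta>. n \<bullet> (x - y) = 0))
     in measure lebesgue {x + s *\<^sub>R n | x s. x \<in> \<zeta> \<and> s \<in> {0..1}})"

definition is_outward_normal :: "(real^'d) set \<Rightarrow> (real^'d) set \<Rightarrow> real^'d \<Rightarrow> bool"
  where "is_outward_normal P \<zeta> n \<longleftrightarrow> norm n = 1 \<and>
    (\<forall>x\<in>rel_interior \<zeta>. \<exists>r>0. P \<inter> ball x r = {y \<in> ball x r. n \<bullet> y < n \<bullet> x})"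

definition outward_normal :: "(real^'d) set \<Rightarrow> (real^'d) set \<Rightarrow> real^'d"
  where "outward_normal P \<zeta> = (THE n. is_outward_normal P \<zeta> n)"

text \<open>An open polyhedral cell \<open>P\<close> with set of faces \<open>\<Phi>\<close>. The faces are part of the data, because
  coplanar pieces of the boundary may be counted as different faces. For \<open>d = 1\<close> the cells are exactly
  the nonempty bounded open intervals and the faces their end points.\<close>

definition polyhedral_cell :: "(real^'d) set \<Rightarrow> (real^'d) set set \<Rightarrow> bool"
  where "polyhedral_cell P \<Phi> \<longleftrightarrow>
    P \<noteq> {} \<and> open P \<and> bounded P \<and> connected P \<and>
    finite \<Phi> \<and> frontier P = \<Union>\<Phi> \<and>
    (\<forall>\<zeta>\<in>\<Phi>. flat_face \<zeta> \<and> (\<exists>n. is_outward_normal P \<zeta> n))"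

text \<open>A mesh is given by its set \<open>\<P>\<close> of cells and by the map \<open>\<F>\<close> sending a cell to the set of its faces.
  The last condition says that two faces, of the same cell or of two different cells, are
  identical or do not overlap: adjacent cells share whole faces.\<close>

definition mesh :: "(real^'d) set \<Rightarrow> (real^'d) set set \<Rightarrow> ((real^'d) set \<Rightarrow> (real^'d) set set) \<Rightarrow> bool"
  where "mesh \<Omega> \<P> \<F> \<longleftrightarrow>
    finite \<P> \<and>
    (\<forall>P\<in>\<P>. polyhedral_cell P (\<F> P) \<and> P \<subseteq> \<Omega>) \<and>
    pairwise disjnt \<P> \<and>
    (\<Union>P\<in>\<P>. closure P) = closure \<Omega> \<and>
    pairwise (\<lambda>\<zeta> \<zeta>'. disjnt (rel_interior \<zeta>) (rel_interior \<zeta>')) (\<Union>P\<in>\<P>. \<F> P)"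

definition mesh_size :: "(real^'d) set set \<Rightarrow> real"
  where "mesh_size \<P> = Max (diameter ` \<P>)"

definition interior_cells ::
    "(real^'d) set \<Rightarrow> (real^'d) set set \<Rightarrow> ((real^'d) set \<Rightarrow> (real^'d) set set) \<Rightarrow> (real^'d) set set"
  where "interior_cells \<Omega> \<P> \<F> = {P \<in> \<P>. \<forall>\<zeta>\<in>\<F> P. \<not> \<zeta> \<subseteq> frontier \<Omega>}"

section \<open>Time discretisation and discrete operators\<close>

definition time_partition :: "real \<Rightarrow> nat \<Rightarrow> (nat \<Rightarrow> real) \<Rightarrow> bool"
  where "time_partition T N t \<longleftrightarrow>
    N \<ge> 1 \<and> t 0 = 0 \<and> t N = T \<and> (\<forall>n<N. t n < t (Suc n))"

definition time_step :: "nat \<Rightarrow> (nat \<Rightarrow> real) \<Rightarrow> real"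
  where "time_step N t = Max ((\<lambda>n. t (Suc n) - t n) ` {..<N})"

definition conv_coeff ::
    "((real^'d) set \<Rightarrow> (real^'d) set set) \<Rightarrow> (nat \<Rightarrow> real) \<Rightarrow>
     ((real^'d) set \<Rightarrow> nat \<Rightarrow> real) \<Rightarrow> ((real^'d) set \<Rightarrow> nat \<Rightarrow> real^'d) \<Rightarrow>
     (real^'d) set \<Rightarrow> nat \<Rightarrow> real"
  where "conv_coeff \<F> t b F P n =
    (b P (Suc n) - b P n) / (t (Suc n) - t n) +
    1 / measure lebesgue P *
      (\<Sum>\<zeta>\<in>\<F> P. face_measure \<zeta> * (F \<zeta> n \<bullet> outward_normal P \<zeta>))"

text \<open>The space-time function equal to \<open>c P n\<close> on \<open>P \<times> (t\<^sub>n, t\<^sub>n\<^sub>+\<^sub>1)\<close>. It is set to zero on the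
  remaining null set.\<close>

definition piecewise_const ::
    "(real^'d) set set \<Rightarrow> nat \<Rightarrow> (nat \<Rightarrow> real) \<Rightarrow> ((real^'d) set \<Rightarrow> nat \<Rightarrow> real) \<Rightarrow>
     (real^'d) \<times> real \<Rightarrow> real"
  where "piecewise_const \<P> N t c z =
    (\<Sum>n<N. \<Sum>P\<in>\<P>. c P n * indicator (P \<times> {t n<..<t (Suc n)}) z)"

definition conv_op ::
    "(real^'d) set set \<Rightarrow> ((real^'d) set \<Rightarrow> (real^'d) set set) \<Rightarrow> nat \<Rightarrow> (nat \<Rightarrow> real) \<Rightarrow>
     ((real^'d) set \<Rightarrow> nat \<Rightarrow> real) \<Rightarrow> ((real^'d) set \<Rightarrow> nat \<Rightarrow> real^'d) \<Rightarrow>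
     (real^'d) \<times> real \<Rightarrow> real"
  where "conv_op \<P> \<F> N t b F = piecewise_const \<P> N t (conv_coeff \<F> t b F)"

definition interpolate ::
    "(real^'d) set set \<Rightarrow> nat \<Rightarrow> (nat \<Rightarrow> real) \<Rightarrow> ((real^'d) \<times> real \<Rightarrow> real) \<Rightarrow>
     (real^'d) \<times> real \<Rightarrow> real"
  where "interpolate \<P> N t \<phi> = piecewise_const \<P> N t
    (\<lambda>P n. 1 / measure lebesgue P * (LINT x:P|lebesgue. \<phi> (x, t n)))"

end

theory Submission
  imports Defs
begin

text \<open>
  The scheme is tested with the interpolate of \<open>\<phi>\<close>. In time, a summation by parts
  (\<open>summation_by_parts\<close>) moves the difference quotients onto the cell averages of \<open>\<phi>\<close>, and produces
  exactly the integrals over the cells of \<open>\<phi>(\<cdot>,0)\<close> and of \<open>\<partial>\<^sub>t\<phi>\<close>. The assumption on the initial values and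
  the consistency of the discrete values of \<open>\<beta>\<close>, the latter applied to the test function \<open>\<partial>\<^sub>t\<phi>\<close>,
  replace the discrete values by \<open>\<beta>(U\<^sub>0)\<close> and \<open>\<beta>(U\<^sup>m)\<close>, up to errors that tend to zero.

  In space the cells may be arbitrarily flat and have small faces or many faces, so that an error of
  second order in the diameter, summed over the faces, would not be under control. Every replacement
  therefore has to be exact, or multiplied by the deviation of the fluxes from \<open>f(U)\<close>. As a face
  inside \<open>\<Omega>\<close> separates two cells with opposite normals, one may subtract from the average of \<open>\<phi>\<close> over
  a cell its exact average over each face (\<open>mesh_conservative\<close>). For a field \<open>w\<close> that is constant on the
  cell, the resulting sum over the faces equals \<open>- \<integral>\<^sub>P \<nabla>\<phi> \<bullet> w\<close> by the divergence theorem
  (\<open>divergence_polyhedral_cell\<close>). With \<open>w\<close> the mean of \<open>f(U)\<close> over the space-time cell, the error is the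
  deviation of the fluxes times the oscillation of \<open>\<phi>\<close>, which is of the order of the diameter
  (\<open>cell_flux_consistency\<close>); its sum is the quantity assumed to vanish. All this is collected in
  \<open>discrete_weak_formulation\<close>. The terms that remain are integrals of \<open>\<beta>(U\<^sup>m)\<close> and \<open>f(U\<^sup>m)\<close> against bounded
  functions that converge almost everywhere, and there the strong convergence of the bounded
  sequence \<open>U\<^sup>m\<close> suffices (\<open>tendsto_integral_composition\<close>). The cells at the boundary do not matter,
  because on fine meshes they miss the support of \<open>\<phi>\<close> (\<open>noninterior_cell_avoids\<close>).

  The divergence theorem is needed for cells that need not be convex, in the direction of an arbitrary
  vector \<open>v\<close>. Averaging \<open>\<partial>\<^sub>v g\<close> over the translates by \<open>s v\<close> with \<open>0 \<le> s \<le> 1\<close> turns the volume integral into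
  integrals along segments. Almost all lines of direction \<open>v\<close> cross the frontier transversally and in
  the relative interior of a face each time, and the fundamental theorem of calculus on such a line
  yields the values of \<open>g\<close> at the crossings (\<open>line_integral_polyhedral_cell\<close>). Since the integral over a
  face is defined by a volume integral over a right prism, integrating over all lines amounts to a
  comparison of right and slanted prisms (\<open>slanted_cylinder_integral\<close>), for which translations and the
  theorem of Tonelli suffice.
\<close>

section \<open>Cylinders over a hyperplane\<close>

lemma nn_integral_lborel_translate:
  fixes f :: "'a::euclidean_space \<Rightarrow> ennreal"
  assumes [measurable]: "f \<in> borel_measurable borel"
  shows "(\<integral>\<^sup>+x. f (x + u) \<partial>lborel) = (\<integral>\<^sup>+x. f x \<partial>lborel)"
proof -
  have "(\<integral>\<^sup>+x. f x \<partial>lborel) = (\<integral>\<^sup>+x. f x \<partial>(distr lborel borel ((+) u)))"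
    by (simp add: lborel_distr_plus)
  also have "\<dots> = (\<integral>\<^sup>+x. f (u + x) \<partial>lborel)"
    by (subst nn_integral_distr) auto
  finally show ?thesis by (simp add: add.commute)
qed

lemma nn_integral_lborel_swap:
  fixes f :: "real \<Rightarrow> 'a::euclidean_space \<Rightarrow> ennreal"
  assumes [measurable]: "case_prod f \<in> borel_measurable (borel \<Otimes>\<^sub>M borel)"
  shows "(\<integral>\<^sup>+s. (\<integral>\<^sup>+x. f s x \<partial>lborel) \<partial>lborel) = (\<integral>\<^sup>+x. (\<integral>\<^sup>+s. f s x \<partial>lborel) \<partial>lborel)"
  by (rule lborel_pair.Fubini'[symmetric]) (use assms in \<open>simp cong: measurable_cong_sets\<close>)

text \<open>The left-hand side is first averaged over a second, independent height, so that the two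
  heights are confined to \<open>[0,h]\<close> and \<open>[0,1]\<close>. A translation along \<open>w'\<close> exchanges their roles and leaves
  a shift of the foot point along \<open>w' - w\<close> by the height that has become independent of the point; this
  shift is a translation as well. Invariance under translations thus replaces the change of variables
  formula for a shear.\<close>

lemma cylinder_height_direction:
  fixes a w w' :: "'a::euclidean_space" and G :: "'a \<Rightarrow> ennreal"
  assumes aw: "a \<bullet> w = 1" "a \<bullet> w' = 1" and h: "0 \<le> h" and [measurable]: "G \<in> borel_measurable borel"
  shows "(\<integral>\<^sup>+x. indicator {0..h} (a \<bullet> x) * G (x - (a \<bullet> x) *\<^sub>R w) \<partial>lborel)
       = ennreal h * (\<integral>\<^sup>+x. indicator {0..1} (a \<bullet> x) * G (x - (a \<bullet> x) *\<^sub>R w') \<partial>lborel)"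
proof -
  let ?I = "indicator {0..1} :: real \<Rightarrow> ennreal" and ?H = "indicator {0..h} :: real \<Rightarrow> ennreal"
  define u where "u = w' - w"
  define p where "p s x = x - (a \<bullet> x) *\<^sub>R w' + s *\<^sub>R u" for s x
  have au: "a \<bullet> u = 0" using aw by (simp add: u_def inner_diff_right)
  have [measurable]: "(\<lambda>x. a \<bullet> x) \<in> borel_measurable borel" by simp
  have [measurable]: "(\<lambda>(s, x). p s x) \<in> borel_measurable (borel \<Otimes>\<^sub>M borel)" "p s \<in> borel_measurable borel" for s
    unfolding p_def by measurable
  have one: "(\<integral>\<^sup>+s. ?I (y - s) \<partial>lborel) = 1" for y
  proof -
    have "(\<lambda>s. ?I (y - s)) = indicator {y - 1..y}" by (auto simp: indicator_def fun_eq_iff)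
    then show ?thesis by simp
  qed
  have "(\<integral>\<^sup>+x. ?H (a \<bullet> x) * G (x - (a \<bullet> x) *\<^sub>R w) \<partial>lborel)
      = (\<integral>\<^sup>+x. (\<integral>\<^sup>+s. ?H (a \<bullet> x) * G (x - (a \<bullet> x) *\<^sub>R w) * ?I (a \<bullet> x - s) \<partial>lborel) \<partial>lborel)"
    by (subst nn_integral_cmult) (auto simp: one)
  also have "\<dots> = (\<integral>\<^sup>+s. (\<integral>\<^sup>+x. ?H (a \<bullet> x) * G (x - (a \<bullet> x) *\<^sub>R w) * ?I (a \<bullet> x - s) \<partial>lborel) \<partial>lborel)"
    by (rule nn_integral_lborel_swap[symmetric]) measurable
  also have "\<dots> = (\<integral>\<^sup>+s. (\<integral>\<^sup>+x. ?H (a \<bullet> x + s) * G (p (a \<bullet> x + s) x) * ?I (a \<bullet> x) \<partial>lborel) \<partial>lborel)"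
  proof (rule nn_integral_cong)
    fix s :: real
    have "x + s *\<^sub>R w' - (a \<bullet> x + s) *\<^sub>R w = p (a \<bullet> x + s) x" for x
      by (simp add: p_def u_def algebra_simps)
    then show "(\<integral>\<^sup>+x. ?H (a \<bullet> x) * G (x - (a \<bullet> x) *\<^sub>R w) * ?I (a \<bullet> x - s) \<partial>lborel)
        = (\<integral>\<^sup>+x. ?H (a \<bullet> x + s) * G (p (a \<bullet> x + s) x) * ?I (a \<bullet> x) \<partial>lborel)"
      using nn_integral_lborel_translate[where u = "s *\<^sub>R w'" and
          f = "\<lambda>x. ?H (a \<bullet> x) * G (x - (a \<bullet> x) *\<^sub>R w) * ?I (a \<bullet> x - s)"]
      by (simp add: inner_add_right aw)
  qed
  also have "\<dots> = (\<integral>\<^sup>+x. (\<integral>\<^sup>+s. ?H (a \<bullet> x + s) * G (p (a \<bullet> x + s) x) * ?I (a \<bullet> x) \<partial>lborel) \<partial>lborel)"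
    by (rule nn_integral_lborel_swap) measurable
  also have "\<dots> = (\<integral>\<^sup>+x. (\<integral>\<^sup>+s. ?H s * (G (p s x) * ?I (a \<bullet> x)) \<partial>lborel) \<partial>lborel)"
  proof (rule nn_integral_cong)
    fix x :: 'a
    show "(\<integral>\<^sup>+s. ?H (a \<bullet> x + s) * G (p (a \<bullet> x + s) x) * ?I (a \<bullet> x) \<partial>lborel)
        = (\<integral>\<^sup>+s. ?H s * (G (p s x) * ?I (a \<bullet> x)) \<partial>lborel)"
      using nn_integral_lborel_translate[where u = "a \<bullet> x" and f = "\<lambda>s. ?H s * (G (p s x) * ?I (a \<bullet> x))"]
      by (simp add: p_def add.commute mult.assoc)
  qed
  also have "\<dots> = (\<integral>\<^sup>+s. (\<integral>\<^sup>+x. ?H s * (G (p s x) * ?I (a \<bullet> x)) \<partial>lborel) \<partial>lborel)"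
    by (rule nn_integral_lborel_swap[symmetric]) measurable
  also have "\<dots> = (\<integral>\<^sup>+s. ?H s * (\<integral>\<^sup>+x. ?I (a \<bullet> x) * G (x - (a \<bullet> x) *\<^sub>R w') \<partial>lborel) \<partial>lborel)"
  proof (rule nn_integral_cong)
    fix s :: real
    have "(\<integral>\<^sup>+x. G (p s x) * ?I (a \<bullet> x) \<partial>lborel) = (\<integral>\<^sup>+x. ?I (a \<bullet> x) * G (x - (a \<bullet> x) *\<^sub>R w') \<partial>lborel)"
      using nn_integral_lborel_translate[where u = "s *\<^sub>R u" and
          f = "\<lambda>x. ?I (a \<bullet> x) * G (x - (a \<bullet> x) *\<^sub>R w')"]
      by (simp add: p_def inner_add_right au add_diff_eq diff_add_eq mult.commute)
    moreover have "(\<integral>\<^sup>+x. ?H s * (G (p s x) * ?I (a \<bullet> x)) \<partial>lborel) = ?H s * (\<integral>\<^sup>+x. G (p s x) * ?I (a \<bullet> x) \<partial>lborel)"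
      by (rule nn_integral_cmult) measurable
    ultimately show "(\<integral>\<^sup>+x. ?H s * (G (p s x) * ?I (a \<bullet> x)) \<partial>lborel)
        = ?H s * (\<integral>\<^sup>+x. ?I (a \<bullet> x) * G (x - (a \<bullet> x) *\<^sub>R w') \<partial>lborel)" by simp
  qed
  also have "\<dots> = ennreal h * (\<integral>\<^sup>+x. ?I (a \<bullet> x) * G (x - (a \<bullet> x) *\<^sub>R w') \<partial>lborel)"
    using h by (subst nn_integral_multc) auto
  finally show ?thesis .
qed

text \<open>Rescaling \<open>w\<close> to height one gives the factor \<open>\<bar>n \<bullet> w\<bar>\<close>, after which the direction may
  be turned to the normal \<open>n\<close>.\<close>

lemma slanted_cylinder_nn_integral:
  fixes n w :: "'a::euclidean_space" and G :: "'a \<Rightarrow> ennreal"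
  assumes n: "norm n = 1" and nw: "n \<bullet> w \<noteq> 0" and G [measurable]: "G \<in> borel_measurable borel"
  shows "(\<integral>\<^sup>+x. indicator {0..1} ((n \<bullet> x - c) / (n \<bullet> w)) * G (x - ((n \<bullet> x - c) / (n \<bullet> w)) *\<^sub>R w) \<partial>lborel)
       = ennreal \<bar>n \<bullet> w\<bar> * (\<integral>\<^sup>+x. indicator {0..1} (n \<bullet> x - c) * G (x - (n \<bullet> x - c) *\<^sub>R n) \<partial>lborel)"
proof -
  have nn: "n \<bullet> n = 1" using n by (simp add: norm_eq_1)
  have meas [measurable]: "(\<lambda>x. b \<bullet> x) \<in> borel_measurable borel" for b :: 'a by simp
  let ?I = "indicator {0..1} :: real \<Rightarrow> ennreal"
  define H where "H y = G (y + c *\<^sub>R n)" for y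
  have H [measurable]: "H \<in> borel_measurable borel" unfolding H_def by measurable
  have shift: "(\<integral>\<^sup>+x. ?I ((n \<bullet> x - c) / (n \<bullet> u)) * G (x - ((n \<bullet> x - c) / (n \<bullet> u)) *\<^sub>R u) \<partial>lborel)
      = (\<integral>\<^sup>+x. ?I ((n \<bullet> x) / (n \<bullet> u)) * H (x - ((n \<bullet> x) / (n \<bullet> u)) *\<^sub>R u) \<partial>lborel)" for u
    using nn_integral_lborel_translate[where u = "c *\<^sub>R n" and
        f = "\<lambda>x. ?I ((n \<bullet> x - c) / (n \<bullet> u)) * G (x - ((n \<bullet> x - c) / (n \<bullet> u)) *\<^sub>R u)"]
    by (simp add: inner_add_right nn H_def add_diff_eq add.commute)
  have main: "(\<integral>\<^sup>+x. ?I ((a \<bullet> x) / (a \<bullet> w)) * H (x - ((a \<bullet> x) / (a \<bullet> w)) *\<^sub>R w) \<partial>lborel)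
      = ennreal (a \<bullet> w) * (\<integral>\<^sup>+x. ?I (a \<bullet> x) * H (x - (a \<bullet> x) *\<^sub>R a) \<partial>lborel)"
    if aw: "a \<bullet> w > 0" and aa: "a \<bullet> a = 1" for a
  proof -
    let ?w = "(1 / (a \<bullet> w)) *\<^sub>R w"
    have "(\<integral>\<^sup>+x. ?I ((a \<bullet> x) / (a \<bullet> w)) * H (x - ((a \<bullet> x) / (a \<bullet> w)) *\<^sub>R w) \<partial>lborel)
        = (\<integral>\<^sup>+x. indicator {0..a \<bullet> w} (a \<bullet> x) * H (x - (a \<bullet> x) *\<^sub>R ?w) \<partial>lborel)"
      using aw by (intro nn_integral_cong) (auto simp: indicator_def field_simps)
    also have "\<dots> = ennreal (a \<bullet> w) * (\<integral>\<^sup>+x. ?I (a \<bullet> x) * H (x - (a \<bullet> x) *\<^sub>R a) \<partial>lborel)"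
      using aw aa by (intro cylinder_height_direction) auto
    finally show ?thesis .
  qed
  have "(\<integral>\<^sup>+x. ?I ((n \<bullet> x) / (n \<bullet> w)) * H (x - ((n \<bullet> x) / (n \<bullet> w)) *\<^sub>R w) \<partial>lborel)
      = ennreal \<bar>n \<bullet> w\<bar> * (\<integral>\<^sup>+x. ?I (n \<bullet> x) * H (x - (n \<bullet> x) *\<^sub>R n) \<partial>lborel)"
  proof (cases "n \<bullet> w > 0")
    case True
    then show ?thesis using main[OF True nn] by simp
  next
    case False
    (* The unit slabs on the two sides of the hyperplane are translates of each other. *)
    have "(\<integral>\<^sup>+x. ?I (- (n \<bullet> x)) * H (x - (n \<bullet> x) *\<^sub>R n) \<partial>lborel)
        = (\<integral>\<^sup>+x. ?I (1 - n \<bullet> x) * H (x - (n \<bullet> x) *\<^sub>R n) \<partial>lborel)"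
      using nn_integral_lborel_translate[where u = "- n" and
          f = "\<lambda>x. ?I (- (n \<bullet> x)) * H (x - (n \<bullet> x) *\<^sub>R n)"]
      by (simp add: inner_diff_right nn algebra_simps)
    also have "\<dots> = (\<integral>\<^sup>+x. ?I (n \<bullet> x) * H (x - (n \<bullet> x) *\<^sub>R n) \<partial>lborel)"
      by (intro nn_integral_cong) (auto simp: indicator_def)
    finally show ?thesis using main[of "- n"] False nw nn by simp
  qed
  then show ?thesis using shift[of w] shift[of n] by (simp add: nn)
qed

text \<open>The case of nonnegative integrands says that the projections of the two cylinders to the
  hyperplane have proportional image measures, which settles real integrands as well.\<close>

lemma slanted_cylinder_integral:
  fixes n w :: "'a::euclidean_space" and g :: "'a \<Rightarrow> real"
  assumes n: "norm n = 1" and nw: "n \<bullet> w \<noteq> 0" and g [measurable]: "g \<in> borel_measurable borel"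
  shows "(LINT x|lborel. indicator {0..1} ((n \<bullet> x - c) / (n \<bullet> w)) * g (x - ((n \<bullet> x - c) / (n \<bullet> w)) *\<^sub>R w))
       = \<bar>n \<bullet> w\<bar> * (LINT x|lborel. indicator {0..1} (n \<bullet> x - c) * g (x - (n \<bullet> x - c) *\<^sub>R n))"
proof -
  have nn: "n \<bullet> n = 1" using n by (simp add: norm_eq_1)
  have meas [measurable]: "(\<lambda>x. b \<bullet> x) \<in> borel_measurable borel" for b :: 'a by simp
  define f where "f u x = (indicator {0..1} ((n \<bullet> x - c) / (n \<bullet> u)) :: real)" for u x
  define \<pi> where "\<pi> u x = x - ((n \<bullet> x - c) / (n \<bullet> u)) *\<^sub>R u" for u x
  define M where "M u = distr (density lborel (\<lambda>x. ennreal (f u x))) borel (\<pi> u)" for u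
  have [measurable]: "f u \<in> borel_measurable borel" "\<pi> u \<in> borel_measurable borel" for u
    unfolding f_def \<pi>_def by measurable
  have f: "ennreal (f u x) = indicator {0..1} ((n \<bullet> x - c) / (n \<bullet> u))" for u x
    by (simp add: f_def indicator_def)
  have em: "emeasure (M u) A = (\<integral>\<^sup>+x. indicator {0..1} ((n \<bullet> x - c) / (n \<bullet> u)) * indicator A (\<pi> u x) \<partial>lborel)"
    if [measurable]: "A \<in> sets borel" for A u
  proof -
    have "emeasure (M u) A = (\<integral>\<^sup>+y. indicator A y \<partial>M u)" by (simp add: M_def)
    also have "\<dots> = (\<integral>\<^sup>+x. indicator A (\<pi> u x) \<partial>density lborel (\<lambda>x. ennreal (f u x)))"
      unfolding M_def by (rule nn_integral_distr) auto
    also have "\<dots> = (\<integral>\<^sup>+x. ennreal (f u x) * indicator A (\<pi> u x) \<partial>lborel)"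
      by (rule nn_integral_density) auto
    finally show ?thesis by (simp add: f)
  qed
  have "M w = density (M n) (\<lambda>_. ennreal \<bar>n \<bullet> w\<bar>)"
  proof (rule measure_eqI)
    fix A assume "A \<in> sets (M w)"
    then have A [measurable]: "A \<in> sets borel" by (simp add: M_def)
    have "emeasure (M w) A = ennreal \<bar>n \<bullet> w\<bar> * emeasure (M n) A"
      unfolding em[OF A] \<pi>_def
      using slanted_cylinder_nn_integral[OF n nw, of "indicator A" c] by (simp add: nn)
    then show "emeasure (M w) A = emeasure (density (M n) (\<lambda>_. ennreal \<bar>n \<bullet> w\<bar>)) A"
      by (subst emeasure_density) (auto simp: M_def nn_integral_cmult_indicator)
  qed (simp add: M_def)
  then have "(LINT y|M w. g y) = \<bar>n \<bullet> w\<bar> * (LINT y|M n. g y)"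
    by (simp add: integral_density M_def)
  moreover have "(LINT y|M u. g y) = (LINT x|lborel. f u x * g (\<pi> u x))" for u
    unfolding M_def by (subst integral_distr, measurable, subst integral_density) (auto simp: f_def)
  ultimately show ?thesis by (simp add: f_def \<pi>_def nn)
qed

text \<open>The lines of direction \<open>v\<close> through \<open>S\<close> stay in the affine hull of \<open>S\<close> and one further
  point, hence in a hyperplane.\<close>

lemma negligible_cylinder:
  fixes S :: "'a::euclidean_space set"
  assumes "aff_dim S < int DIM('a) - 1"
  shows "negligible {x. \<exists>s. x + s *\<^sub>R v \<in> S}"
proof (cases "S = {}")
  case False
  then obtain a where a: "a \<in> S" by blast
  define S' where "S' = insert (a + v) S"
  have "aff_dim S' < int DIM('a)"
    using assms by (simp add: S'_def aff_dim_insert)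
  then obtain n c where n: "n \<noteq> 0" "S' \<subseteq> {x. n \<bullet> x = c}"
    by (rule aff_lowdim_subset_hyperplane)
  then have "n \<bullet> v = 0" using a by (auto simp: S'_def inner_add_right)
  then have "{x. \<exists>s. x + s *\<^sub>R v \<in> S} \<subseteq> {x. n \<bullet> x = c}"
    using n by (auto simp: S'_def inner_add_right)
  then show ?thesis using negligible_hyperplane n(1) negligible_subset by blast
qed simp

section \<open>Flat faces, their normals and integrals over them\<close>

definition unit_normal :: "(real^'d) set \<Rightarrow> real^'d \<Rightarrow> bool"
  where "unit_normal \<zeta> n \<longleftrightarrow> norm n = 1 \<and> (\<forall>x\<in>\<zeta>. \<forall>y\<in>\<zeta>. n \<bullet> (x - y) = 0)"

text \<open>The integral for the surface measure of \<open>\<zeta>\<close>, realised by a volume integral in the same way as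
  \<open>face_measure\<close>: the values of \<open>g\<close> on \<open>\<zeta>\<close> are extended to the right prism of height one by
  constancy along the normal.\<close>

definition face_integral :: "(real^'d) set \<Rightarrow> (real^'d \<Rightarrow> real) \<Rightarrow> real"
  where "face_integral \<zeta> g =
    (let n = (SOME n. unit_normal \<zeta> n); h = (\<lambda>x. n \<bullet> x - n \<bullet> (SOME a. a \<in> \<zeta>))
     in LINT x|lborel. indicator {0..1} (h x) * (indicator \<zeta> (x - h x *\<^sub>R n) * g (x - h x *\<^sub>R n)))"

lemma flat_face_nonempty: "flat_face \<zeta> \<Longrightarrow> \<zeta> \<noteq> {}"
  by (auto simp: flat_face_def)

lemma flat_face_compact:
  assumes "flat_face \<zeta>" shows "compact \<zeta>"
proof -
  obtain \<K> where "finite \<K>" "\<zeta> = \<Union>\<K>" "\<forall>K\<in>\<K>. polytope K"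
    using assms unfolding flat_face_def by blast
  then show ?thesis using compact_Union polytope_imp_compact by blast
qed

lemma flat_face_hyperplane:
  fixes \<zeta> :: "(real^'d) set"
  assumes "flat_face \<zeta>"
  obtains n c where "n \<noteq> 0" "affine hull \<zeta> = {x. n \<bullet> x = c}"
proof -
  have "aff_dim \<zeta> = int (DIM(real^'d) - 1)" using assms by (simp add: flat_face_def of_nat_diff)
  then have "\<exists>n c. n \<noteq> 0 \<and> affine hull \<zeta> = {x. n \<bullet> x = c}" by (simp only: aff_dim_eq_hyperplane)
  then show ?thesis using that by blast
qed

lemma unit_normal_exists:
  assumes "flat_face \<zeta>" shows "\<exists>n. unit_normal \<zeta> n"
proof -
  obtain n c where n: "n \<noteq> 0" "affine hull \<zeta> = {x. n \<bullet> x = c}"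
    using flat_face_hyperplane[OF assms] .
  have "n \<bullet> x = c" if "x \<in> \<zeta>" for x using n(2) hull_inc[OF that, of affine] by auto
  then have "n \<bullet> (x - y) = 0" if "x \<in> \<zeta>" "y \<in> \<zeta>" for x y using that by (simp add: inner_diff_right)
  then have "\<forall>x\<in>\<zeta>. \<forall>y\<in>\<zeta>. (n /\<^sub>R norm n) \<bullet> (x - y) = 0" by (metis inner_scaleR_left mult_zero_right)
  moreover have "norm (n /\<^sub>R norm n) = 1" using n(1) by simp
  ultimately have "unit_normal \<zeta> (n /\<^sub>R norm n)" unfolding unit_normal_def by blast
  then show ?thesis by blast
qed

lemma unit_normal_const: "unit_normal \<zeta> n \<Longrightarrow> x \<in> \<zeta> \<Longrightarrow> y \<in> \<zeta> \<Longrightarrow> n \<bullet> x = n \<bullet> y"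
  unfolding unit_normal_def by (metis inner_diff_right right_minus_eq)

lemma unit_normal_affine_hull:
  assumes "unit_normal \<zeta> n" "a \<in> \<zeta>" "x \<in> affine hull \<zeta>"
  shows "n \<bullet> x = n \<bullet> a"
proof -
  have "\<zeta> \<subseteq> {x. n \<bullet> x = n \<bullet> a}"
    using unit_normal_const[OF assms(1) _ assms(2)] by blast
  then have "affine hull \<zeta> \<subseteq> {x. n \<bullet> x = n \<bullet> a}"
    by (intro hull_minimal affine_hyperplane)
  then show ?thesis using assms by auto
qed

lemma unit_normal_unique:
  assumes \<zeta>: "flat_face \<zeta>" and n: "unit_normal \<zeta> n" and n': "unit_normal \<zeta> n'"
  shows "n' = n \<or> n' = - n"
proof -
  obtain m c where m: "m \<noteq> 0" "affine hull \<zeta> = {x. m \<bullet> x = c}"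
    using flat_face_hyperplane[OF \<zeta>] .
  obtain a where a: "a \<in> \<zeta>" using flat_face_nonempty[OF \<zeta>] by blast
  then have ma: "m \<bullet> a = c" using m(2) hull_inc[OF a, of affine] by auto
  have par: "k = ((k \<bullet> m) / (m \<bullet> m)) *\<^sub>R m" if k: "unit_normal \<zeta> k" for k
  proof -
    define z where "z = k - ((k \<bullet> m) / (m \<bullet> m)) *\<^sub>R m"
    have "m \<bullet> z = 0" using m(1) by (simp add: z_def inner_diff_right inner_commute)
    then have "a + z \<in> affine hull \<zeta>" using m(2) ma by (simp add: inner_add_right)
    then have "k \<bullet> z = 0"
      using unit_normal_affine_hull[OF k a] by (force simp: inner_add_right)
    then have "z \<bullet> z = 0" using \<open>m \<bullet> z = 0\<close> by (simp add: z_def inner_diff_left inner_diff_right inner_commute)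
    then show ?thesis by (simp add: z_def)
  qed
  have "\<bar>(k \<bullet> m) / (m \<bullet> m)\<bar> * norm m = 1" if k: "unit_normal \<zeta> k" for k
  proof -
    have "norm k = \<bar>(k \<bullet> m) / (m \<bullet> m)\<bar> * norm m"
      using arg_cong[OF par[OF k], of norm] by (simp only: norm_scaleR)
    then show ?thesis using k by (simp only: unit_normal_def)
  qed
  from this[OF n] this[OF n'] have "\<bar>(n' \<bullet> m) / (m \<bullet> m)\<bar> = \<bar>(n \<bullet> m) / (m \<bullet> m)\<bar>"
    using m(1) by (metis mult_right_cancel norm_eq_zero)
  then have "(n' \<bullet> m) / (m \<bullet> m) = (n \<bullet> m) / (m \<bullet> m) \<or> (n' \<bullet> m) / (m \<bullet> m) = - ((n \<bullet> m) / (m \<bullet> m))"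
    by (simp only: abs_eq_iff)
  then have "((n' \<bullet> m) / (m \<bullet> m)) *\<^sub>R m = ((n \<bullet> m) / (m \<bullet> m)) *\<^sub>R m \<or>
      ((n' \<bullet> m) / (m \<bullet> m)) *\<^sub>R m = - (((n \<bullet> m) / (m \<bullet> m)) *\<^sub>R m)"
    by (metis scaleR_minus_left)
  then show ?thesis unfolding par[OF n, symmetric] par[OF n', symmetric] .
qed

text \<open>The sets in \<open>\<E>\<close> are the facets of the convex pieces of \<open>\<zeta>\<close>. All pieces span the same
  hyperplane as \<open>\<zeta>\<close>, so that their relative interiors lie in that of \<open>\<zeta>\<close>.\<close>

lemma flat_face_rel_interior:
  fixes \<zeta> :: "(real^'d) set"
  assumes "flat_face \<zeta>"
  obtains \<E> where "finite \<E>" "\<And>E. E \<in> \<E> \<Longrightarrow> aff_dim E < int CARD('d) - 1"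
    "\<zeta> - rel_interior \<zeta> \<subseteq> \<Union>\<E>" "\<zeta> \<subseteq> closure (rel_interior \<zeta>)"
proof -
  obtain \<K> where \<K>: "finite \<K>" "\<zeta> = \<Union>\<K>" "\<And>K. K \<in> \<K> \<Longrightarrow> polytope K"
    "\<And>K. K \<in> \<K> \<Longrightarrow> aff_dim K = int CARD('d) - 1"
    using assms unfolding flat_face_def by blast
  have sub: "rel_interior K \<subseteq> rel_interior \<zeta>" if K: "K \<in> \<K>" for K
  proof (rule subset_rel_interior)
    show "K \<subseteq> \<zeta>" using \<K>(2) K by auto
    show "affine hull K = affine hull \<zeta>"
    proof (rule affine_dim_equal)
      show "affine hull K \<subseteq> affine hull \<zeta>" using \<open>K \<subseteq> \<zeta>\<close> by (rule hull_mono)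
      show "aff_dim (affine hull K) = aff_dim (affine hull \<zeta>)"
        using \<K>(4)[OF K] assms by (simp add: flat_face_def)
      show "affine hull K \<noteq> {}" using \<K>(4)[OF K] by auto
    qed auto
  qed
  define \<E> where "\<E> = (\<Union>K\<in>\<K>. {E. E facet_of K})"
  show thesis
  proof
    show "finite \<E>" unfolding \<E>_def using \<K>
      by (auto intro!: finite_polytope_facets)
    show "aff_dim E < int CARD('d) - 1" if "E \<in> \<E>" for E
      using that \<K>(4) by (auto simp: \<E>_def facet_of_def)
    show "\<zeta> - rel_interior \<zeta> \<subseteq> \<Union>\<E>"
    proof
      fix x assume x: "x \<in> \<zeta> - rel_interior \<zeta>"
      then obtain K where K: "K \<in> \<K>" "x \<in> K" using \<K>(2) by auto
      have "x \<notin> rel_interior K" using x sub[OF K(1)] by auto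
      then have "x \<in> rel_frontier K" using K closure_subset by (auto simp: rel_frontier_def)
      moreover have "rel_frontier K = \<Union>{F. F facet_of K}"
        by (intro rel_frontier_of_polyhedron polytope_imp_polyhedron \<K>(3) K(1))
      ultimately show "x \<in> \<Union>\<E>" using K by (auto simp: \<E>_def)
    qed
    show "\<zeta> \<subseteq> closure (rel_interior \<zeta>)"
    proof
      fix x assume "x \<in> \<zeta>"
      then obtain K where K: "K \<in> \<K>" "x \<in> K" using \<K>(2) by auto
      have "closure (rel_interior K) = closure K"
        using \<K>(3)[OF K(1)] by (intro convex_closure_rel_interior polytope_imp_convex)
      then have "x \<in> closure (rel_interior K)" using K closure_subset by auto
      then show "x \<in> closure (rel_interior \<zeta>)" using closure_mono[OF sub[OF K(1)]] by auto
    qed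
  qed
qed

lemma rel_interior_flat_face_nonempty: "flat_face \<zeta> \<Longrightarrow> rel_interior \<zeta> \<noteq> {}"
proof -
  assume \<zeta>: "flat_face \<zeta>"
  then obtain \<E> where "\<zeta> \<subseteq> closure (rel_interior \<zeta>)" by (rule flat_face_rel_interior)
  then show ?thesis using flat_face_nonempty[OF \<zeta>] by auto
qed

lemma negligible_lines_through_edges:
  assumes "flat_face \<zeta>"
  shows "negligible {x. \<exists>s. x + s *\<^sub>R v \<in> \<zeta> - rel_interior \<zeta>}"
proof -
  obtain \<E> where \<E>: "finite \<E>" "\<And>E. E \<in> \<E> \<Longrightarrow> aff_dim E < int CARD('a) - 1"
    "\<zeta> - rel_interior \<zeta> \<subseteq> \<Union>\<E>" by (rule flat_face_rel_interior[OF assms]) blast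
  have "negligible (\<Union>E\<in>\<E>. {x. \<exists>s. x + s *\<^sub>R v \<in> E})"
    using \<E> by (intro negligible_Union) (auto intro!: negligible_cylinder)
  then show ?thesis by (rule negligible_subset) (use \<E>(3) in blast)
qed

lemma negligible_lines_in_face:
  assumes "unit_normal \<zeta> n" "n \<bullet> v = 0"
  shows "negligible {x. \<exists>s. x + s *\<^sub>R v \<in> \<zeta>}"
proof (cases "\<zeta> = {}")
  case False
  then obtain a where a: "a \<in> \<zeta>" by blast
  have "{x. \<exists>s. x + s *\<^sub>R v \<in> \<zeta>} \<subseteq> {x. n \<bullet> x = n \<bullet> a}"
    using unit_normal_const[OF assms(1) _ a] assms(2) by (force simp: inner_add_right)
  moreover have "n \<noteq> 0" using assms by (auto simp: unit_normal_def)
  ultimately show ?thesis using negligible_hyperplane negligible_subset by blast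
qed simp

lemma negligible_flat_face:
  assumes "flat_face \<zeta>" shows "negligible \<zeta>"
proof -
  obtain n where n: "unit_normal \<zeta> n" using unit_normal_exists[OF assms] ..
  show ?thesis using negligible_lines_in_face[OF n, of 0] by simp
qed

text \<open>Slanting the prism over \<open>\<zeta>\<close> from the normal to the direction \<open>w\<close> keeps the foot points and
  changes the height to \<open>\<bar>n \<bullet> w\<bar>\<close>. Both orientations of the normal are allowed here, whereas the
  definition of the face integral fixes one of them.\<close>

lemma face_integral_slanted:
  fixes \<zeta> :: "(real^'d) set"
  assumes \<zeta>: "flat_face \<zeta>" and n: "unit_normal \<zeta> n" and a: "a \<in> \<zeta>" and nw: "n \<bullet> w \<noteq> 0"
    and g: "g \<in> borel_measurable borel"
  shows "(LINT x|lborel. indicator {0..1} ((n \<bullet> x - n \<bullet> a) / (n \<bullet> w)) *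
        (indicator \<zeta> (x - ((n \<bullet> x - n \<bullet> a) / (n \<bullet> w)) *\<^sub>R w) * g (x - ((n \<bullet> x - n \<bullet> a) / (n \<bullet> w)) *\<^sub>R w)))
    = \<bar>n \<bullet> w\<bar> * face_integral \<zeta> g"
proof -
  define m where "m = (SOME n. unit_normal \<zeta> n)"
  define a' where "a' = (SOME a. a \<in> \<zeta>)"
  have m: "unit_normal \<zeta> m" unfolding m_def using unit_normal_exists[OF \<zeta>] by (rule someI_ex)
  have a': "a' \<in> \<zeta>" unfolding a'_def using a by (rule someI)
  have ma: "m \<bullet> a' = m \<bullet> a" using unit_normal_const[OF m a' a] .
  have \<zeta>b: "\<zeta> \<in> sets borel" using flat_face_compact[OF \<zeta>] by (rule borel_compact)
  have mn: "m = n \<or> m = - n" using unit_normal_unique[OF \<zeta> n m] .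
  then have mw: "m \<bullet> w \<noteq> 0" "\<bar>m \<bullet> w\<bar> = \<bar>n \<bullet> w\<bar>" using nw by auto
  have eq: "(m \<bullet> x - m \<bullet> a) / (m \<bullet> w) = (n \<bullet> x - n \<bullet> a) / (n \<bullet> w)" for x
  proof -
    have "(- p) / (- q) = p / q" for p q :: real by simp
    from this[of "n \<bullet> x - n \<bullet> a" "n \<bullet> w"] show ?thesis using mn by auto
  qed
  have meas: "(\<lambda>x. indicator \<zeta> x * g x) \<in> borel_measurable borel"
    using \<zeta>b g by measurable
  have "norm m = 1" using m by (simp add: unit_normal_def)
  from slanted_cylinder_integral[OF this mw(1) meas, of "m \<bullet> a"]
  show ?thesis unfolding face_integral_def Let_def m_def[symmetric] a'_def[symmetric] ma eq mw(2) .
qed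

lemma face_prism:
  assumes n: "unit_normal \<zeta> n" and a: "a \<in> \<zeta>"
  shows "{x + s *\<^sub>R n | x s. x \<in> \<zeta> \<and> s \<in> {0..1}}
    = {x. n \<bullet> x - n \<bullet> a \<in> {0..1} \<and> x - (n \<bullet> x - n \<bullet> a) *\<^sub>R n \<in> \<zeta>}" (is "?A = ?B")
proof (intro subset_antisym subsetI)
  have nn: "n \<bullet> n = 1" using n by (simp add: unit_normal_def norm_eq_1)
  fix y assume "y \<in> ?A"
  then obtain x s where y: "y = x + s *\<^sub>R n" "x \<in> \<zeta>" "s \<in> {0..1}" by blast
  then have "n \<bullet> y - n \<bullet> a = s"
    using unit_normal_const[OF n _ a] nn by (simp add: inner_add_right)
  then show "y \<in> ?B" using y by simp
next
  fix y assume "y \<in> ?B"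
  then show "y \<in> ?A"
    by (intro CollectI exI[of _ "y - (n \<bullet> y - n \<bullet> a) *\<^sub>R n"] exI[of _ "n \<bullet> y - n \<bullet> a"]) auto
qed

lemma compact_prism:
  fixes \<zeta> :: "'a::real_normed_vector set"
  assumes "compact \<zeta>"
  shows "compact {x + s *\<^sub>R n | x s. x \<in> \<zeta> \<and> s \<in> {0..1::real}}"
proof -
  have "{x + s *\<^sub>R n | x s. x \<in> \<zeta> \<and> s \<in> {0..1}} = (\<lambda>(x, s). x + s *\<^sub>R n) ` (\<zeta> \<times> {0..1})"
    by force
  then show ?thesis
    using assms
    by (simp, intro compact_continuous_image compact_Times)
      (simp_all add: case_prod_unfold continuous_intros)
qed

text \<open>The foot points of the prism lie in \<open>\<zeta>\<close>, and the volume of the prism is \<open>face_measure \<zeta>\<close>.\<close>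

lemma face_integral_approx:
  fixes g :: "real^'d \<Rightarrow> real"
  assumes \<zeta>: "flat_face \<zeta>" and g: "continuous_on UNIV g" and close: "\<And>x. x \<in> \<zeta> \<Longrightarrow> \<bar>g x - k\<bar> \<le> e"
  shows "\<bar>face_integral \<zeta> g - k * face_measure \<zeta>\<bar> \<le> e * face_measure \<zeta>"
proof -
  define n where "n = (SOME n. unit_normal \<zeta> n)"
  define a where "a = (SOME a. a \<in> \<zeta>)"
  have n: "unit_normal \<zeta> n" unfolding n_def using unit_normal_exists[OF \<zeta>] by (rule someI_ex)
  have a: "a \<in> \<zeta>" unfolding a_def using flat_face_nonempty[OF \<zeta>] by (simp add: some_in_eq)
  define S where "S = {x + s *\<^sub>R n | x s. x \<in> \<zeta> \<and> s \<in> {0..1::real}}"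
  define \<pi> where "\<pi> x = x - (n \<bullet> x - n \<bullet> a) *\<^sub>R n" for x
  have cS: "compact S" unfolding S_def using flat_face_compact[OF \<zeta>] by (rule compact_prism)
  then have S [measurable]: "S \<in> sets borel" by (rule borel_compact)
  have fS: "emeasure lborel S < \<infinity>" using cS by (rule emeasure_compact_finite)
  have S': "x \<in> S \<longleftrightarrow> n \<bullet> x - n \<bullet> a \<in> {0..1} \<and> \<pi> x \<in> \<zeta>" for x
    unfolding S_def face_prism[OF n a] \<pi>_def by simp
  have fm: "face_measure \<zeta> = measure lborel S"
    unfolding face_measure_def Let_def unit_normal_def[symmetric] n_def[symmetric] S_def[symmetric]
    by (simp add: measure_completion)
  have fi: "face_integral \<zeta> g = (LINT x|lborel. indicator S x * g (\<pi> x))"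
    unfolding face_integral_def Let_def n_def[symmetric] a_def[symmetric]
    by (intro Bochner_Integration.integral_cong) (auto simp: S' indicator_def \<pi>_def[symmetric])
  have cont: "continuous_on UNIV (\<lambda>x. g (\<pi> x))"
    unfolding \<pi>_def by (intro continuous_on_compose2[OF g] continuous_intros) auto
  have int: "integrable lborel (\<lambda>x. indicator S x * g (\<pi> x))"
    using borel_integrable_compact[OF cS continuous_on_subset[OF cont subset_UNIV]]
    by (rule back_subst[of "integrable lborel"]) (auto simp: indicator_def)
  have intk: "integrable lborel (\<lambda>x. indicator S x * c)" for c :: real
    using fS by (intro integrable_mult_left) simp
  have "face_integral \<zeta> g - k * face_measure \<zeta> = (LINT x|lborel. indicator S x * (g (\<pi> x) - k))"
    unfolding fi fm right_diff_distrib using int intk[of k] by simp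
  also have "\<bar>\<dots>\<bar> \<le> (LINT x|lborel. indicator S x * e)"
  proof (rule order_trans[OF integral_abs_bound], rule integral_mono)
    show "integrable lborel (\<lambda>x. \<bar>indicator S x * (g (\<pi> x) - k)\<bar>)"
      unfolding right_diff_distrib using int intk by (intro integrable_abs Bochner_Integration.integrable_diff)
  qed (use intk close S' in \<open>auto simp: indicator_def\<close>)
  finally show ?thesis using fm fS by (simp add: mult.commute)
qed

lemma face_integral_const_one:
  assumes "flat_face \<zeta>" shows "face_integral \<zeta> (\<lambda>_. 1) = face_measure \<zeta>"
  using face_integral_approx[OF assms, of "\<lambda>_. 1" 1 0] by simp

lemma face_integral_zero:
  fixes g :: "real^'d \<Rightarrow> real"
  assumes "flat_face \<zeta>" "continuous_on UNIV g" "\<And>x. x \<in> \<zeta> \<Longrightarrow> g x = 0"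
  shows "face_integral \<zeta> g = 0"
  using face_integral_approx[OF assms(1,2), of 0 0] assms(3) by simp

lemma face_measure_nonneg: "0 \<le> face_measure \<zeta>"
  by (simp add: face_measure_def Let_def)

lemma half_ball_notin_closure:
  fixes n :: "'a::euclidean_space"
  assumes "P \<inter> ball x r = {y \<in> ball x r. n \<bullet> y < n \<bullet> x}" "y \<in> ball x r" "n \<bullet> x < n \<bullet> y"
  shows "y \<notin> closure P"
proof -
  have "open (ball x r \<inter> {z. n \<bullet> x < n \<bullet> z})"
    by (intro open_Int open_ball open_halfspace_gt)
  moreover have "\<not> n \<bullet> x < n \<bullet> z" if "z \<in> P" "z \<in> ball x r" for z
    using that assms(1) less_asym by blast
  then have "ball x r \<inter> {z. n \<bullet> x < n \<bullet> z} \<inter> P = {}" by blast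
  ultimately have "ball x r \<inter> {z. n \<bullet> x < n \<bullet> z} \<inter> closure P = {}"
    by (simp add: open_Int_closure_eq_empty)
  then show ?thesis using assms by auto
qed

text \<open>Seen from a point of the relative interior of a face, the cell is a half space, and a half
  ball determines the unit normal of its flat side.\<close>

lemma is_outward_normal_unique:
  assumes \<zeta>: "flat_face \<zeta>" and n: "is_outward_normal P \<zeta> n" and n': "is_outward_normal P \<zeta> n'"
  shows "n = n'"
proof (rule ccontr)
  assume neq: "n \<noteq> n'"
  obtain x where x: "x \<in> rel_interior \<zeta>" using rel_interior_flat_face_nonempty[OF \<zeta>] by blast
  obtain r where r: "r > 0" "P \<inter> ball x r = {y \<in> ball x r. n \<bullet> y < n \<bullet> x}"
    using n x unfolding is_outward_normal_def by blast
  obtain r' where r': "r' > 0" "P \<inter> ball x r' = {y \<in> ball x r'. n' \<bullet> y < n' \<bullet> x}"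
    using n' x unfolding is_outward_normal_def by blast
  have unit: "n \<bullet> n = 1" "n' \<bullet> n' = 1" using n n' by (auto simp: is_outward_normal_def norm_eq_1)
  have "(n - n') \<bullet> (n - n') > 0" using neq by simp
  then have lt: "n \<bullet> n' < 1" using unit by (simp add: inner_diff_left inner_diff_right inner_commute)
  define t where "t = min r r' / (2 * norm (n' - n))"
  have t: "t > 0" using r r' neq by (simp add: t_def)
  define y where "y = x + t *\<^sub>R (n' - n)"
  have "dist x y = min r r' / 2" using neq t r(1) r'(1) by (simp add: y_def dist_norm t_def)
  then have y: "y \<in> ball x r" "y \<in> ball x r'" using r r' by auto
  have "n \<bullet> y < n \<bullet> x" using t lt unit by (simp add: y_def inner_add_right inner_diff_right mult_pos_neg)
  moreover have "\<not> n' \<bullet> y < n' \<bullet> x"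
  proof -
    have "t * (1 - n' \<bullet> n) > 0" using t lt by (simp add: inner_commute)
    then show ?thesis using unit by (simp add: y_def inner_add_right inner_diff_right)
  qed
  ultimately show False using r(2) r'(2) y by blast
qed

lemma outward_normal_eq:
  assumes "flat_face \<zeta>" "is_outward_normal P \<zeta> n"
  shows "outward_normal P \<zeta> = n"
  unfolding outward_normal_def
  by (rule the_equality) (use assms is_outward_normal_unique in auto)

text \<open>Near a point of the relative interior the frontier of the cell is the flat side of a half
  ball, and a neighbourhood of that point in \<open>\<zeta>\<close> already spans the affine hull of \<open>\<zeta>\<close>.\<close>

lemma outward_normal_unit_normal:
  assumes n: "is_outward_normal P \<zeta> n" and P: "open P" and sub: "\<zeta> \<subseteq> frontier P"
    and ne: "rel_interior \<zeta> \<noteq> {}"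
  shows "unit_normal \<zeta> n"
proof -
  obtain x where x: "x \<in> rel_interior \<zeta>" using ne by blast
  obtain r where r: "r > 0" "P \<inter> ball x r = {y \<in> ball x r. n \<bullet> y < n \<bullet> x}"
    using n x unfolding is_outward_normal_def by blast
  have loc: "n \<bullet> y = n \<bullet> x" if y: "y \<in> \<zeta>" "y \<in> ball x r" for y
  proof (rule linorder_cases[of "n \<bullet> y" "n \<bullet> x"])
    assume "n \<bullet> y < n \<bullet> x"
    then have "y \<in> P" using r y by blast
    then show ?thesis using y sub P by (auto simp: frontier_def interior_open)
  next
    assume "n \<bullet> x < n \<bullet> y"
    then have "y \<notin> closure P" by (rule half_ball_notin_closure[OF r(2) y(2)])
    then show ?thesis using y sub by (auto simp: frontier_def)
  qed
  obtain e where e: "e > 0" "ball x e \<inter> affine hull \<zeta> \<subseteq> \<zeta>"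
    using x by (auto simp: mem_rel_interior_ball)
  have nz: "n \<bullet> z = n \<bullet> x" if z: "z \<in> \<zeta>" for z
  proof (cases "z = x")
    case False
    define t where "t = min e r / (2 * norm (z - x))"
    have t: "t > 0" using e r False by (simp add: t_def)
    define y where "y = x + t *\<^sub>R (z - x)"
    have xz: "x \<in> affine hull \<zeta>" "z \<in> affine hull \<zeta>"
      using x z by (simp_all add: hull_inc subsetD[OF rel_interior_subset])
    have "y = (1 - t) *\<^sub>R x + t *\<^sub>R z" by (simp add: y_def algebra_simps)
    then have "y \<in> affine hull \<zeta>" using mem_affine[OF affine_affine_hull xz, of "1 - t" t] by simp
    moreover have "dist x y = min e r / 2" using e(1) r(1) False by (simp add: y_def dist_norm t_def)
    ultimately have "y \<in> \<zeta>" "y \<in> ball x r" using e r by auto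
    then have "n \<bullet> y = n \<bullet> x" by (rule loc)
    then show ?thesis using t by (simp add: y_def inner_add_right inner_diff_right)
  qed simp
  have "n \<bullet> (z - z') = 0" if "z \<in> \<zeta>" "z' \<in> \<zeta>" for z z'
    using nz[OF that(1)] nz[OF that(2)] by (simp add: inner_diff_right)
  then show ?thesis using n unfolding unit_normal_def is_outward_normal_def by blast
qed

section \<open>The divergence theorem on a polyhedral cell\<close>

abbreviation nonoverlapping :: "(real^'d) set set \<Rightarrow> bool"
  where "nonoverlapping \<equiv> pairwise (\<lambda>\<zeta> \<zeta>'. disjnt (rel_interior \<zeta>) (rel_interior \<zeta>'))"

lemma polyhedral_cell_face:
  assumes cell: "polyhedral_cell P \<Phi>" and \<zeta>: "\<zeta> \<in> \<Phi>"
  shows "flat_face \<zeta>" "\<zeta> \<subseteq> frontier P" "is_outward_normal P \<zeta> (outward_normal P \<zeta>)"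
    "unit_normal \<zeta> (outward_normal P \<zeta>)"
proof -
  show f: "flat_face \<zeta>" and s: "\<zeta> \<subseteq> frontier P"
    using assms by (auto simp: polyhedral_cell_def)
  obtain n where n: "is_outward_normal P \<zeta> n" using assms unfolding polyhedral_cell_def by blast
  then have "outward_normal P \<zeta> = n" using f by (intro outward_normal_eq)
  then show o: "is_outward_normal P \<zeta> (outward_normal P \<zeta>)" using n by simp
  show "unit_normal \<zeta> (outward_normal P \<zeta>)"
    using cell by (intro outward_normal_unit_normal[OF o _ s] rel_interior_flat_face_nonempty f)
      (simp add: polyhedral_cell_def)
qed

text \<open>A line that meets the frontier transversally and off the edges crosses it at the finitely
  many parameters \<open>\<sigma> \<zeta>\<close>, and there the product of \<open>g\<close> with the indicator of the cell jumps by the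
  value of \<open>g\<close>. With the jumps compensated this product becomes a continuous function, to which the
  fundamental theorem of calculus applies; the compensation accumulated between \<open>x\<close> and \<open>x + v\<close> is the
  sum over the faces.\<close>

lemma line_integral_polyhedral_cell:
  fixes P :: "(real^'d) set" and g gv :: "real^'d \<Rightarrow> real"
  assumes cell: "polyhedral_cell P \<Phi>"
    and disj: "nonoverlapping \<Phi>"
    and deriv: "\<And>s. ((\<lambda>s. g (x + s *\<^sub>R v)) has_real_derivative gv (x + s *\<^sub>R v)) (at s)"
    and edge: "\<And>\<zeta> s. \<zeta> \<in> \<Phi> \<Longrightarrow> x + s *\<^sub>R v \<notin> \<zeta> - rel_interior \<zeta>"
    and par: "\<And>\<zeta> s. \<zeta> \<in> \<Phi> \<Longrightarrow> outward_normal P \<zeta> \<bullet> v = 0 \<Longrightarrow> x + s *\<^sub>R v \<notin> \<zeta>"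
    and ends: "x \<notin> frontier P" "x + v \<notin> frontier P"
    and a: "\<And>\<zeta>. \<zeta> \<in> \<Phi> \<Longrightarrow> a \<zeta> \<in> \<zeta>"
  defines "\<sigma> \<equiv> \<lambda>\<zeta>. (outward_normal P \<zeta> \<bullet> a \<zeta> - outward_normal P \<zeta> \<bullet> x) / (outward_normal P \<zeta> \<bullet> v)"
  shows "((\<lambda>s. indicator P (x + s *\<^sub>R v) * gv (x + s *\<^sub>R v)) has_integral
      (indicator P (x + v) * g (x + v) - indicator P x * g x +
       (\<Sum>\<zeta>\<in>\<Phi>. sgn (outward_normal P \<zeta> \<bullet> v) *
          (indicator {0..1} (\<sigma> \<zeta>) * (indicator \<zeta> (x + \<sigma> \<zeta> *\<^sub>R v) * g (x + \<sigma> \<zeta> *\<^sub>R v)))))) {0..1}"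
proof -
  define \<nu> where "\<nu> = outward_normal P"
  define \<psi> where "\<psi> s = g (x + s *\<^sub>R v)" for s
  define hit where "hit \<zeta> \<longleftrightarrow> x + \<sigma> \<zeta> *\<^sub>R v \<in> \<zeta>" for \<zeta>
  (* J compensates the jump at the crossing of a face. Since P is open, the crossing point is outside
     of P, so that the jump occurs at its left on leaving P and at its right on entering P. *)
  define J where "J \<zeta> s = (if hit \<zeta> then
      (if \<nu> \<zeta> \<bullet> v > 0 then (if \<sigma> \<zeta> \<le> s then \<psi> (\<sigma> \<zeta>) else 0) else (if \<sigma> \<zeta> < s then - \<psi> (\<sigma> \<zeta>) else 0))
      else 0)" for \<zeta> s
  define G where "G s = indicator P (x + s *\<^sub>R v) * \<psi> s + (\<Sum>\<zeta>\<in>\<Phi>. J \<zeta> s)" for s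
  have fin: "finite \<Phi>" and P: "open P" and front: "frontier P = \<Union>\<Phi>"
    using cell by (auto simp: polyhedral_cell_def)
  have line: "\<nu> \<zeta> \<bullet> v \<noteq> 0 \<and> s = \<sigma> \<zeta> \<and> hit \<zeta>" if "\<zeta> \<in> \<Phi>" "x + s *\<^sub>R v \<in> \<zeta>" for \<zeta> s
  proof -
    have nz: "\<nu> \<zeta> \<bullet> v \<noteq> 0" using par[OF that(1)] that(2) by (auto simp: \<nu>_def)
    have "\<nu> \<zeta> \<bullet> (x + s *\<^sub>R v) = \<nu> \<zeta> \<bullet> a \<zeta>"
      using unit_normal_const polyhedral_cell_face(4)[OF cell that(1)] that(2) a[OF that(1)] \<nu>_def by metis
    then have "s = \<sigma> \<zeta>" using nz by (simp add: \<sigma>_def \<nu>_def field_simps inner_add_right)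
    then show ?thesis using nz that by (simp add: hit_def)
  qed
  have der\<psi>: "(\<psi> has_real_derivative gv (x + s *\<^sub>R v)) (at s)" for s
    unfolding \<psi>_def by (rule deriv)
  have cont\<psi>: "isCont \<psi> s" for s using der\<psi> DERIV_isCont by blast
  have J_const: "eventually (\<lambda>s'. J \<zeta> s' = J \<zeta> s) (nhds s)" if "hit \<zeta> \<Longrightarrow> \<sigma> \<zeta> \<noteq> s" for \<zeta> s
  proof (cases "hit \<zeta>")
    case True
    then have "s < \<sigma> \<zeta> \<or> \<sigma> \<zeta> < s" using that[OF True] by linarith
    then consider "s < \<sigma> \<zeta>" | "\<sigma> \<zeta> < s" by blast
    then show ?thesis
    proof cases
      case 1
      then have "eventually (\<lambda>s'. s' < \<sigma> \<zeta>) (nhds s)" by (intro eventually_nhds_in_open[of "{..<\<sigma> \<zeta>}", simplified])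
      then show ?thesis by eventually_elim (use 1 in \<open>auto simp: J_def\<close>)
    next
      case 2
      then have "eventually (\<lambda>s'. \<sigma> \<zeta> < s') (nhds s)" by (intro eventually_nhds_in_open[of "{\<sigma> \<zeta><..}", simplified])
      then show ?thesis by eventually_elim (use 2 in \<open>auto simp: J_def\<close>)
    qed
  qed (simp add: J_def)
  have line_ev: "eventually (\<lambda>s'. x + s' *\<^sub>R v \<in> B) (nhds s)" if "open B" "x + s *\<^sub>R v \<in> B" for B s
  proof -
    have "open ((\<lambda>s. x + s *\<^sub>R v) -` B)" using that(1) by (intro open_vimage continuous_intros)
    from eventually_nhds_in_open[OF this, of s] show ?thesis using that(2) by simp
  qed
  have off: "(G has_real_derivative indicator P (x + s *\<^sub>R v) * gv (x + s *\<^sub>R v)) (at s)"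
    if s: "x + s *\<^sub>R v \<notin> frontier P" for s
  proof -
    have "eventually (\<lambda>s'. \<forall>\<zeta>\<in>\<Phi>. J \<zeta> s' = J \<zeta> s) (nhds s)"
    proof (intro eventually_ball_finite fin ballI J_const)
      fix \<zeta> assume "\<zeta> \<in> \<Phi>" "hit \<zeta>"
      then show "\<sigma> \<zeta> \<noteq> s" using s front by (auto simp: hit_def)
    qed
    moreover have "eventually (\<lambda>s'. indicator P (x + s' *\<^sub>R v) = (indicator P (x + s *\<^sub>R v) :: real)) (nhds s)"
    proof (cases "x + s *\<^sub>R v \<in> P")
      case True
      show ?thesis using line_ev[OF P True] by eventually_elim (use True in simp)
    next
      case False
      then have "x + s *\<^sub>R v \<in> - closure P" using s P by (auto simp: frontier_def interior_open)
      then have "eventually (\<lambda>s'. x + s' *\<^sub>R v \<in> - closure P) (nhds s)" by (intro line_ev) auto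
      then show ?thesis
        by eventually_elim (use False closure_subset in \<open>auto simp: indicator_def\<close>)
    qed
    ultimately have ev: "eventually (\<lambda>s'. G s' = indicator P (x + s *\<^sub>R v) * \<psi> s' + (\<Sum>\<zeta>\<in>\<Phi>. J \<zeta> s)) (nhds s)"
      by eventually_elim (simp add: G_def)
    have "((\<lambda>s'. indicator P (x + s *\<^sub>R v) * \<psi> s' + (\<Sum>\<zeta>\<in>\<Phi>. J \<zeta> s))
        has_real_derivative indicator P (x + s *\<^sub>R v) * gv (x + s *\<^sub>R v)) (at s)"
      by (auto intro!: derivative_eq_intros der\<psi>)
    then show ?thesis using DERIV_cong_ev[OF refl ev refl] by blast
  qed
  have on: "isCont G s" if s: "x + s *\<^sub>R v \<in> frontier P" for s
  proof -
    define y where "y = x + s *\<^sub>R v"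
    obtain \<zeta> where \<zeta>: "\<zeta> \<in> \<Phi>" "y \<in> \<zeta>" using s front by (auto simp: y_def)
    have y: "y \<in> rel_interior \<zeta>" using edge[OF \<zeta>(1), of s] \<zeta>(2) by (simp add: y_def)
    have l: "\<nu> \<zeta> \<bullet> v \<noteq> 0" "s = \<sigma> \<zeta>" "hit \<zeta>" using line[OF \<zeta>(1)] \<zeta>(2) by (auto simp: y_def)
    obtain r where r: "r > 0" "P \<inter> ball y r = {z \<in> ball y r. \<nu> \<zeta> \<bullet> z < \<nu> \<zeta> \<bullet> y}"
      using polyhedral_cell_face(3)[OF cell \<zeta>(1)] y unfolding is_outward_normal_def \<nu>_def by blast
    have "eventually (\<lambda>s'. \<forall>\<zeta>'\<in>\<Phi> - {\<zeta>}. J \<zeta>' s' = J \<zeta>' s) (nhds s)"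
    proof (intro eventually_ball_finite finite_Diff fin ballI J_const notI)
      fix \<zeta>' assume z: "\<zeta>' \<in> \<Phi> - {\<zeta>}" "hit \<zeta>'" "\<sigma> \<zeta>' = s"
      then have "y \<in> \<zeta>'" by (simp add: hit_def y_def)
      then have "y \<in> rel_interior \<zeta>'" using edge[of \<zeta>' s] z by (simp add: y_def)
      then show False using disj y \<zeta>(1) z(1) by (auto simp: pairwise_def disjnt_def)
    qed
    moreover have "eventually (\<lambda>s'. x + s' *\<^sub>R v \<in> ball y r) (nhds s)"
      using r by (intro line_ev) (auto simp: y_def)
    ultimately have ev: "eventually (\<lambda>s'. G s' = (if \<nu> \<zeta> \<bullet> v > 0 then \<psi> (min s' s) else \<psi> (max s' s) - \<psi> s)
        + (\<Sum>\<zeta>'\<in>\<Phi> - {\<zeta>}. J \<zeta>' s)) (nhds s)"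
    proof eventually_elim
      case (elim s')
      have "\<nu> \<zeta> \<bullet> (x + s' *\<^sub>R v) < \<nu> \<zeta> \<bullet> y \<longleftrightarrow> (s' - s) * (\<nu> \<zeta> \<bullet> v) < 0"
        by (simp add: y_def inner_add_right algebra_simps)
      then have inP: "x + s' *\<^sub>R v \<in> P \<longleftrightarrow> (s' - s) * (\<nu> \<zeta> \<bullet> v) < 0"
        using elim(2) r(2) by blast
      have "G s' = indicator P (x + s' *\<^sub>R v) * \<psi> s' + J \<zeta> s' + (\<Sum>\<zeta>'\<in>\<Phi> - {\<zeta>}. J \<zeta>' s)"
        unfolding G_def sum.remove[OF fin \<zeta>(1)] using elim(1) by simp
      moreover have "indicator P (x + s' *\<^sub>R v) * \<psi> s' + J \<zeta> s'
          = (if \<nu> \<zeta> \<bullet> v > 0 then \<psi> (min s' s) else \<psi> (max s' s) - \<psi> s)"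
        using l by (auto simp: indicator_def inP J_def mult_less_0_iff min_def max_def not_less)
      ultimately show ?case by simp
    qed
    have "isCont (\<lambda>s'. min s' s) s" "isCont (\<lambda>s'. max s' s) s"
      by (intro continuous_min continuous_max continuous_ident continuous_const)+
    then have "isCont (\<lambda>s'. \<psi> (min s' s)) s" "isCont (\<lambda>s'. \<psi> (max s' s)) s"
      using isCont_o2 cont\<psi> by blast+
    then have "isCont (\<lambda>s'. (if \<nu> \<zeta> \<bullet> v > 0 then \<psi> (min s' s) else \<psi> (max s' s) - \<psi> s)
        + (\<Sum>\<zeta>'\<in>\<Phi> - {\<zeta>}. J \<zeta>' s)) s"
      by (cases "\<nu> \<zeta> \<bullet> v > 0") (simp_all add: continuous_intros)
    then show ?thesis using isCont_cong[OF ev] by blast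
  qed
  have "((\<lambda>s. indicator P (x + s *\<^sub>R v) * gv (x + s *\<^sub>R v)) has_integral (G 1 - G 0)) {0..1}"
  proof (rule fundamental_theorem_of_calculus_interior_strong[where S = "\<sigma> ` \<Phi>"])
    fix s :: real assume s: "s \<in> {0<..<1} - \<sigma> ` \<Phi>"
    then have "x + s *\<^sub>R v \<notin> frontier P" using line front by blast
    then show "(G has_vector_derivative indicator P (x + s *\<^sub>R v) * gv (x + s *\<^sub>R v)) (at s)"
      using off by (simp add: has_real_derivative_iff_has_vector_derivative)
  next
    have "isCont G s" for s using on off DERIV_isCont by blast
    then show "continuous_on {0..1} G" by (simp add: continuous_at_imp_continuous_on)
  qed (use fin in auto)
  moreover have "J \<zeta> 1 - J \<zeta> 0 = sgn (\<nu> \<zeta> \<bullet> v) *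
          (indicator {0..1} (\<sigma> \<zeta>) * (indicator \<zeta> (x + \<sigma> \<zeta> *\<^sub>R v) * g (x + \<sigma> \<zeta> *\<^sub>R v)))" if \<zeta>: "\<zeta> \<in> \<Phi>" for \<zeta>
  proof (cases "hit \<zeta>")
    case True
    then have "\<sigma> \<zeta> \<noteq> 0" "\<sigma> \<zeta> \<noteq> 1" using ends front \<zeta> by (auto simp: hit_def)
    moreover have "\<nu> \<zeta> \<bullet> v \<noteq> 0" using line[OF \<zeta>] True by (simp add: hit_def)
    ultimately show ?thesis
      using True by (auto simp: J_def indicator_def hit_def[symmetric] \<psi>_def[symmetric] sgn_if)
  qed (simp add: J_def hit_def)
  then have "(\<Sum>\<zeta>\<in>\<Phi>. J \<zeta> 1) - (\<Sum>\<zeta>\<in>\<Phi>. J \<zeta> 0) = (\<Sum>\<zeta>\<in>\<Phi>. sgn (\<nu> \<zeta> \<bullet> v) *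
          (indicator {0..1} (\<sigma> \<zeta>) * (indicator \<zeta> (x + \<sigma> \<zeta> *\<^sub>R v) * g (x + \<sigma> \<zeta> *\<^sub>R v))))"
    unfolding sum_subtractf[symmetric] by (intro sum.cong) auto
  ultimately show ?thesis by (simp add: G_def \<psi>_def \<nu>_def algebra_simps)
qed

lemma integral_lborel_translate:
  fixes f :: "'a::euclidean_space \<Rightarrow> real"
  assumes [measurable]: "f \<in> borel_measurable borel"
  shows "(LINT x|lborel. f (x + u)) = (LINT x|lborel. f x)"
proof -
  have "(LINT x|lborel. f x) = (LINT x|distr lborel borel ((+) u). f x)"
    by (simp add: lborel_distr_plus)
  also have "\<dots> = (LINT x|lborel. f (u + x))"
    by (rule integral_distr) auto
  finally show ?thesis by (simp add: add.commute)
qed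

lemma AE_lborel_notin_negligible:
  assumes "negligible S" shows "AE x in lborel. x \<notin> S"
proof -
  have "AE x in lebesgue. x \<notin> S"
    using assms by (intro AE_not_in) (simp add: negligible_iff_null_sets)
  then show ?thesis by (simp add: AE_completion_iff)
qed

lemma integrable_lborel_bounded_support:
  fixes f :: "'a::euclidean_space \<Rightarrow> real"
  assumes "f \<in> borel_measurable borel" "compact K" "\<And>x. x \<in> K \<Longrightarrow> \<bar>f x\<bar> \<le> B" "\<And>x. x \<notin> K \<Longrightarrow> f x = 0"
  shows "integrable lborel f"
  by (rule integrableI_bounded_set[of K _ _ B])
    (use assms emeasure_compact_finite[OF assms(2)] in \<open>auto intro: borel_compact\<close>)

text \<open>The edges and the faces parallel to \<open>v\<close> are met by a null set of lines only. For any other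
  face, the starting points \<open>x\<close> of the segments from \<open>x\<close> to \<open>x + v\<close> that cross it fill the prism over
  the face slanted along \<open>- v\<close>; integrating the value of \<open>g\<close> at the crossing point over \<open>x\<close> thus gives
  the face integral with the factor \<open>\<bar>n \<bullet> v\<bar>\<close>, and the sign of \<open>n \<bullet> v\<close> tells leaving from entering.\<close>

lemma divergence_polyhedral_cell:
  fixes P :: "(real^'d) set" and g gv :: "real^'d \<Rightarrow> real"
  assumes cell: "polyhedral_cell P \<Phi>"
    and disj: "nonoverlapping \<Phi>"
    and g: "continuous_on UNIV g" and gv: "continuous_on UNIV gv"
    and deriv: "\<And>x s. ((\<lambda>s. g (x + s *\<^sub>R v)) has_real_derivative gv (x + s *\<^sub>R v)) (at s)"
  shows "(LINT x|lborel. indicator P x * gv x) = (\<Sum>\<zeta>\<in>\<Phi>. (outward_normal P \<zeta> \<bullet> v) * face_integral \<zeta> g)"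
proof -
  define \<nu> where "\<nu> = outward_normal P"
  define a where "a \<zeta> = (SOME a. a \<in> \<zeta>)" for \<zeta> :: "(real^'d) set"
  define \<sigma> where "\<sigma> \<zeta> x = (\<nu> \<zeta> \<bullet> a \<zeta> - \<nu> \<zeta> \<bullet> x) / (\<nu> \<zeta> \<bullet> v)" for \<zeta> x
  define \<tau> where "\<tau> \<zeta> x = sgn (\<nu> \<zeta> \<bullet> v) *
      (indicator {0..1} (\<sigma> \<zeta> x) * (indicator \<zeta> (x + \<sigma> \<zeta> x *\<^sub>R v) * g (x + \<sigma> \<zeta> x *\<^sub>R v)))" for \<zeta> x
  define H where "H x = indicator P x * gv x" for x
  define H1 where "H1 x = indicator P x * g x" for x
  have fin: "finite \<Phi>" and P: "open P" "bounded P" and front: "frontier P = \<Union>\<Phi>"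
    using cell by (auto simp: polyhedral_cell_def)
  have face: "flat_face \<zeta>" "unit_normal \<zeta> (\<nu> \<zeta>)" "a \<zeta> \<in> \<zeta>" if "\<zeta> \<in> \<Phi>" for \<zeta>
    using polyhedral_cell_face[OF cell that] by (auto simp: \<nu>_def a_def some_in_eq flat_face_nonempty)
  have [measurable]: "P \<in> sets borel" using P by simp
  have gm [measurable]: "g \<in> borel_measurable borel" using g by (rule borel_measurable_continuous_onI)
  have [measurable]: "gv \<in> borel_measurable borel" using gv by (rule borel_measurable_continuous_onI)
  have Hm [measurable]: "H \<in> borel_measurable borel" unfolding H_def by measurable
  have H1m [measurable]: "H1 \<in> borel_measurable borel" unfolding H1_def by measurable
  have bnd: "\<exists>B. \<forall>x\<in>K. \<bar>h x\<bar> \<le> B" if "continuous_on UNIV h" "compact K" for h :: "real^'d \<Rightarrow> real" and K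
  proof -
    have "compact (h ` K)" using that by (meson compact_continuous_image continuous_on_subset subset_UNIV)
    from compact_imp_bounded[OF this] show ?thesis by (auto simp: bounded_iff)
  qed
  have cP: "compact (closure P)" using P by simp
  obtain B where B: "\<And>x. x \<in> closure P \<Longrightarrow> \<bar>gv x\<bar> \<le> B" using bnd[OF gv cP] by blast
  obtain B1 where B1: "\<And>x. x \<in> closure P \<Longrightarrow> \<bar>g x\<bar> \<le> B1" using bnd[OF g cP] by blast
  have B0: "B \<ge> 0"
  proof -
    obtain p where "p \<in> P" using cell by (auto simp: polyhedral_cell_def)
    then show ?thesis using B[of p] closure_subset by force
  qed
  have HB: "\<bar>H x\<bar> \<le> B" for x using B[of x] B0 closure_subset[of P] by (auto simp: H_def indicator_def)
  have H1int: "integrable lborel H1"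
    by (rule integrable_lborel_bounded_support[OF H1m cP, of B1])
      (use B1 order_trans[OF abs_ge_zero B1] closure_subset[of P] in \<open>auto simp: H1_def indicator_def\<close>)
  obtain R where R: "\<And>x. x \<in> P \<Longrightarrow> norm x \<le> R" using P(2) by (auto simp: bounded_iff)
  have Rc: "norm x \<le> R" if "x \<in> closure P" for x
  proof -
    have "closure P \<subseteq> cball 0 R" using R by (intro closure_minimal) auto
    then show ?thesis using that by auto
  qed
  have H0: "H x = 0" if "norm x > R" for x using R[of x] that by (auto simp: H_def indicator_def)
  (* Averaging over translates by s v replaces the volume integral by integrals along segments. *)
  have "(LINT x|lborel. H x) = (LINT s::real|lborel. indicator {0..1} s * (LINT x|lborel. H x))"
    by simp
  also have "\<dots> = (LINT s|lborel. (LINT x|lborel. indicator {0..1} s * H (x + s *\<^sub>R v)))"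
    by (simp add: integral_lborel_translate)
  also have "\<dots> = (LINT x|lborel. (LINT s|lborel. indicator {0..1} s * H (x + s *\<^sub>R v)))"
  proof (rule lborel_pair.Fubini_integral)
    have "integrable (lborel :: ((real^'d) \<times> real) measure) (\<lambda>(x, s). indicator {0..1} s * H (x + s *\<^sub>R v))"
    proof (rule integrable_lborel_bounded_support)
      show "(\<lambda>(x, s). indicator {0..1} s * H (x + s *\<^sub>R v)) \<in> borel_measurable borel"
        unfolding borel_prod[symmetric] by measurable
      show "compact (cball (0::real^'d) (R + norm v) \<times> {0..1::real})" by (intro compact_Times) auto
      show "\<bar>case z of (x, s) \<Rightarrow> indicator {0..1} s * H (x + s *\<^sub>R v)\<bar> \<le> B" for z :: "(real^'d) \<times> real"
        using HB B0 by (auto simp: indicator_def split: prod.splits)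
      show "(case z of (x, s) \<Rightarrow> indicator {0..1} s * H (x + s *\<^sub>R v)) = 0"
        if "z \<notin> cball (0::real^'d) (R + norm v) \<times> {0..1::real}" for z
      proof -
        obtain x s where z: "z = (x, s)" by (cases z)
        show ?thesis
        proof (cases "s \<in> {0..1}")
          case True
          then have "norm x > R + norm v" using that z by auto
          moreover have "norm (s *\<^sub>R v) \<le> norm v" using True by (simp add: mult_left_le_one_le)
          ultimately have "norm (x + s *\<^sub>R v) > R" using norm_diff_ineq[of x "s *\<^sub>R v"] by linarith
          then show ?thesis using z H0 by simp
        qed (simp add: z)
      qed
    qed
    then show "integrable (lborel \<Otimes>\<^sub>M lborel) (\<lambda>(x, s). indicator {0..1} s * H (x + s *\<^sub>R v))"
      by (simp add: lborel_prod)
  qed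
  also have "\<dots> = (LINT x|lborel. H1 (x + v) - H1 x + (\<Sum>\<zeta>\<in>\<Phi>. \<tau> \<zeta> x))"
  proof (rule integral_cong_AE)
    show "(\<lambda>x. LINT s|lborel. indicator {0..1} s * H (x + s *\<^sub>R v)) \<in> borel_measurable lborel"
      by measurable
    have \<zeta>b: "\<zeta> \<in> sets borel" if "\<zeta> \<in> \<Phi>" for \<zeta>
      using face(1)[OF that] flat_face_compact borel_compact by blast
    show "(\<lambda>x. H1 (x + v) - H1 x + (\<Sum>\<zeta>\<in>\<Phi>. \<tau> \<zeta> x)) \<in> borel_measurable lborel"
      unfolding \<tau>_def \<sigma>_def using \<zeta>b by measurable
    have neg: "negligible (frontier P)"
      unfolding front using fin face(1) by (intro negligible_Union) (auto intro: negligible_flat_face)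
    note ends = AE_lborel_notin_negligible[OF neg]
      AE_lborel_notin_negligible[OF negligible_translation[OF neg, of "- v"]]
    have "AE x in lborel. \<forall>\<zeta>\<in>\<Phi>. x \<notin> {x. \<exists>s. x + s *\<^sub>R v \<in> \<zeta> - rel_interior \<zeta>}"
      using face(1) by (intro AE_finite_allI fin AE_lborel_notin_negligible negligible_lines_through_edges)
    moreover have "AE x in lborel. \<forall>\<zeta>\<in>\<Phi>. \<nu> \<zeta> \<bullet> v = 0 \<longrightarrow> x \<notin> {x. \<exists>s. x + s *\<^sub>R v \<in> \<zeta>}"
    proof (intro AE_finite_allI fin)
      fix \<zeta> assume "\<zeta> \<in> \<Phi>"
      then show "AE x in lborel. \<nu> \<zeta> \<bullet> v = 0 \<longrightarrow> x \<notin> {x. \<exists>s. x + s *\<^sub>R v \<in> \<zeta>}"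
        using AE_lborel_notin_negligible[OF negligible_lines_in_face[OF face(2)]] by (cases "\<nu> \<zeta> \<bullet> v = 0") auto
    qed
    ultimately show "AE x in lborel. (LINT s|lborel. indicator {0..1} s * H (x + s *\<^sub>R v))
        = H1 (x + v) - H1 x + (\<Sum>\<zeta>\<in>\<Phi>. \<tau> \<zeta> x)"
      using ends
    proof eventually_elim
      case (elim x)
      have xv: "x + v \<notin> frontier P"
      proof
        assume "x + v \<in> frontier P"
        then have "- v + (x + v) \<in> (+) (- v) ` frontier P" by (rule imageI)
        then show False using elim(4) by simp
      qed
      have *: "((\<lambda>s. H (x + s *\<^sub>R v)) has_integral (H1 (x + v) - H1 x + (\<Sum>\<zeta>\<in>\<Phi>. \<tau> \<zeta> x))) {0..1}"
        unfolding H_def H1_def \<tau>_def \<sigma>_def \<nu>_def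
        by (rule line_integral_polyhedral_cell[OF cell disj])
          (use elim xv face(3) deriv in \<open>auto simp: \<nu>_def\<close>)
      have "set_integrable lborel {0..1} (\<lambda>s. H (x + s *\<^sub>R v))"
        unfolding set_integrable_def
        by (rule integrable_lborel_bounded_support[of _ "{0..1}" B]) (use HB in \<open>auto simp: indicator_def\<close>)
      from set_borel_integral_eq_integral(2)[OF this] integral_unique[OF *]
      show ?case by (simp add: set_lebesgue_integral_def)
    qed
  qed
  also have "\<dots> = (LINT x|lborel. H1 (x + v)) - (LINT x|lborel. H1 x) + (\<Sum>\<zeta>\<in>\<Phi>. LINT x|lborel. \<tau> \<zeta> x)"
  proof -
    have "integrable lborel (\<tau> \<zeta>)" if \<zeta>: "\<zeta> \<in> \<Phi>" for \<zeta>
    proof (cases "\<nu> \<zeta> \<bullet> v = 0")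
      case False
      have c\<zeta>: "compact \<zeta>" using face(1)[OF \<zeta>] by (rule flat_face_compact)
      then have [measurable]: "\<zeta> \<in> sets borel" by (rule borel_compact)
      obtain C where C: "\<And>x. x \<in> \<zeta> \<Longrightarrow> \<bar>g x\<bar> \<le> C" using bnd[OF g c\<zeta>] by blast
      show ?thesis
      proof (rule integrable_lborel_bounded_support[OF _ compact_cball[of 0 "R + norm v"]])
        show "\<tau> \<zeta> \<in> borel_measurable borel" unfolding \<tau>_def \<sigma>_def by measurable
        have "C \<ge> 0" using C[OF face(3)[OF \<zeta>]] by linarith
        then show "\<bar>\<tau> \<zeta> x\<bar> \<le> C" for x
          using C by (auto simp: \<tau>_def indicator_def sgn_if)
        show "\<tau> \<zeta> x = 0" if "x \<notin> cball 0 (R + norm v)" for x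
        proof (rule ccontr)
          assume "\<tau> \<zeta> x \<noteq> 0"
          then have 1: "\<sigma> \<zeta> x \<in> {0..1}" "x + \<sigma> \<zeta> x *\<^sub>R v \<in> \<zeta>" by (auto simp: \<tau>_def indicator_def split: if_splits)
          then have "norm (x + \<sigma> \<zeta> x *\<^sub>R v) \<le> R"
            using polyhedral_cell_face(2)[OF cell \<zeta>] by (intro Rc) (auto simp: frontier_def)
          moreover have "norm (\<sigma> \<zeta> x *\<^sub>R v) \<le> norm v" using 1 by (simp add: mult_left_le_one_le)
          ultimately have "norm x \<le> R + norm v" using norm_diff_ineq[of x "\<sigma> \<zeta> x *\<^sub>R v"] by linarith
          then show False using that by simp
        qed
      qed
    qed (simp add: \<tau>_def[abs_def])
    moreover have "integrable lborel (\<lambda>x. H1 (x + v))"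
    proof -
      have "integrable (distr lborel borel ((+) v)) H1" using H1int by (simp add: lborel_distr_plus)
      then show ?thesis by (subst (asm) integrable_distr_eq) (auto simp: add.commute)
    qed
    ultimately show ?thesis using H1int by (simp add: Bochner_Integration.integral_sum)
  qed
  also have "\<dots> = (\<Sum>\<zeta>\<in>\<Phi>. LINT x|lborel. \<tau> \<zeta> x)" by (simp add: integral_lborel_translate)
  also have "\<dots> = (\<Sum>\<zeta>\<in>\<Phi>. (\<nu> \<zeta> \<bullet> v) * face_integral \<zeta> g)"
  proof (rule sum.cong[OF refl])
    fix \<zeta> assume \<zeta>: "\<zeta> \<in> \<Phi>"
    show "(LINT x|lborel. \<tau> \<zeta> x) = (\<nu> \<zeta> \<bullet> v) * face_integral \<zeta> g"
    proof (cases "\<nu> \<zeta> \<bullet> v = 0")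
      case False
      then have "\<nu> \<zeta> \<bullet> (- v) \<noteq> 0" by simp
      note * = face_integral_slanted[OF face[OF \<zeta>] this gm]
      have \<sigma>: "(\<nu> \<zeta> \<bullet> x - \<nu> \<zeta> \<bullet> a \<zeta>) / (\<nu> \<zeta> \<bullet> (- v)) = \<sigma> \<zeta> x" for x
        by (simp add: \<sigma>_def minus_divide_left)
      have "(LINT x|lborel. \<tau> \<zeta> x) = sgn (\<nu> \<zeta> \<bullet> v) * (\<bar>\<nu> \<zeta> \<bullet> v\<bar> * face_integral \<zeta> g)"
        unfolding \<tau>_def using * unfolding \<sigma> by simp
      then show ?thesis by (simp add: mult_sgn_abs mult.assoc[symmetric])
    qed (simp add: \<tau>_def)
  qed
  finally show ?thesis by (simp add: H_def \<nu>_def)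
qed

section \<open>Conservativity of the mesh\<close>

text \<open>The relative interior of a face is too large to be covered by the edges of finitely many
  faces: thickened along the normal, it contains a ball, whereas the edges sweep out a null set.\<close>

lemma flat_face_generic_point:
  fixes \<zeta> :: "(real^'d) set"
  assumes \<zeta>: "flat_face \<zeta>" and \<Omega>: "open \<Omega>" and meet: "\<zeta> \<inter> \<Omega> \<noteq> {}"
    and Z: "finite Z" "\<And>\<zeta>'. \<zeta>' \<in> Z \<Longrightarrow> flat_face \<zeta>'"
  obtains x where "x \<in> rel_interior \<zeta>" "x \<in> \<Omega>" "\<And>\<zeta>'. \<zeta>' \<in> Z \<Longrightarrow> x \<in> \<zeta>' \<Longrightarrow> x \<in> rel_interior \<zeta>'"
proof -
  obtain m c where m: "m \<noteq> 0" "affine hull \<zeta> = {x. m \<bullet> x = c}"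
    using flat_face_hyperplane[OF \<zeta>] .
  have mm: "m \<bullet> m > 0" using m(1) by simp
  have "\<zeta> \<subseteq> closure (rel_interior \<zeta>)" by (rule flat_face_rel_interior[OF \<zeta>])
  then have "\<Omega> \<inter> rel_interior \<zeta> \<noteq> {}"
    using meet open_Int_closure_eq_empty[OF \<Omega>, of "rel_interior \<zeta>"] by blast
  then obtain x where x: "x \<in> \<Omega>" "x \<in> rel_interior \<zeta>" by blast
  obtain V where V: "open V" "rel_interior \<zeta> = affine hull \<zeta> \<inter> V"
    using openin_rel_interior[of \<zeta>] by (auto simp: openin_open)
  have "open (V \<inter> \<Omega>)" "x \<in> V \<inter> \<Omega>" using V \<Omega> x by auto
  then obtain e where e: "e > 0" "ball x e \<subseteq> V \<inter> \<Omega>" by (meson openE)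
  have xc: "m \<bullet> x = c" using x V m by auto
  define E where "E = (\<Union>\<zeta>'\<in>Z. {y. \<exists>s. y + s *\<^sub>R m \<in> \<zeta>' - rel_interior \<zeta>'})"
  have "negligible {y. \<exists>s. y + s *\<^sub>R m \<in> \<zeta>' - rel_interior \<zeta>'}" if "\<zeta>' \<in> Z" for \<zeta>'
    by (rule negligible_lines_through_edges[OF Z(2)[OF that]])
  then have "negligible E" unfolding E_def using Z(1) by (intro negligible_Union) auto
  then have "\<not> ball x e \<subseteq> E"
    using open_not_negligible[of "ball x e"] e(1) negligible_subset by (metis ball_eq_empty not_le open_ball)
  then obtain y where y: "y \<in> ball x e" "y \<notin> E" by blast
  define t where "t = (m \<bullet> y - c) / (m \<bullet> m)"
  define p where "p = y - t *\<^sub>R m"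
  have mt: "m \<bullet> (y - x) = t * (m \<bullet> m)" using mm xc by (simp add: t_def inner_diff_right)
  have sq: "(z - t *\<^sub>R m) \<bullet> (z - t *\<^sub>R m) = z \<bullet> z - 2 * t * (m \<bullet> z) + t * t * (m \<bullet> m)" for z
    by (simp add: inner_diff_left inner_diff_right inner_commute)
  have "p - x = (y - x) - t *\<^sub>R m" by (simp add: p_def)
  then have "(p - x) \<bullet> (p - x) = (y - x) \<bullet> (y - x) - 2 * t * (m \<bullet> (y - x)) + t * t * (m \<bullet> m)"
    using sq[of "y - x"] by metis
  also have "\<dots> = (y - x) \<bullet> (y - x) - t * t * (m \<bullet> m)" unfolding mt by (simp add: algebra_simps)
  also have "\<dots> \<le> (y - x) \<bullet> (y - x)" using mm by simp
  finally have "norm (p - x) \<le> norm (y - x)" by (simp add: norm_le)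
  then have pb: "p \<in> ball x e" using y(1) by (simp add: dist_norm norm_minus_commute)
  have "m \<bullet> p = c" using mm by (simp add: p_def t_def inner_diff_right)
  then have "p \<in> rel_interior \<zeta>" "p \<in> \<Omega>" using pb e(2) V(2) m(2) by auto
  moreover have "p \<in> rel_interior \<zeta>'" if "\<zeta>' \<in> Z" "p \<in> \<zeta>'" for \<zeta>'
  proof (rule ccontr)
    assume "p \<notin> rel_interior \<zeta>'"
    then have "y + (- t) *\<^sub>R m \<in> \<zeta>' - rel_interior \<zeta>'" using that by (simp add: p_def)
    then show False using y(2) that(1) unfolding E_def by blast
  qed
  ultimately show thesis using that by blast
qed

lemma mesh_cell:
  assumes "mesh \<Omega> \<P> \<F>" "P \<in> \<P>"
  shows "polyhedral_cell P (\<F> P)" "P \<subseteq> \<Omega>" "open P" "bounded P" "P \<noteq> {}" "finite (\<F> P)"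
    "nonoverlapping (\<F> P)"
proof -
  show "polyhedral_cell P (\<F> P)" "P \<subseteq> \<Omega>" using assms by (auto simp: mesh_def)
  then show "open P" "bounded P" "P \<noteq> {}" "finite (\<F> P)" by (auto simp: polyhedral_cell_def)
  show "nonoverlapping (\<F> P)"
    by (rule pairwise_subset[of _ "\<Union>P\<in>\<P>. \<F> P"]) (use assms in \<open>auto simp: mesh_def\<close>)
qed

text \<open>With equal normals both cells would contain a common half ball.\<close>

lemma normals_opposite:
  assumes mesh: "mesh \<Omega> \<P> \<F>" and P: "P \<in> \<P>" "\<zeta> \<in> \<F> P" and Q: "Q \<in> \<P>" "\<zeta> \<in> \<F> Q" and PQ: "P \<noteq> Q"
  shows "outward_normal Q \<zeta> = - outward_normal P \<zeta>"
proof -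
  define n where "n = outward_normal P \<zeta>"
  note fP = polyhedral_cell_face[OF mesh_cell(1)[OF mesh P(1)] P(2)]
    and fQ = polyhedral_cell_face[OF mesh_cell(1)[OF mesh Q(1)] Q(2)]
  have "outward_normal Q \<zeta> \<noteq> n"
  proof
    assume eq: "outward_normal Q \<zeta> = n"
    obtain x where x: "x \<in> rel_interior \<zeta>" using rel_interior_flat_face_nonempty[OF fP(1)] by blast
    obtain r where r: "r > 0" "P \<inter> ball x r = {y \<in> ball x r. n \<bullet> y < n \<bullet> x}"
      using fP(3) x unfolding is_outward_normal_def n_def by blast
    obtain r' where r': "r' > 0" "Q \<inter> ball x r' = {y \<in> ball x r'. n \<bullet> y < n \<bullet> x}"
      using fQ(3) x unfolding is_outward_normal_def eq by blast
    have nn: "norm n = 1" using fP(4) by (simp add: n_def unit_normal_def)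
    define y where "y = x - (min r r' / 2) *\<^sub>R n"
    have "dist x y = min r r' / 2" using nn r(1) r'(1) by (simp add: y_def dist_norm)
    then have "y \<in> ball x r" "y \<in> ball x r'" using r(1) r'(1) by auto
    moreover have "n \<bullet> y < n \<bullet> x" using nn r(1) r'(1) by (simp add: y_def inner_diff_right norm_eq_1)
    ultimately have "y \<in> P" "y \<in> Q" using r(2) r'(2) by blast+
    moreover have "disjnt P Q" using mesh P Q PQ by (auto simp: mesh_def pairwise_def)
    ultimately show False by (auto simp: disjnt_def)
  qed
  then show ?thesis using unit_normal_unique[OF fP(1,4) fQ(4)] by (auto simp: n_def)
qed

text \<open>At a generic point of \<open>\<zeta>\<close> in \<open>\<Omega>\<close> the half ball opposite to \<open>P\<close> is covered by the closures
  of the other cells. Such a point lies in the closure of one of them, and by genericity in the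
  relative interior of one of its faces, which is \<open>\<zeta>\<close> because distinct faces do not overlap.\<close>

lemma neighbour_exists:
  fixes \<Omega> :: "(real^'d) set"
  assumes mesh: "mesh \<Omega> \<P> \<F>" and \<Omega>: "open \<Omega>" and P: "P \<in> \<P>" "\<zeta> \<in> \<F> P" and meet: "\<zeta> \<inter> \<Omega> \<noteq> {}"
  obtains Q where "Q \<in> \<P>" "Q \<noteq> P" "\<zeta> \<in> \<F> Q"
proof -
  note cell = mesh_cell[OF mesh]
  note fP = polyhedral_cell_face[OF cell(1)[OF P(1)] P(2)]
  have fin: "finite \<P>" and dis: "pairwise disjnt \<P>" and cov: "(\<Union>P\<in>\<P>. closure P) = closure \<Omega>"
    and pw: "nonoverlapping (\<Union>P\<in>\<P>. \<F> P)"
    using mesh by (auto simp: mesh_def)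
  define n where "n = outward_normal P \<zeta>"
  obtain x where x: "x \<in> rel_interior \<zeta>" "x \<in> \<Omega>"
      "\<And>\<zeta>'. \<zeta>' \<in> (\<Union>P\<in>\<P>. \<F> P) \<Longrightarrow> x \<in> \<zeta>' \<Longrightarrow> x \<in> rel_interior \<zeta>'"
  proof (rule flat_face_generic_point[OF fP(1) \<Omega> meet, of "\<Union>P\<in>\<P>. \<F> P"])
    show "finite (\<Union>P\<in>\<P>. \<F> P)" using fin cell(6) by blast
    show "flat_face \<zeta>'" if "\<zeta>' \<in> (\<Union>P\<in>\<P>. \<F> P)" for \<zeta>'
      using that polyhedral_cell_face(1) cell(1) by blast
  qed blast
  obtain r where r: "r > 0" "P \<inter> ball x r = {y \<in> ball x r. n \<bullet> y < n \<bullet> x}"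
    using fP(3) x(1) unfolding is_outward_normal_def n_def by blast
  have nn: "norm n = 1" using fP(4) by (simp add: n_def unit_normal_def)
  have "\<exists>Q\<in>\<P> - {P}. x \<in> closure Q"
  proof (rule ccontr)
    assume no: "\<not> ?thesis"
    define V where "V = \<Omega> \<inter> ball x r - (\<Union>Q\<in>\<P> - {P}. closure Q)"
    have "open V" unfolding V_def using fin \<Omega> by (intro open_Diff open_Int closed_UN) auto
    moreover have "x \<in> V" using no x(2) r(1) by (auto simp: V_def)
    ultimately obtain e where e: "e > 0" "ball x e \<subseteq> V" by (meson openE)
    define y where "y = x + (e / 2) *\<^sub>R n"
    have "dist x y = e / 2" using nn e(1) by (simp add: y_def dist_norm)
    then have yV: "y \<in> V" using e by auto
    then have "y \<in> (\<Union>P\<in>\<P>. closure P)" using cov closure_subset by (auto simp: V_def)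
    then have "y \<in> closure P" using yV by (auto simp: V_def)
    moreover have "n \<bullet> x < n \<bullet> y" using nn e(1) by (simp add: y_def inner_add_right norm_eq_1)
    ultimately show False using half_ball_notin_closure[OF r(2)] yV by (auto simp: V_def)
  qed
  then obtain Q where Q: "Q \<in> \<P>" "Q \<noteq> P" "x \<in> closure Q" by blast
  have xP: "x \<in> closure P" using x(1) fP(2) rel_interior_subset by (auto simp: frontier_def)
  have "Q \<inter> P = {}" using dis P(1) Q by (auto simp: pairwise_def disjnt_def)
  then have "x \<notin> Q" using xP open_Int_closure_eq_empty[OF cell(3)[OF Q(1)], of P] by blast
  then have "x \<in> frontier Q" using Q cell(3) by (simp add: frontier_def interior_open)
  then obtain \<zeta>' where z: "\<zeta>' \<in> \<F> Q" "x \<in> \<zeta>'" using cell(1)[OF Q(1)] by (auto simp: polyhedral_cell_def)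
  then have "x \<in> rel_interior \<zeta>'" using x(3) Q(1) by blast
  then have "\<not> disjnt (rel_interior \<zeta>) (rel_interior \<zeta>')" using x(1) by (auto simp: disjnt_def)
  then have "\<zeta> = \<zeta>'" using pw P Q(1) z(1) unfolding pairwise_def by blast
  then show thesis using that Q z by blast
qed

lemma sum_normals_interior_face:
  assumes mesh: "mesh \<Omega> \<P> \<F>" and \<Omega>: "open \<Omega>" and meet: "\<zeta> \<inter> \<Omega> \<noteq> {}"
  shows "(\<Sum>P | P \<in> \<P> \<and> \<zeta> \<in> \<F> P. outward_normal P \<zeta>) = 0"
proof (cases "\<exists>P\<in>\<P>. \<zeta> \<in> \<F> P")
  case True
  then obtain P where P: "P \<in> \<P>" "\<zeta> \<in> \<F> P" by blast
  obtain Q where Q: "Q \<in> \<P>" "Q \<noteq> P" "\<zeta> \<in> \<F> Q" using neighbour_exists[OF mesh \<Omega> P meet] .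
  note opp = normals_opposite[OF mesh]
  have "R = P \<or> R = Q" if R: "R \<in> \<P>" "\<zeta> \<in> \<F> R" for R
  proof (rule ccontr)
    assume no: "\<not> ?thesis"
    have "outward_normal R \<zeta> = - outward_normal P \<zeta>" "outward_normal R \<zeta> = - outward_normal Q \<zeta>"
      "outward_normal Q \<zeta> = - outward_normal P \<zeta>"
      using opp[OF P R] opp[OF Q(1,3) R] opp[OF P Q(1,3)] no Q(2) by auto
    then have "outward_normal P \<zeta> + outward_normal P \<zeta> = 0" by (metis add.right_inverse add.inverse_inverse)
    then have "outward_normal P \<zeta> = 0" by (simp add: scaleR_2[symmetric])
    then show False
      using polyhedral_cell_face(4)[OF mesh_cell(1)[OF mesh P(1)] P(2)] by (simp add: unit_normal_def)
  qed
  then have "{P \<in> \<P>. \<zeta> \<in> \<F> P} = {P, Q}" using P Q by blast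
  then show ?thesis using opp[OF P Q(1,3)] Q(2) by simp
next
  case False
  then have "{P. P \<in> \<P> \<and> \<zeta> \<in> \<F> P} = {}" by blast
  then show ?thesis by (simp only: sum.empty)
qed

text \<open>The fluxes of a face cancel because it separates exactly two cells, with opposite normals,
  or lies outside \<open>\<Omega>\<close>, where the weight vanishes.\<close>

lemma mesh_conservative:
  fixes g :: "real^'d \<Rightarrow> real" and H :: "(real^'d) set \<Rightarrow> real^'d"
  assumes mesh: "mesh \<Omega> \<P> \<F>" and \<Omega>: "open \<Omega>" and g: "continuous_on UNIV g" "\<And>x. x \<notin> \<Omega> \<Longrightarrow> g x = 0"
  shows "(\<Sum>P\<in>\<P>. \<Sum>\<zeta>\<in>\<F> P. face_integral \<zeta> g * (H \<zeta> \<bullet> outward_normal P \<zeta>)) = 0"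
proof -
  define Z where "Z = (\<Union>P\<in>\<P>. \<F> P)"
  have fin: "finite \<P>" using mesh by (simp add: mesh_def)
  have finZ: "finite Z" unfolding Z_def using fin mesh_cell(6)[OF mesh] by blast
  have ffZ: "flat_face \<zeta>" if "\<zeta> \<in> Z" for \<zeta>
    using that polyhedral_cell_face(1) mesh_cell(1)[OF mesh] unfolding Z_def by blast
  have "\<F> P = {\<zeta>. \<zeta> \<in> Z \<and> \<zeta> \<in> \<F> P}" if "P \<in> \<P>" for P using that by (auto simp: Z_def)
  then have "(\<Sum>P\<in>\<P>. \<Sum>\<zeta>\<in>\<F> P. face_integral \<zeta> g * (H \<zeta> \<bullet> outward_normal P \<zeta>))
      = (\<Sum>P\<in>\<P>. \<Sum>\<zeta> | \<zeta> \<in> Z \<and> \<zeta> \<in> \<F> P. face_integral \<zeta> g * (H \<zeta> \<bullet> outward_normal P \<zeta>))"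
    by (intro sum.cong) auto
  also have "\<dots> = (\<Sum>\<zeta>\<in>Z. \<Sum>P | P \<in> \<P> \<and> \<zeta> \<in> \<F> P. face_integral \<zeta> g * (H \<zeta> \<bullet> outward_normal P \<zeta>))"
    by (rule sum.swap_restrict[OF fin finZ])
  also have "\<dots> = (\<Sum>\<zeta>\<in>Z. face_integral \<zeta> g * (H \<zeta> \<bullet> (\<Sum>P | P \<in> \<P> \<and> \<zeta> \<in> \<F> P. outward_normal P \<zeta>)))"
    by (simp add: sum_distrib_left inner_sum_right)
  also have "\<dots> = 0"
  proof (intro sum.neutral ballI)
    fix \<zeta> assume \<zeta>: "\<zeta> \<in> Z"
    show "face_integral \<zeta> g * (H \<zeta> \<bullet> (\<Sum>P | P \<in> \<P> \<and> \<zeta> \<in> \<F> P. outward_normal P \<zeta>)) = 0"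
    proof (cases "\<zeta> \<inter> \<Omega> = {}")
      case True
      then have "face_integral \<zeta> g = 0" using g by (intro face_integral_zero ffZ \<zeta>) auto
      then show ?thesis by simp
    next
      case False
      then show ?thesis using sum_normals_interior_face[OF mesh \<Omega>] by simp
    qed
  qed
  finally show ?thesis .
qed

text \<open>The closure of \<open>P\<close> lies in the ball of radius \<open>e\<close> about each of its points, whereas a face on the
  boundary contains no point of \<open>\<Omega>\<close>.\<close>

lemma noninterior_cell_avoids:
  assumes mesh: "mesh \<Omega> \<P> \<F>" and \<Omega>: "open \<Omega>" and P: "P \<in> \<P>" "P \<notin> interior_cells \<Omega> \<P> \<F>"
    and K: "\<And>x. x \<in> K \<Longrightarrow> ball x e \<subseteq> \<Omega>" and small: "diameter P < e"
  shows "closure P \<inter> K = {}"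
proof (rule ccontr)
  assume "closure P \<inter> K \<noteq> {}"
  then obtain k where k: "k \<in> closure P" "k \<in> K" by blast
  obtain \<zeta> where \<zeta>: "\<zeta> \<in> \<F> P" "\<zeta> \<subseteq> frontier \<Omega>" using P by (auto simp: interior_cells_def)
  note f = polyhedral_cell_face[OF mesh_cell(1)[OF mesh P(1)] \<zeta>(1)]
  obtain z where z: "z \<in> \<zeta>" using flat_face_nonempty[OF f(1)] by blast
  then have "z \<in> closure P" using f(2) by (auto simp: frontier_def)
  moreover have b: "bounded (closure P)" "bounded P" using mesh_cell(4)[OF mesh P(1)] by auto
  ultimately have "dist k z \<le> diameter (closure P)" using k(1) by (intro diameter_bounded_bound)
  also have "\<dots> = diameter P" by (rule diameter_closure[OF b(2)])
  finally have "z \<in> ball k e" using small by simp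
  then have "z \<in> \<Omega>" using K[OF k(2)] by blast
  then show False using z \<zeta>(2) \<Omega> by (auto simp: frontier_def interior_open)
qed

section \<open>Test functions\<close>

lemma smooth_has_derivative:
  assumes "smooth \<phi>" shows "(\<phi> has_derivative frechet_derivative \<phi> (at z)) (at z)"
proof -
  have "Ck (Suc 0) \<phi>" using assms unfolding smooth_def by blast
  then have "\<phi> differentiable (at z)" by simp
  then show ?thesis by (simp add: frechet_derivative_works)
qed

lemma smooth_frechet_derivative:
  assumes "smooth \<phi>" shows "smooth (\<lambda>z. frechet_derivative \<phi> (at z) v)"
  unfolding smooth_def
proof
  fix k
  have "Ck (Suc k) \<phi>" using assms unfolding smooth_def by blast
  then show "Ck k (\<lambda>z. frechet_derivative \<phi> (at z) v)" by simp
qed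

lemma smooth_continuous:
  assumes "smooth \<phi>" shows "continuous_on UNIV \<phi>"
proof -
  have "Ck 0 \<phi>" using assms unfolding smooth_def by blast
  then show ?thesis by simp
qed

lemma slice_has_derivative:
  assumes "(\<phi> has_derivative \<phi>') (at (x, s))"
  shows "((\<lambda>y. \<phi> (y, s)) has_derivative (\<lambda>v. \<phi>' (v, 0))) (at x)"
proof -
  have "((\<lambda>y. (y, s)) has_derivative (\<lambda>v. (v, 0))) (at x)"
    by (intro derivative_eq_intros) auto
  from has_derivative_compose[OF this, of \<phi> \<phi>'] assms show ?thesis by simp
qed

lemma Ck_slice: "Ck k \<phi> \<Longrightarrow> Ck k (\<lambda>y. \<phi> (y, s))"
proof (induction k arbitrary: \<phi>)
  case 0
  then show ?case by (auto intro!: continuous_on_compose2[of UNIV \<phi>] continuous_intros)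
next
  case (Suc k)
  have d: "((\<lambda>y. \<phi> (y, s)) has_derivative (\<lambda>v. frechet_derivative \<phi> (at (x, s)) (v, 0))) (at x)" for x
    using Suc.prems by (intro slice_has_derivative) (simp add: frechet_derivative_works)
  have "frechet_derivative (\<lambda>y. \<phi> (y, s)) (at x) v = frechet_derivative \<phi> (at (x, s)) (v, 0)" for x v
    using frechet_derivative_at[OF d] by (metis (no_types))
  moreover have "Ck k (\<lambda>x. frechet_derivative \<phi> (at (x, s)) (v, 0))" for v
    using Suc.IH[of "\<lambda>z. frechet_derivative \<phi> (at z) (v, 0)"] Suc.prems by simp
  moreover have "(\<lambda>y. \<phi> (y, s)) differentiable (at x)" for x
    using d unfolding differentiable_def by blast
  ultimately show ?case by simp
qed

lemma zero_on_open_imp_derivative_zero: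
  assumes "open S" "x \<in> S" "\<And>y. y \<in> S \<Longrightarrow> f y = 0"
  shows "frechet_derivative f (at x) = (\<lambda>v. 0)"
proof -
  have "((\<lambda>y. 0) has_derivative (\<lambda>v. 0)) (at x)" by (rule has_derivative_const)
  then have "(f has_derivative (\<lambda>v. 0)) (at x)"
    by (rule has_derivative_transform_within_open[OF _ assms(1,2)]) (use assms(3) in simp)
  from frechet_derivative_at[OF this] show ?thesis by simp
qed

text \<open>The cut-off function agrees with \<open>g\<close> on \<open>\<Omega>\<close> and vanishes on the complement of \<open>K\<close>, and
  these two open sets cover the space.\<close>

lemma Ck_cutoff:
  fixes g :: "'a::real_normed_vector \<Rightarrow> real"
  assumes \<Omega>: "open \<Omega>" and K: "closed K" "K \<subseteq> \<Omega>"
  shows "Ck k g \<Longrightarrow> (\<And>x. x \<in> \<Omega> - K \<Longrightarrow> g x = 0) \<Longrightarrow> Ck k (\<lambda>x. if x \<in> \<Omega> then g x else 0)"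
    and cutoff_derivative: "(\<And>x. g differentiable (at x)) \<Longrightarrow> (\<And>x. x \<in> \<Omega> - K \<Longrightarrow> g x = 0) \<Longrightarrow>
      ((\<lambda>x. if x \<in> \<Omega> then g x else 0) has_derivative
        (\<lambda>v. if x \<in> \<Omega> then frechet_derivative g (at x) v else 0)) (at x)"
proof -
  have der: "((\<lambda>x. if x \<in> \<Omega> then g x else 0) has_derivative
        (\<lambda>v. if x \<in> \<Omega> then frechet_derivative g (at x) v else 0)) (at x)"
    if g: "\<And>x. g differentiable (at x)" and z: "\<And>x. x \<in> \<Omega> - K \<Longrightarrow> g x = 0" for g :: "'a \<Rightarrow> real" and x
  proof (cases "x \<in> \<Omega>")
    case True
    have "(g has_derivative frechet_derivative g (at x)) (at x)" using g by (simp add: frechet_derivative_works)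
    then have "((\<lambda>x. if x \<in> \<Omega> then g x else 0) has_derivative frechet_derivative g (at x)) (at x)"
      by (rule has_derivative_transform_within_open[OF _ \<Omega> True]) simp
    then show ?thesis using True by simp
  next
    case False
    then have x: "x \<in> - K" "open (- K)" using K by auto
    have "((\<lambda>y. 0) has_derivative (\<lambda>v. 0)) (at x)" by (rule has_derivative_const)
    then have "((\<lambda>x. if x \<in> \<Omega> then g x else 0) has_derivative (\<lambda>v. 0)) (at x)"
      by (rule has_derivative_transform_within_open[OF _ x(2,1)]) (use z in auto)
    then show ?thesis using False by simp
  qed
  then show "(\<And>x. g differentiable (at x)) \<Longrightarrow> (\<And>x. x \<in> \<Omega> - K \<Longrightarrow> g x = 0) \<Longrightarrow>
      ((\<lambda>x. if x \<in> \<Omega> then g x else 0) has_derivative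
        (\<lambda>v. if x \<in> \<Omega> then frechet_derivative g (at x) v else 0)) (at x)" by blast
  have oK: "open (\<Omega> - K)" using \<Omega> K by auto
  show "Ck k g \<Longrightarrow> (\<And>x. x \<in> \<Omega> - K \<Longrightarrow> g x = 0) \<Longrightarrow> Ck k (\<lambda>x. if x \<in> \<Omega> then g x else 0)"
  proof (induction k arbitrary: g)
    case (0 g)
    have "continuous_on (\<Omega> \<union> - K) (\<lambda>x. if x \<in> \<Omega> then g x else 0)"
    proof (rule continuous_on_open_Un[OF \<Omega>])
      show "open (- K)" using K by auto
      have "continuous_on \<Omega> g" using 0(1) continuous_on_subset by auto
      then show "continuous_on \<Omega> (\<lambda>x. if x \<in> \<Omega> then g x else 0)" by (rule continuous_on_eq) simp
      have "continuous_on (- K) (\<lambda>x. 0::real)" by simp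
      then show "continuous_on (- K) (\<lambda>x. if x \<in> \<Omega> then g x else 0)"
        by (rule continuous_on_eq) (use 0(2) in auto)
    qed
    moreover have "\<Omega> \<union> - K = UNIV" using K by auto
    ultimately show ?case by simp
  next
    case (Suc k g)
    have d: "((\<lambda>x. if x \<in> \<Omega> then g x else 0) has_derivative
        (\<lambda>v. if x \<in> \<Omega> then frechet_derivative g (at x) v else 0)) (at x)" for x
      by (rule der) (use Suc.prems in auto)
    have eq: "frechet_derivative (\<lambda>x. if x \<in> \<Omega> then g x else 0) (at x) v
        = (if x \<in> \<Omega> then frechet_derivative g (at x) v else 0)" for x v
      unfolding frechet_derivative_at[OF d, symmetric] by simp
    have "Ck k (\<lambda>x. if x \<in> \<Omega> then frechet_derivative g (at x) v else 0)" for v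
    proof (rule Suc.IH)
      show "Ck k (\<lambda>x. frechet_derivative g (at x) v)" using Suc.prems by simp
      show "frechet_derivative g (at x) v = 0" if "x \<in> \<Omega> - K" for x
        using zero_on_open_imp_derivative_zero[OF oK that, of g] Suc.prems(2) by simp
    qed
    then show ?case using d by (auto simp: eq differentiable_def)
  qed
qed

lemma time_deriv_frechet:
  assumes "smooth \<phi>" shows "time_deriv \<phi> = (\<lambda>z. frechet_derivative \<phi> (at z) (0, 1))"
    and "((\<lambda>s. \<phi> (x, s)) has_real_derivative time_deriv \<phi> (x, s)) (at s)"
proof -
  have d: "((\<lambda>s. \<phi> (x, s)) has_real_derivative frechet_derivative \<phi> (at (x, s)) (0, 1)) (at s)" for x s
  proof -
    have "((\<lambda>r. (x, r)) has_derivative (\<lambda>h. (0, h))) (at s)"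
      by (intro derivative_eq_intros) auto
    from has_derivative_compose[OF this smooth_has_derivative[OF assms]]
    have "((\<lambda>r. \<phi> (x, r)) has_derivative (\<lambda>h. frechet_derivative \<phi> (at (x, s)) (0, h))) (at s)" .
    moreover have "frechet_derivative \<phi> (at (x, s)) (0, h) = h * frechet_derivative \<phi> (at (x, s)) (0, 1)" for h
      using linear_scale[OF has_derivative_linear[OF smooth_has_derivative[OF assms]], of "(x, s)" h "(0, 1)"] by simp
    then have "(\<lambda>h. frechet_derivative \<phi> (at (x, s)) (0, h)) = (*) (frechet_derivative \<phi> (at (x, s)) (0, 1))"
      by (intro ext) (metis mult.commute)
    ultimately show ?thesis by (simp only: has_field_derivative_def)
  qed
  show eq: "time_deriv \<phi> = (\<lambda>z. frechet_derivative \<phi> (at z) (0, 1))"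
    unfolding time_deriv_def using DERIV_imp_deriv[OF d] by (auto simp: fun_eq_iff)
  show "((\<lambda>s. \<phi> (x, s)) has_real_derivative time_deriv \<phi> (x, s)) (at s)"
    unfolding eq by (rule d)
qed

lemma space_grad_inner:
  fixes \<phi> :: "(real^'d) \<times> real \<Rightarrow> real"
  assumes "smooth \<phi>" shows "space_grad \<phi> z \<bullet> v = frechet_derivative \<phi> (at z) (v, 0)"
proof -
  obtain x s where z: "z = (x, s)" by (cases z)
  have d: "((\<lambda>y. \<phi> (y, s)) has_derivative (\<lambda>v. frechet_derivative \<phi> (at (x, s)) (v, 0))) (at x)"
    by (intro slice_has_derivative smooth_has_derivative assms)
  interpret linear "\<lambda>v. frechet_derivative \<phi> (at (x, s)) (v, 0)" using d by (rule has_derivative_linear)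
  have "frechet_derivative \<phi> (at (x, s)) (v, 0) = frechet_derivative \<phi> (at (x, s)) ((\<Sum>i\<in>UNIV. v $ i *\<^sub>R axis i 1), 0)"
    using basis_expansion[of v] by (simp add: scalar_mult_eq_scaleR)
  also have "\<dots> = (\<Sum>i\<in>UNIV. v $ i * frechet_derivative \<phi> (at (x, s)) (axis i 1, 0))"
    using sum[of "\<lambda>i. v $ i *\<^sub>R axis i 1" UNIV] scale by simp
  also have "\<dots> = space_grad \<phi> z \<bullet> v"
    by (simp add: space_grad_def inner_vec_def z frechet_derivative_at[OF d, symmetric] mult.commute)
  finally show ?thesis by (simp add: z)
qed

lemma space_grad_continuous:
  fixes \<phi> :: "(real^'d) \<times> real \<Rightarrow> real"
  assumes "smooth \<phi>" shows "continuous_on UNIV (space_grad \<phi>)"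
proof -
  have "space_grad \<phi> z = (\<chi> i. frechet_derivative \<phi> (at z) (axis i 1, 0))" for z
    using space_grad_inner[OF assms, of z "axis i 1" for i] by (simp add: vec_eq_iff inner_axis)
  moreover have "continuous_on UNIV (\<lambda>z. \<chi> i. frechet_derivative \<phi> (at z) (axis i 1, 0))"
    by (intro continuous_on_vec_lambda smooth_continuous smooth_frechet_derivative assms)
  ultimately show ?thesis by (simp cong: continuous_on_cong)
qed

text \<open>The support condition speaks of \<open>\<Omega> \<times> [0,T)\<close> only; by continuity \<open>\<phi>\<close> and its derivatives also
  vanish at the final time, and at the initial time their zeros extend from positive times.\<close>

lemma spacetime_test_function_support:
  fixes \<phi> :: "(real^'d) \<times> real \<Rightarrow> real"
  assumes \<phi>: "\<phi> \<in> spacetime_test_functions \<Omega> T" and \<Omega>: "open \<Omega>" and T: "T > 0"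
  obtains K where "compact K" "K \<subseteq> \<Omega> \<times> {0..<T}"
    "\<forall>z \<in> \<Omega> \<times> {0..T} - K. \<phi> z = 0"
    "\<forall>z \<in> \<Omega> \<times> {0..T} - K. \<forall>v. frechet_derivative \<phi> (at z) v = 0"
proof -
  obtain K where K: "compact K" "K \<subseteq> \<Omega> \<times> {0..<T}" "\<forall>z\<in>\<Omega> \<times> {0..<T} - K. \<phi> z = 0"
    and sm: "smooth \<phi>" using \<phi> by (auto simp: spacetime_test_functions_def)
  define S where "S = \<Omega> \<times> {0<..<T} - K"
  have S: "open S" unfolding S_def using \<Omega> K(1) by (intro open_Diff open_Times compact_imp_closed) auto
  have zS: "\<phi> z = 0" if "z \<in> S" for z using K(3) that by (auto simp: S_def)
  have ext: "\<psi> z = 0" if \<psi>: "continuous_on UNIV \<psi>" "\<And>z. z \<in> S \<Longrightarrow> \<psi> z = 0" and z: "z \<in> \<Omega> \<times> {0..T} - K"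
    for \<psi> :: "(real^'d) \<times> real \<Rightarrow> real" and z
  proof -
    obtain x s where zs: "z = (x, s)" by (cases z)
    have "closed ((\<lambda>r. (x, r)) -` {z. \<psi> z = 0})"
      by (intro closed_vimage closed_Collect_eq \<psi> continuous_intros)
    moreover have "closed ((\<lambda>r. (x, r)) -` K)"
      by (intro closed_vimage compact_imp_closed K continuous_intros)
    ultimately have cl: "closed ((\<lambda>r. (x, r)) -` {z. \<psi> z = 0} \<union> (\<lambda>r. (x, r)) -` K)" by (rule closed_Un)
    have "{0<..<T} \<subseteq> (\<lambda>r. (x, r)) -` {z. \<psi> z = 0} \<union> (\<lambda>r. (x, r)) -` K"
      using z zs \<psi>(2) by (auto simp: S_def)
    then have "closure {0<..<T} \<subseteq> (\<lambda>r. (x, r)) -` {z. \<psi> z = 0} \<union> (\<lambda>r. (x, r)) -` K"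
      using cl by (rule closure_minimal)
    then have "s \<in> (\<lambda>r. (x, r)) -` {z. \<psi> z = 0} \<union> (\<lambda>r. (x, r)) -` K" using z zs T by auto
    then show ?thesis using z zs by auto
  qed
  show thesis
  proof (rule that[OF K(1,2)]; intro ballI allI)
    show "\<phi> z = 0" if "z \<in> \<Omega> \<times> {0..T} - K" for z
      using ext[OF smooth_continuous[OF sm] zS that] .
    show "frechet_derivative \<phi> (at z) v = 0" if "z \<in> \<Omega> \<times> {0..T} - K" for z v
    proof (rule ext[OF _ _ that, of "\<lambda>z. frechet_derivative \<phi> (at z) v"])
      show "continuous_on UNIV (\<lambda>z. frechet_derivative \<phi> (at z) v)"
        by (intro smooth_continuous smooth_frechet_derivative sm)
      show "frechet_derivative \<phi> (at z) v = 0" if "z \<in> S" for z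
        using zero_on_open_imp_derivative_zero[OF S that zS] by simp
    qed
  qed
qed

lemma time_deriv_test_function:
  fixes \<phi> :: "(real^'d) \<times> real \<Rightarrow> real"
  assumes \<phi>: "\<phi> \<in> spacetime_test_functions \<Omega> T" and \<Omega>: "open \<Omega>" and T: "T > 0"
  shows "time_deriv \<phi> \<in> spacetime_test_functions \<Omega> T"
proof -
  have sm: "smooth \<phi>" using \<phi> by (simp add: spacetime_test_functions_def)
  obtain K where K: "compact K" "K \<subseteq> \<Omega> \<times> {0..<T}"
    "\<forall>z \<in> \<Omega> \<times> {0..T} - K. \<phi> z = 0"
    "\<forall>z \<in> \<Omega> \<times> {0..T} - K. \<forall>v. frechet_derivative \<phi> (at z) v = 0"
    by (rule spacetime_test_function_support[OF \<phi> \<Omega> T])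
  have "\<forall>z\<in>\<Omega> \<times> {0..<T} - K. frechet_derivative \<phi> (at z) (0, 1) = 0" using K(4) by auto
  then show ?thesis
    unfolding time_deriv_frechet(1)[OF sm] spacetime_test_functions_def
    using smooth_frechet_derivative[OF sm] K(1,2) by blast
qed

text \<open>Outside \<open>\<Omega>\<close> the values of \<open>\<phi>\<close> are arbitrary; replacing them by zero keeps the slices smooth,
  makes them vanish on the boundary faces, and allows a Lipschitz estimate along segments that leave
  \<open>\<Omega>\<close>. The constant \<open>L\<close> is uniform in time because the derivatives are bounded on the compact
  support.\<close>

lemma spacetime_test_function_slices:
  fixes \<phi> :: "(real^'d) \<times> real \<Rightarrow> real"
  assumes \<phi>: "\<phi> \<in> spacetime_test_functions \<Omega> T" and \<Omega>: "open \<Omega>" and T: "T > 0"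
  defines "G \<equiv> \<lambda>s x. if x \<in> \<Omega> then \<phi> (x, s) else 0"
  obtains K L where "compact K" "K \<subseteq> \<Omega>" "0 \<le> L"
    "\<forall>s\<in>{0..T}. G s \<in> test_functions \<Omega>"
    "\<forall>x. G T x = 0"
    "\<forall>s\<in>{0..T}. \<forall>x. x \<notin> K \<longrightarrow> G s x = 0"
    "\<forall>s\<in>{0..T}. \<forall>x\<in>\<Omega> - K. time_deriv \<phi> (x, s) = 0 \<and> space_grad \<phi> (x, s) = 0"
    "\<forall>s\<in>{0..T}. \<forall>x\<in>\<Omega>. \<bar>time_deriv \<phi> (x, s)\<bar> \<le> L \<and> norm (space_grad \<phi> (x, s)) \<le> L"
    "\<forall>s\<in>{0..T}. \<forall>x v. frechet_derivative (G s) (at x) v = (if x \<in> \<Omega> then space_grad \<phi> (x, s) \<bullet> v else 0)"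
    "\<forall>s\<in>{0..T}. \<forall>x y. \<bar>G s x - G s y\<bar> \<le> L * dist x y"
proof -
  have sm: "smooth \<phi>" using \<phi> by (simp add: spacetime_test_functions_def)
  obtain C where C: "compact C" "C \<subseteq> \<Omega> \<times> {0..<T}"
    "\<forall>z \<in> \<Omega> \<times> {0..T} - C. \<phi> z = 0"
    "\<forall>z \<in> \<Omega> \<times> {0..T} - C. \<forall>v. frechet_derivative \<phi> (at z) v = 0"
    by (rule spacetime_test_function_support[OF \<phi> \<Omega> T])
  have grad0: "time_deriv \<phi> z = 0 \<and> space_grad \<phi> z = 0" if "z \<in> \<Omega> \<times> {0..T} - C" for z
  proof -
    have "space_grad \<phi> z \<bullet> v = 0" for v using C(4)[rule_format, OF that] space_grad_inner[OF sm] by simp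
    then have "space_grad \<phi> z = 0" using inner_eq_zero_iff by blast
    then show ?thesis using C(4)[rule_format, OF that] time_deriv_frechet(1)[OF sm] by simp
  qed
  define K where "K = fst ` C"
  have K: "compact K" "K \<subseteq> \<Omega>" unfolding K_def using C(1,2)
    by (auto intro!: compact_continuous_image continuous_intros)
  have CK: "(x, s) \<notin> C" if "x \<notin> K" for x s using that unfolding K_def by force
  have ct: "continuous_on UNIV (time_deriv \<phi>)"
    unfolding time_deriv_frechet(1)[OF sm] by (intro smooth_continuous smooth_frechet_derivative sm)
  have bnd: "\<exists>L\<ge>0. \<forall>z\<in>C. norm (h z) \<le> L" if "continuous_on UNIV h" for h :: "(real^'d) \<times> real \<Rightarrow> 'b::real_normed_vector"
  proof -
    have "compact (h ` C)" using that C(1) by (meson compact_continuous_image continuous_on_subset subset_UNIV)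
    then have "bounded (h ` C)" by (rule compact_imp_bounded)
    then show ?thesis unfolding bounded_pos by (auto intro!: less_imp_le)
  qed
  obtain L1 where L1: "L1 \<ge> 0" "\<And>z. z \<in> C \<Longrightarrow> norm (time_deriv \<phi> z) \<le> L1" using bnd[OF ct] by blast
  obtain L2 where L2: "L2 \<ge> 0" "\<And>z. z \<in> C \<Longrightarrow> norm (space_grad \<phi> z) \<le> L2"
    using bnd[OF space_grad_continuous[OF sm]] by blast
  define L where "L = max L1 L2"
  have L: "\<bar>time_deriv \<phi> (x, s)\<bar> \<le> L \<and> norm (space_grad \<phi> (x, s)) \<le> L" if "s \<in> {0..T}" "x \<in> \<Omega>" for s x
  proof (cases "(x, s) \<in> C")
    case True
    then show ?thesis using L1(2)[OF True] L2(2)[OF True] by (simp add: L_def le_max_iff_disj)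
  next
    case False
    then show ?thesis using grad0[of "(x, s)"] that L1(1) by (simp add: L_def)
  qed
  have L0: "0 \<le> L" using L1(1) by (simp add: L_def)
  have slice0: "\<phi> (x, s) = 0" if "s \<in> {0..T}" "x \<in> \<Omega> - K" for s x
    using C(3)[rule_format, of "(x, s)"] CK[of x s] that by auto
  have smG: "smooth (G s)" if "s \<in> {0..T}" for s
    unfolding smooth_def G_def
  proof
    fix k
    have "Ck k (\<lambda>x. \<phi> (x, s))" using sm by (intro Ck_slice) (simp add: smooth_def)
    then show "Ck k (\<lambda>x. if x \<in> \<Omega> then \<phi> (x, s) else 0)"
      by (rule Ck_cutoff[OF \<Omega> compact_imp_closed[OF K(1)] K(2)]) (use slice0 that in blast)
  qed
  have fr: "frechet_derivative (G s) (at x) v = (if x \<in> \<Omega> then space_grad \<phi> (x, s) \<bullet> v else 0)"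
    if s: "s \<in> {0..T}" for s x v
  proof -
    have d: "((\<lambda>y. \<phi> (y, s)) has_derivative (\<lambda>v. space_grad \<phi> (x, s) \<bullet> v)) (at x)" for x
      unfolding space_grad_inner[OF sm] by (intro slice_has_derivative smooth_has_derivative sm)
    have "(G s has_derivative (\<lambda>v. if x \<in> \<Omega> then frechet_derivative (\<lambda>y. \<phi> (y, s)) (at x) v else 0)) (at x)"
      unfolding G_def
      by (rule cutoff_derivative[OF \<Omega> compact_imp_closed[OF K(1)] K(2)])
        (use slice0 s d in \<open>auto simp: differentiable_def\<close>)
    from frechet_derivative_at[OF this, symmetric] show ?thesis
      using frechet_derivative_at[OF d, symmetric] by simp
  qed
  have lip: "\<bar>G s x - G s y\<bar> \<le> L * dist x y" if s: "s \<in> {0..T}" for s x y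
  proof -
    have "norm (G s x - G s y) \<le> L * norm (x - y)"
    proof (rule differentiable_bound[of UNIV])
      show "(G s has_derivative frechet_derivative (G s) (at z)) (at z)" for z
        by (rule smooth_has_derivative[OF smG[OF s]])
      show "onorm (frechet_derivative (G s) (at z)) \<le> L" for z
      proof (rule onorm_le)
        fix v
        show "norm (frechet_derivative (G s) (at z) v) \<le> L * norm v"
        proof (cases "z \<in> \<Omega>")
          case True
          have "\<bar>space_grad \<phi> (z, s) \<bullet> v\<bar> \<le> norm (space_grad \<phi> (z, s)) * norm v"
            by (rule Cauchy_Schwarz_ineq2)
          also have "\<dots> \<le> L * norm v" using L[OF s True] by (simp add: mult_right_mono)
          finally show ?thesis using True by (simp add: fr[OF s])
        qed (simp add: fr[OF s] L0)
      qed
    qed auto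
    then show ?thesis by (simp add: dist_norm)
  qed
  show thesis
  proof (rule that[OF K L0]; intro ballI allI impI)
    show "G s \<in> test_functions \<Omega>" if "s \<in> {0..T}" for s
      unfolding test_functions_def
      by (intro CollectI conjI exI[of _ K] smG that) (use K slice0[OF that] in \<open>auto simp: G_def\<close>)
    show "G T x = 0" for x 
    proof (cases "x \<in> \<Omega>")
      case True
      have "(x, T) \<notin> C" using C(2) by auto
      then have "\<phi> (x, T) = 0" using C(3)[rule_format, of "(x, T)"] True T by auto
      then show ?thesis by (simp add: G_def)
    qed (simp add: G_def)
    show "G s x = 0" if "s \<in> {0..T}" "x \<notin> K" for s x using slice0[OF that(1)] that(2) by (simp add: G_def)
    show "time_deriv \<phi> (x, s) = 0 \<and> space_grad \<phi> (x, s) = 0" if "s \<in> {0..T}" "x \<in> \<Omega> - K" for s x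
      using grad0[of "(x, s)"] CK[of x s] that by auto
    show "\<bar>time_deriv \<phi> (x, s)\<bar> \<le> L \<and> norm (space_grad \<phi> (x, s)) \<le> L" if "s \<in> {0..T}" "x \<in> \<Omega>" for s x
      using L[OF that] .
    show "frechet_derivative (G s) (at x) v = (if x \<in> \<Omega> then space_grad \<phi> (x, s) \<bullet> v else 0)"
      if "s \<in> {0..T}" for s x v using fr[OF that] .
    show "\<bar>G s x - G s y\<bar> \<le> L * dist x y" if "s \<in> {0..T}" for s x y using lip[OF that] .
  qed
qed

section \<open>Integrals over the cells of a space-time mesh\<close>

lemma set_integral_cong:
  assumes "\<And>x. x \<in> S \<Longrightarrow> f x = g x"
  shows "(LINT x:S|M. f x) = (LINT x:S|M. g x)"
  unfolding set_lebesgue_integral_def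
proof (rule Bochner_Integration.integral_cong[OF refl])
  show "indicator S x *\<^sub>R f x = indicator S x *\<^sub>R g x" for x by (cases "x \<in> S") (simp_all add: assms)
qed

lemma set_integral_eq_0:
  assumes "\<And>x. x \<in> S \<Longrightarrow> f x = 0"
  shows "(LINT x:S|M. f x) = 0"
  using set_integral_cong[of S f "\<lambda>_. 0" M] assms by (simp add: set_lebesgue_integral_def)

lemma continuous_set_integrable:
  fixes h :: "'a::euclidean_space \<Rightarrow> 'b::euclidean_space"
  assumes "P \<in> sets borel" "bounded P" "continuous_on UNIV h"
  shows "set_integrable lborel P h" "set_integrable lebesgue P h"
    "(LINT x:P|lebesgue. h x) = (LINT x:P|lborel. h x)"
proof -
  have "set_integrable lborel (closure P) h"
    unfolding set_integrable_def using assms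
    by (intro borel_integrable_compact) (auto intro: continuous_on_subset)
  then show i: "set_integrable lborel P h"
    by (rule set_integrable_subset) (use assms closure_subset in auto)
  have m: "(\<lambda>x. indicator P x *\<^sub>R h x) \<in> borel_measurable lborel"
    using i unfolding set_integrable_def by (rule borel_measurable_integrable)
  show "set_integrable lebesgue P h"
    using i integrable_completion[OF m] unfolding set_integrable_def by simp
  show "(LINT x:P|lebesgue. h x) = (LINT x:P|lborel. h x)"
    using integral_completion[OF m] unfolding set_lebesgue_integral_def by simp
qed

lemma mean_value_approx:
  fixes h :: "'a::euclidean_space \<Rightarrow> 'b::euclidean_space"
  assumes P: "open P" "bounded P" "P \<noteq> {}" and h: "continuous_on UNIV h"
    and close: "\<And>y. y \<in> P \<Longrightarrow> norm (h y - k) \<le> e"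
  shows "norm ((1 / measure lebesgue P) *\<^sub>R (LINT x:P|lebesgue. h x) - k) \<le> e"
proof -
  have Pb: "P \<in> sets borel" using P by simp
  have lm: "P \<in> lmeasurable" using P by (intro bounded_set_imp_lmeasurable) auto
  have pos: "measure lebesgue P > 0"
    using P lm open_not_negligible negligible_iff_measure0 by (metis measure_nonneg order_le_less)
  have ik: "set_integrable lebesgue P (\<lambda>x. c)" for c :: 'b
    by (rule continuous_set_integrable(2)[OF Pb P(2) continuous_on_const])
  have ie: "set_integrable lebesgue P (\<lambda>x. e)"
    using continuous_set_integrable(2)[OF Pb P(2), of "\<lambda>_. e"] by simp
  have ih: "set_integrable lebesgue P h" by (rule continuous_set_integrable(2)[OF Pb P(2) h])
  have const: "(LINT x:P|lebesgue. c) = measure lebesgue P *\<^sub>R c" for c :: 'b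
  proof -
    have "integrable lebesgue (indicator P :: _ \<Rightarrow> real)" using lm by (simp only: lmeasurable_iff_integrable)
    then show ?thesis unfolding set_lebesgue_integral_def by (subst integral_scaleR_left) auto
  qed
  have conste: "(LINT x:P|lebesgue. e) = measure lebesgue P * e"
    unfolding set_lebesgue_integral_def using lm by simp
  have "norm (LINT x:P|lebesgue. h x - k) \<le> (LINT x:P|lebesgue. e)"
    unfolding set_lebesgue_integral_def
  proof (rule Bochner_Integration.integral_norm_bound_integral)
    show "integrable lebesgue (\<lambda>x. indicator P x *\<^sub>R (h x - k))"
      using set_integral_diff(1)[OF ih ik] unfolding set_integrable_def .
    show "integrable lebesgue (\<lambda>x. indicator P x *\<^sub>R e)" using ie unfolding set_integrable_def .
    show "norm (indicator P x *\<^sub>R (h x - k)) \<le> indicator P x *\<^sub>R e" for x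
      using close by (auto simp: indicator_def)
  qed
  then have *: "norm ((LINT x:P|lebesgue. h x) - measure lebesgue P *\<^sub>R k) \<le> measure lebesgue P * e"
    using set_integral_diff(2)[OF ih ik] by (simp add: const conste)
  have "(1 / measure lebesgue P) *\<^sub>R (LINT x:P|lebesgue. h x) - k
      = (1 / measure lebesgue P) *\<^sub>R ((LINT x:P|lebesgue. h x) - measure lebesgue P *\<^sub>R k)"
    using pos by (simp add: scaleR_diff_right)
  also have "norm \<dots> \<le> (1 / measure lebesgue P) * (measure lebesgue P * e)"
    using * pos unfolding norm_scaleR by (intro mult_mono) auto
  finally show ?thesis using pos by simp
qed

lemma mesh_cell_measure:
  assumes "mesh \<Omega> \<P> \<F>" "P \<in> \<P>"
  shows "P \<in> lmeasurable" "measure lebesgue P > 0"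
proof -
  note c = mesh_cell[OF assms]
  show lm: "P \<in> lmeasurable" using c by (intro bounded_set_imp_lmeasurable) auto
  show "measure lebesgue P > 0"
    using c lm open_not_negligible negligible_iff_measure0 by (metis measure_nonneg order_le_less)
qed

lemma mesh_bounded:
  assumes "mesh \<Omega> \<P> \<F>" shows "bounded \<Omega>"
proof -
  have "bounded (\<Union>P\<in>\<P>. closure P)"
    using assms mesh_cell(4)[OF assms] by (intro bounded_UN) (auto simp: mesh_def)
  then have "bounded (closure \<Omega>)" using assms by (simp add: mesh_def)
  then show ?thesis using bounded_subset closure_subset by blast
qed

definition skeleton :: "(real^'d) set set \<Rightarrow> (real^'d) set"
  where "skeleton \<P> = (\<Union>P\<in>\<P>. frontier P)"

lemma skeleton_null:
  assumes mesh: "mesh \<Omega> \<P> \<F>"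
  shows "skeleton \<P> \<in> null_sets lborel"
proof -
  have "frontier P \<in> null_sets lborel" if P: "P \<in> \<P>" for P
  proof -
    have "frontier P = \<Union>(\<F> P)" using mesh_cell(1)[OF mesh P] by (simp add: polyhedral_cell_def)
    moreover have "negligible (\<Union>(\<F> P))"
      using mesh_cell(6)[OF mesh P] polyhedral_cell_face(1)[OF mesh_cell(1)[OF mesh P]]
      by (intro negligible_Union ballI negligible_flat_face)
    moreover have "frontier P \<in> sets lborel" by simp
    ultimately show ?thesis
      using null_sets_completion_iff[of "frontier P" lborel] by (simp add: negligible_iff_null_sets)
  qed
  then show ?thesis unfolding skeleton_def
    using mesh by (intro null_sets.finite_UN) (auto simp: mesh_def)
qed

lemma mesh_indicator:
  assumes mesh: "mesh \<Omega> \<P> \<F>" and x: "x \<notin> skeleton \<P>"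
  shows "(\<Sum>P\<in>\<P>. indicator P x) = (indicator \<Omega> x :: real)"
proof (cases "\<exists>P\<in>\<P>. x \<in> P")
  case True
  then obtain P where P: "P \<in> \<P>" "x \<in> P" by blast
  have fin: "finite \<P>" and dis: "pairwise disjnt \<P>" using mesh by (auto simp: mesh_def)
  have "indicator Q x = (0::real)" if Q: "Q \<in> \<P> - {P}" for Q
  proof -
    have "disjnt P Q" using dis P(1) Q unfolding pairwise_def by blast
    then show ?thesis using P(2) by (simp add: disjnt_iff)
  qed
  then have "(\<Sum>P\<in>\<P>. indicator P x) = (indicator P x :: real)"
    using sum.remove[OF fin P(1), of "\<lambda>P. indicator P x :: real"] by simp
  then show ?thesis using P mesh_cell(2)[OF mesh P(1)] by auto
next
  case False
  have "x \<notin> \<Omega>"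
  proof
    assume "x \<in> \<Omega>"
    then have "x \<in> (\<Union>P\<in>\<P>. closure P)" using mesh closure_subset by (auto simp: mesh_def)
    then obtain P where P: "P \<in> \<P>" "x \<in> closure P" by blast
    then have "x \<in> frontier P" using False mesh_cell(3)[OF mesh P(1)] by (simp add: frontier_def interior_open)
    then show False using x P by (auto simp: skeleton_def)
  qed
  then show ?thesis using False by (simp add: indicator_def)
qed

lemma integral_mesh_decomposition:
  fixes h :: "real^'d \<Rightarrow> real"
  assumes mesh: "mesh \<Omega> \<P> \<F>" and h: "set_integrable lebesgue \<Omega> h"
  shows "(LINT x:\<Omega>|lebesgue. h x) = (\<Sum>P\<in>\<P>. LINT x:P|lebesgue. h x)"
proof -
  have int: "integrable lebesgue (\<lambda>x. indicator P x *\<^sub>R h x)" if "P \<in> \<P>" for P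
    using set_integrable_subset[OF h, of P] mesh_cell(2,3)[OF mesh that]
    unfolding set_integrable_def by simp
  have "AE x in lebesgue. x \<notin> skeleton \<P>"
    using skeleton_null[OF mesh] by (intro AE_not_in) (rule null_sets_completionI)
  then have "AE x in lebesgue. indicator \<Omega> x *\<^sub>R h x = (\<Sum>P\<in>\<P>. indicator P x *\<^sub>R h x)"
  proof eventually_elim
    case (elim x)
    then show ?case using mesh_indicator[OF mesh elim] by (simp add: sum_distrib_right[symmetric])
  qed
  then have "(LINT x:\<Omega>|lebesgue. h x) = (LINT x|lebesgue. (\<Sum>P\<in>\<P>. indicator P x *\<^sub>R h x))"
    unfolding set_lebesgue_integral_def
    using h int unfolding set_integrable_def by (intro integral_cong_AE) auto
  also have "\<dots> = (\<Sum>P\<in>\<P>. LINT x:P|lebesgue. h x)"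
    unfolding set_lebesgue_integral_def using int by (intro Bochner_Integration.integral_sum)
  finally show ?thesis .
qed

lemma time_partition_mono:
  assumes tp: "time_partition T N t" and ij: "i \<le> j" "j \<le> N"
  shows "t i \<le> t j"
  using ij
proof (induction j rule: dec_induct)
  case (step j)
  then have "t j < t (Suc j)" using tp by (simp add: time_partition_def)
  then show ?case using step by simp
qed simp

lemma time_partition_range:
  assumes "time_partition T N t" "i \<le> N" shows "0 \<le> t i" "t i \<le> T"
  using time_partition_mono[OF assms(1), of 0 i] time_partition_mono[OF assms(1), of i N] assms
  by (auto simp: time_partition_def)

lemma time_partition_indicator:
  assumes tp: "time_partition T N t" and s: "s \<notin> t ` {..N}"
  shows "(\<Sum>n<N. indicator {t n<..<t (Suc n)} s) = (indicator {0<..<T} s :: real)"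
proof -
  have "(\<Sum>n<k. indicator {t n<..<t (Suc n)} s) = (indicator {t 0<..<t k} s :: real)" if "k \<le> N" for k
    using that
  proof (induction k)
    case (Suc k)
    have "s \<noteq> t k" using s Suc.prems by auto
    moreover have "t 0 \<le> t k" "t k < t (Suc k)"
      using time_partition_mono[OF tp, of 0 k] Suc.prems tp by (auto simp: time_partition_def)
    ultimately show ?case using Suc by (auto simp: indicator_def)
  qed simp
  from this[of N] show ?thesis using tp by (simp add: time_partition_def)
qed

lemma AE_off_skeleton:
  assumes mesh: "mesh \<Omega> \<P> \<F>"
  shows "AE z in lebesgue. fst z \<notin> skeleton \<P> \<and> snd z \<notin> t ` {..N::nat}"
proof -
  have 1: "skeleton \<P> \<times> UNIV \<in> null_sets (lborel \<Otimes>\<^sub>M lborel)"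
    using skeleton_null[OF mesh] by (intro lborel.times_in_null_sets1) auto
  have 2: "UNIV \<times> t ` {..N} \<in> null_sets (lborel \<Otimes>\<^sub>M lborel)"
    by (intro lborel.times_in_null_sets2 finite_imp_null_set_lborel) auto
  have "AE z in lborel \<Otimes>\<^sub>M lborel. z \<notin> skeleton \<P> \<times> UNIV" "AE z in lborel \<Otimes>\<^sub>M lborel. z \<notin> UNIV \<times> t ` {..N}"
    using 1 2 by (auto intro!: AE_not_in)
  then have "AE z in lborel. fst z \<notin> skeleton \<P> \<and> snd z \<notin> t ` {..N}"
    unfolding lborel_prod by eventually_elim (auto simp: mem_Times_iff)
  then show ?thesis by (simp add: AE_completion_iff)
qed

lemma spacetime_indicator:
  assumes mesh: "mesh \<Omega> \<P> \<F>" and tp: "time_partition T N t"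
    and z: "fst z \<notin> skeleton \<P>" "snd z \<notin> t ` {..N}"
  shows "(\<Sum>n<N. \<Sum>P\<in>\<P>. indicator (P \<times> {t n<..<t (Suc n)}) z) = (indicator (\<Omega> \<times> {0<..<T}) z :: real)"
proof -
  have "(\<Sum>n<N. \<Sum>P\<in>\<P>. indicator (P \<times> {t n<..<t (Suc n)}) z :: real)
      = (\<Sum>n<N. indicator {t n<..<t (Suc n)} (snd z)) * (\<Sum>P\<in>\<P>. indicator P (fst z))"
    unfolding sum_product by (intro sum.cong refl) (auto simp: indicator_def mem_Times_iff)
  then show ?thesis unfolding mesh_indicator[OF mesh z(1)] time_partition_indicator[OF tp z(2)]
    by (auto simp: indicator_def mem_Times_iff)
qed

lemma integral_spacetime_decomposition:
  fixes h :: "(real^'d) \<times> real \<Rightarrow> real"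
  assumes mesh: "mesh \<Omega> \<P> \<F>" and tp: "time_partition T N t"
    and h: "set_integrable lebesgue (\<Omega> \<times> {0<..<T}) h"
  shows "(LINT z:\<Omega> \<times> {0<..<T}|lebesgue. h z)
    = (\<Sum>n<N. \<Sum>P\<in>\<P>. LINT z:P \<times> {t n<..<t (Suc n)}|lebesgue. h z)"
proof -
  have int: "integrable lebesgue (\<lambda>z. indicator (P \<times> {t n<..<t (Suc n)}) z *\<^sub>R h z)"
    if "P \<in> \<P>" "n < N" for P n
  proof -
    have "P \<times> {t n<..<t (Suc n)} \<subseteq> \<Omega> \<times> {0<..<T}"
      using mesh_cell(2)[OF mesh that(1)] time_partition_range[OF tp, of n] time_partition_range[OF tp, of "Suc n"] that(2)
      by auto
    moreover have "open (P \<times> {t n<..<t (Suc n)})" using mesh_cell(3)[OF mesh that(1)] by (intro open_Times) auto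
    ultimately show ?thesis using set_integrable_subset[OF h] unfolding set_integrable_def by simp
  qed
  have "AE z in lebesgue. indicator (\<Omega> \<times> {0<..<T}) z *\<^sub>R h z
      = (\<Sum>n<N. \<Sum>P\<in>\<P>. indicator (P \<times> {t n<..<t (Suc n)}) z *\<^sub>R h z)"
    using AE_off_skeleton[OF mesh, of t N]
  proof eventually_elim
    case (elim z)
    then show ?case using spacetime_indicator[OF mesh tp, of z] by (simp add: sum_distrib_right[symmetric])
  qed
  then have "(LINT z:\<Omega> \<times> {0<..<T}|lebesgue. h z)
      = (LINT z|lebesgue. (\<Sum>n<N. \<Sum>P\<in>\<P>. indicator (P \<times> {t n<..<t (Suc n)}) z *\<^sub>R h z))"
    unfolding set_lebesgue_integral_def
    using h int unfolding set_integrable_def by (intro integral_cong_AE) auto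
  also have "\<dots> = (\<Sum>n<N. \<Sum>P\<in>\<P>. LINT z:P \<times> {t n<..<t (Suc n)}|lebesgue. h z)"
    unfolding set_lebesgue_integral_def using int
    by (subst Bochner_Integration.integral_sum, force, intro sum.cong refl Bochner_Integration.integral_sum) auto
  finally show ?thesis .
qed

lemma measure_cylinder:
  fixes P :: "(real^'d) set"
  assumes P: "open P" "bounded P" and ab: "a \<le> b"
  shows "P \<times> {a<..<b} \<in> lmeasurable" "measure lebesgue (P \<times> {a<..<b}) = measure lebesgue P * (b - a)"
proof -
  have o: "open (P \<times> {a<..<b})" using P by (intro open_Times) auto
  show "P \<times> {a<..<b} \<in> lmeasurable"
    using P o by (intro bounded_set_imp_lmeasurable bounded_Times) auto
  have "emeasure lborel (P \<times> {a<..<b}) = emeasure lborel P * emeasure lborel {a<..<b}"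
    using P unfolding lborel_prod[symmetric] by (intro lborel.emeasure_pair_measure_Times) auto
  then have "measure lborel (P \<times> {a<..<b}) = measure lborel P * (b - a)"
    using ab by (simp add: measure_def enn2real_mult)
  then show "measure lebesgue (P \<times> {a<..<b}) = measure lebesgue P * (b - a)"
    using o P by (simp add: measure_completion)
qed

lemma integral_time_derivative:
  fixes h ht :: "(real^'d) \<times> real \<Rightarrow> real"
  assumes P: "open P" "bounded P" and ab: "a \<le> b"
    and h: "continuous_on UNIV h" and ht: "continuous_on UNIV ht"
    and der: "\<And>x s. ((\<lambda>s. h (x, s)) has_real_derivative ht (x, s)) (at s)"
  shows "(LINT z:P \<times> {a<..<b}|lebesgue. ht z) = (LINT x:P|lebesgue. h (x, b)) - (LINT x:P|lebesgue. h (x, a))"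
proof -
  have Pb: "P \<in> sets borel" using P by simp
  have ob: "P \<times> {a<..<b} \<in> sets borel" using P by (intro borel_open open_Times) auto
  have bb: "bounded (P \<times> {a<..<b})" using P by (intro bounded_Times) auto
  note I = continuous_set_integrable[OF ob bb ht]
  have ch: "continuous_on UNIV (\<lambda>x. h (x, s))" for s
    by (intro continuous_on_compose2[OF h] continuous_intros) auto
  note J = continuous_set_integrable[OF Pb P(2) ch]
  have inner: "(LINT s|lborel. indicator (P \<times> {a<..<b}) (x, s) *\<^sub>R ht (x, s)) = indicator P x *\<^sub>R (h (x, b) - h (x, a))" for x
  proof -
    have cx: "continuous_on UNIV (\<lambda>s. ht (x, s))"
      by (intro continuous_on_compose2[OF ht] continuous_intros) auto
    then have [measurable]: "(\<lambda>s. ht (x, s)) \<in> borel_measurable borel" by (rule borel_measurable_continuous_onI)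
    have "(LINT s|lborel. indicator {a<..<b} s *\<^sub>R ht (x, s)) = (LINT s|lborel. indicator {a..b} s *\<^sub>R ht (x, s))"
    proof (rule integral_cong_AE)
      show "AE s in lborel. indicator {a<..<b} s *\<^sub>R ht (x, s) = indicator {a..b} s *\<^sub>R ht (x, s)"
        using AE_lborel_singleton[of a] AE_lborel_singleton[of b]
        by eventually_elim (auto simp: indicator_def)
    qed measurable
    also have "\<dots> = h (x, b) - h (x, a)"
      using ab der
      by (intro integral_FTC_atLeastAtMost continuous_on_subset[OF cx])
        (auto simp: has_real_derivative_iff_has_vector_derivative intro: has_vector_derivative_at_within)
    moreover have "indicator (P \<times> {a<..<b}) (x, s) = (indicator P x * indicator {a<..<b} s :: real)" for s
      by (auto simp: indicator_def)
    ultimately show ?thesis by (simp add: mult.assoc)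
  qed
  have "(LINT z:P \<times> {a<..<b}|lebesgue. ht z) = (LINT z|(lborel \<Otimes>\<^sub>M lborel). indicator (P \<times> {a<..<b}) z *\<^sub>R ht z)"
    unfolding I(3) lborel_prod by (simp add: set_lebesgue_integral_def)
  also have "\<dots> = (LINT x|lborel. (LINT s|lborel. indicator (P \<times> {a<..<b}) (x, s) *\<^sub>R ht (x, s)))"
    by (rule lborel_pair.integral_fst'[symmetric]) (use I(1) in \<open>simp add: lborel_prod set_integrable_def\<close>)
  also have "\<dots> = (LINT x:P|lborel. h (x, b) - h (x, a))"
    unfolding inner by (simp add: set_lebesgue_integral_def)
  also have "\<dots> = (LINT x:P|lborel. h (x, b)) - (LINT x:P|lborel. h (x, a))"
    by (rule set_integral_diff(2)[OF J(1) J(1)])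
  finally show ?thesis unfolding J(3) .
qed

section \<open>Passing to the limit in nonlinear terms\<close>

lemma LIMSEQ_subseq_criterion:
  fixes X :: "nat \<Rightarrow> real"
  assumes "\<And>r :: nat \<Rightarrow> nat. strict_mono r \<Longrightarrow> \<exists>s :: nat \<Rightarrow> nat. strict_mono s \<and> (\<lambda>n. X (r (s n))) \<longlonglongrightarrow> l"
  shows "X \<longlonglongrightarrow> l"
proof (rule ccontr)
  assume "\<not> X \<longlonglongrightarrow> l"
  then obtain e where e: "e > 0" "\<forall>k. \<exists>n\<ge>k. dist (X n) l \<ge> e"
    unfolding lim_sequentially by (auto simp: not_less)
  then have "infinite {n. dist (X n) l \<ge> e}"
    unfolding infinite_nat_iff_unbounded_le by auto
  then obtain r :: "nat \<Rightarrow> nat" where r: "strict_mono r" "\<And>n. r n \<in> {n. dist (X n) l \<ge> e}"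
    using infinite_enumerate by blast
  obtain s :: "nat \<Rightarrow> nat" where s: "(\<lambda>n. X (r (s n))) \<longlonglongrightarrow> l" using assms[OF r(1)] by blast
  then obtain n where "dist (X (r (s n))) l < e" using e(1) unfolding lim_sequentially by blast
  then show False using r(2)[of "s n"] by simp
qed

text \<open>Every subsequence has a further one along which \<open>U\<close> converges almost everywhere. There the
  convergence passes to \<open>\<beta>\<close>, and the bounds permit dominated convergence. The limit is the same for
  all subsequences.\<close>

lemma tendsto_integral_composition:
  fixes U :: "nat \<Rightarrow> 'a \<Rightarrow> 'p::euclidean_space" and \<beta> :: "'p \<Rightarrow> 'b::euclidean_space"
  assumes fin: "finite_measure M" and \<beta>: "continuous_on UNIV \<beta>"
    and U: "\<And>m. U m \<in> borel_measurable M" "\<And>m. AE z in M. norm (U m z) \<le> C"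
    and V: "V \<in> borel_measurable M" "AE z in M. norm (V z) \<le> C'"
    and L1: "(\<lambda>m. LINT z|M. norm (U m z - V z)) \<longlonglongrightarrow> 0"
    and \<psi>: "\<And>m. \<psi> m \<in> borel_measurable M" "\<And>m. AE z in M. norm (\<psi> m z) \<le> B"
    and \<psi>0: "\<psi>0 \<in> borel_measurable M" "AE z in M. (\<lambda>m. \<psi> m z) \<longlonglongrightarrow> \<psi>0 z"
  shows "(\<lambda>m. LINT z|M. \<beta> (U m z) \<bullet> \<psi> m z) \<longlonglongrightarrow> (LINT z|M. \<beta> (V z) \<bullet> \<psi>0 z)"
proof (rule LIMSEQ_subseq_criterion)
  interpret finite_measure M by (rule fin)
  have \<beta>m [measurable]: "\<beta> \<in> borel_measurable borel" using \<beta> by (rule borel_measurable_continuous_onI)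
  note [measurable] = U(1) V(1) \<psi>(1) \<psi>0(1)
  have "bounded (\<beta> ` cball 0 C)"
    using \<beta> by (intro compact_imp_bounded compact_continuous_image) (auto intro: continuous_on_subset)
  then obtain D where "\<forall>u\<in>cball 0 C. norm (\<beta> u) \<le> D"
    unfolding bounded_iff by blast
  then have D: "norm (\<beta> u) \<le> D" if "norm u \<le> C" for u using that by simp
  have intU: "integrable M (U m)" for m
    by (rule integrable_const_bound[OF U(2) U(1)])
  have intV: "integrable M V" by (rule integrable_const_bound[OF V(2) V(1)])
  fix r :: "nat \<Rightarrow> nat" assume r: "strict_mono r"
  have "(\<lambda>n. LINT z|M. norm (U (r n) z - V z)) \<longlonglongrightarrow> 0"
    using LIMSEQ_subseq_LIMSEQ[OF L1 r] by (simp add: o_def)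
  then obtain s where s: "strict_mono s" "AE z in M. (\<lambda>n. U (r (s n)) z - V z) \<longlonglongrightarrow> 0"
    using tendsto_L1_AE_subseq[of M "\<lambda>n z. U (r n) z - V z"] intU intV by auto
  have rs: "strict_mono (r \<circ> s)" using r s(1) by (rule strict_mono_o)
  have "(\<lambda>n. LINT z|M. \<beta> (U (r (s n)) z) \<bullet> \<psi> (r (s n)) z) \<longlonglongrightarrow> (LINT z|M. \<beta> (V z) \<bullet> \<psi>0 z)"
  proof (rule integral_dominated_convergence[where w = "\<lambda>_. D * B"])
    show "AE z in M. (\<lambda>n. \<beta> (U (r (s n)) z) \<bullet> \<psi> (r (s n)) z) \<longlonglongrightarrow> \<beta> (V z) \<bullet> \<psi>0 z"
      using s(2) \<psi>0(2)
    proof eventually_elim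
      case (elim z)
      have "(\<lambda>n. U (r (s n)) z) \<longlonglongrightarrow> V z" using elim(1) by (simp add: LIM_zero_iff)
      moreover have "isCont \<beta> (V z)" using \<beta> by (simp add: continuous_on_eq_continuous_at)
      ultimately have "(\<lambda>n. \<beta> (U (r (s n)) z)) \<longlonglongrightarrow> \<beta> (V z)" using isCont_tendsto_compose by blast
      moreover have "(\<lambda>n. \<psi> (r (s n)) z) \<longlonglongrightarrow> \<psi>0 z"
        using LIMSEQ_subseq_LIMSEQ[OF elim(2) rs] by (simp add: o_def)
      ultimately show ?case by (rule tendsto_inner)
    qed
    show "AE z in M. norm (\<beta> (U (r (s n)) z) \<bullet> \<psi> (r (s n)) z) \<le> D * B" for n
      using U(2)[of "r (s n)"] \<psi>(2)[of "r (s n)"]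
    proof eventually_elim
      case (elim z)
      have "norm (\<beta> (U (r (s n)) z) \<bullet> \<psi> (r (s n)) z) \<le> norm (\<beta> (U (r (s n)) z)) * norm (\<psi> (r (s n)) z)"
        by (simp add: Cauchy_Schwarz_ineq2)
      also have "\<dots> \<le> D * B"
        by (rule mult_mono[OF D[OF elim(1)] elim(2) order_trans[OF norm_ge_zero D[OF elim(1)]] norm_ge_zero])
      finally show ?case .
    qed
  qed simp_all
  then show "\<exists>s. strict_mono s \<and> (\<lambda>n. LINT z|M. \<beta> (U (r (s n)) z) \<bullet> \<psi> (r (s n)) z) \<longlonglongrightarrow> (LINT z|M. \<beta> (V z) \<bullet> \<psi>0 z)"
    using s(1) by blast
qed

section \<open>Consistency of the discrete fluxes\<close>

lemma smooth_line_derivative: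
  fixes g :: "'a::real_normed_vector \<Rightarrow> real"
  assumes "smooth g"
  shows "((\<lambda>s. g (x + s *\<^sub>R v)) has_real_derivative frechet_derivative g (at (x + s *\<^sub>R v)) v) (at s)"
proof -
  have "((\<lambda>s. x + s *\<^sub>R v) has_derivative (\<lambda>h. h *\<^sub>R v)) (at s)"
    by (intro derivative_eq_intros) auto
  from has_derivative_compose[OF this smooth_has_derivative[OF assms]]
  have "((\<lambda>s. g (x + s *\<^sub>R v)) has_derivative (\<lambda>h. frechet_derivative g (at (x + s *\<^sub>R v)) (h *\<^sub>R v))) (at s)" .
  moreover have "(\<lambda>h. frechet_derivative g (at (x + s *\<^sub>R v)) (h *\<^sub>R v)) = (*) (frechet_derivative g (at (x + s *\<^sub>R v)) v)"
    using linear_scale[OF has_derivative_linear[OF smooth_has_derivative[OF assms]], of "x + s *\<^sub>R v" _ v]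
    by (intro ext) (metis mult.commute real_scaleR_def)
  ultimately show ?thesis by (simp only: has_field_derivative_def)
qed

text \<open>For the constant field \<open>H = w\<close> the left-hand side vanishes: the flux of \<open>w\<close> through the closed
  surface is zero, which removes \<open>k\<close>, and the divergence theorem for \<open>g w\<close> is exact. Hence only the
  deviation of \<open>H\<close> from \<open>w\<close> is multiplied by the oscillation of \<open>g\<close> on the cell, which is at most
  \<open>L * diameter P\<close>, and the estimate is uniform in the shape of the cell.\<close>

lemma cell_flux_consistency:
  fixes g :: "real^'d \<Rightarrow> real" and H :: "(real^'d) set \<Rightarrow> real^'d"
  assumes cell: "polyhedral_cell P \<Phi>"
    and disj: "nonoverlapping \<Phi>"
    and g: "smooth g" and lip: "\<And>x y. \<bar>g x - g y\<bar> \<le> L * dist x y" and L: "0 \<le> L"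
  defines "k \<equiv> 1 / measure lebesgue P * (LINT x:P|lebesgue. g x)"
  shows "\<bar>(\<Sum>\<zeta>\<in>\<Phi>. (k * face_measure \<zeta> - face_integral \<zeta> g) * (H \<zeta> \<bullet> outward_normal P \<zeta>))
        + (LINT x:P|lebesgue. frechet_derivative g (at x) w)\<bar>
    \<le> L * diameter P * (\<Sum>\<zeta>\<in>\<Phi>. face_measure \<zeta> * \<bar>(H \<zeta> - w) \<bullet> outward_normal P \<zeta>\<bar>)"
proof -
  define n where "n = outward_normal P"
  have P: "open P" "bounded P" "P \<noteq> {}" and fin: "finite \<Phi>" using cell by (auto simp: polyhedral_cell_def)
  have Pb: "P \<in> sets borel" using P by simp
  note ff = polyhedral_cell_face[OF cell]
  have gc: "continuous_on UNIV g" by (rule smooth_continuous[OF g])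
  have dc: "continuous_on UNIV (\<lambda>x. frechet_derivative g (at x) w)"
    by (intro smooth_continuous smooth_frechet_derivative g)
  have osc: "\<bar>g x - k\<bar> \<le> L * diameter P" if x: "x \<in> closure P" for x
  proof -
    have "norm ((1 / measure lebesgue P) *\<^sub>R (LINT x:P|lebesgue. g x) - g x) \<le> L * diameter P"
    proof (rule mean_value_approx[OF P gc])
      fix y assume "y \<in> P"
      then have "y \<in> closure P" using closure_subset by blast
      then have "dist y x \<le> diameter (closure P)"
        using x P(2) by (intro diameter_bounded_bound) auto
      then have "L * dist y x \<le> L * diameter P"
        using L diameter_closure[OF P(2)] by (intro mult_left_mono) auto
      then show "norm (g y - g x) \<le> L * diameter P" using lip[of y x] by simp
    qed
    then show ?thesis by (simp add: k_def abs_minus_commute)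
  qed
  have dev: "\<bar>k * face_measure \<zeta> - face_integral \<zeta> g\<bar> \<le> L * diameter P * face_measure \<zeta>" if "\<zeta> \<in> \<Phi>" for \<zeta>
  proof -
    have "\<bar>face_integral \<zeta> g - k * face_measure \<zeta>\<bar> \<le> (L * diameter P) * face_measure \<zeta>"
      using ff(2)[OF that] by (intro face_integral_approx ff(1)[OF that] gc osc) (auto simp: frontier_def)
    then show ?thesis by (simp add: abs_minus_commute)
  qed
  have div: "(LINT x:P|lebesgue. frechet_derivative g (at x) w) = (\<Sum>\<zeta>\<in>\<Phi>. (n \<zeta> \<bullet> w) * face_integral \<zeta> g)"
    using divergence_polyhedral_cell[OF cell disj gc dc smooth_line_derivative[OF g]]
      continuous_set_integrable(3)[OF Pb P(2) dc] by (simp add: set_lebesgue_integral_def n_def)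
  have "(LINT x|lborel. indicator P x * 0) = (\<Sum>\<zeta>\<in>\<Phi>. (n \<zeta> \<bullet> w) * face_integral \<zeta> (\<lambda>_. 1))"
    unfolding n_def by (rule divergence_polyhedral_cell[OF cell disj]) auto
  then have closed: "(\<Sum>\<zeta>\<in>\<Phi>. (n \<zeta> \<bullet> w) * face_measure \<zeta>) = 0"
    using face_integral_const_one[OF ff(1)] by simp
  have "(\<Sum>\<zeta>\<in>\<Phi>. (k * face_measure \<zeta> - face_integral \<zeta> g) * (H \<zeta> \<bullet> n \<zeta>))
        + (\<Sum>\<zeta>\<in>\<Phi>. (n \<zeta> \<bullet> w) * face_integral \<zeta> g)
      = (\<Sum>\<zeta>\<in>\<Phi>. (k * face_measure \<zeta> - face_integral \<zeta> g) * (H \<zeta> \<bullet> n \<zeta>))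
        + (\<Sum>\<zeta>\<in>\<Phi>. (n \<zeta> \<bullet> w) * face_integral \<zeta> g) - k * (\<Sum>\<zeta>\<in>\<Phi>. (n \<zeta> \<bullet> w) * face_measure \<zeta>)"
    by (simp add: closed)
  also have "\<dots> = (\<Sum>\<zeta>\<in>\<Phi>. (k * face_measure \<zeta> - face_integral \<zeta> g) * ((H \<zeta> - w) \<bullet> n \<zeta>))"
    unfolding sum_distrib_left sum.distrib[symmetric] sum_subtractf[symmetric]
    by (intro sum.cong refl) (simp add: inner_diff_left inner_commute[of w] algebra_simps)
  also have "\<bar>\<dots>\<bar> \<le> (\<Sum>\<zeta>\<in>\<Phi>. L * diameter P * (face_measure \<zeta> * \<bar>(H \<zeta> - w) \<bullet> n \<zeta>\<bar>))"
  proof (rule order_trans[OF sum_abs sum_mono])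
    fix \<zeta> assume "\<zeta> \<in> \<Phi>"
    from mult_right_mono[OF dev[OF this], of "\<bar>(H \<zeta> - w) \<bullet> n \<zeta>\<bar>"]
    show "\<bar>(k * face_measure \<zeta> - face_integral \<zeta> g) * ((H \<zeta> - w) \<bullet> n \<zeta>)\<bar>
        \<le> L * diameter P * (face_measure \<zeta> * \<bar>(H \<zeta> - w) \<bullet> n \<zeta>\<bar>)"
      by (simp add: abs_mult mult.assoc)
  qed
  finally show ?thesis unfolding div n_def[symmetric] by (simp add: sum_distrib_left)
qed

section \<open>Bounded functions on a set of finite measure\<close>

lemma bounded_set_integrable:
  fixes h :: "'a::euclidean_space \<Rightarrow> 'b::euclidean_space"
  assumes "S \<in> lmeasurable" "h \<in> borel_measurable (lebesgue_on S)" "AE z in lebesgue_on S. norm (h z) \<le> B"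
  shows "set_integrable lebesgue S h"
proof -
  interpret finite_measure "lebesgue_on S"
    using assms(1) by (rule finite_measure_lebesgue_on)
  have "integrable (lebesgue_on S) h" by (rule integrable_const_bound[OF assms(3,2)])
  then show ?thesis
    using assms(1) by (subst (asm) integrable_restrict_space) (auto simp: set_integrable_def fmeasurableD)
qed

lemma Linfty_AE_bounded:
  fixes u :: "'a \<Rightarrow> 'b::real_normed_vector"
  assumes "u \<in> Linfty M" obtains C where "AE z in M. norm (u z) \<le> C"
proof -
  define s where "s = Linfty_norm M u"
  have s: "s < \<infinity>" using assms by (simp add: Linfty_def s_def)
  have AE: "AE z in M. ereal (norm (u z)) \<le> s" unfolding s_def by (rule esssup_AE)
  show thesis
  proof (cases s)
    case (real r)
    then show ?thesis using that[of r] AE by simp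
  next
    case MInf
    have "AE z in M. norm (u z) \<le> 0" using AE unfolding MInf by eventually_elim simp
    then show ?thesis by (rule that)
  qed (use s in simp)
qed

lemma Linfty_norm_le_AE:
  fixes u :: "'a \<Rightarrow> 'b::real_normed_vector"
  assumes "Linfty_norm M u \<le> ereal C" shows "AE z in M. norm (u z) \<le> C"
  using esssup_AE[of "\<lambda>z. ereal (norm (u z))" M]
proof eventually_elim
  case (elim z)
  then have "ereal (norm (u z)) \<le> ereal C" using assms by (rule order_trans)
  then show ?case by simp
qed

lemma Linfty_comp_integrable:
  fixes u :: "'a::euclidean_space \<Rightarrow> 'p::euclidean_space" and \<beta> :: "'p \<Rightarrow> 'b::euclidean_space" and \<psi> :: "'a \<Rightarrow> 'b"
  assumes S: "S \<in> lmeasurable" and u: "u \<in> Linfty (lebesgue_on S)" and \<beta>: "continuous_on UNIV \<beta>"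
  shows "set_integrable lebesgue S (\<lambda>z. \<beta> (u z))"
    and "\<psi> \<in> borel_measurable (lebesgue_on S) \<Longrightarrow> (\<And>z. z \<in> S \<Longrightarrow> norm (\<psi> z) \<le> B) \<Longrightarrow>
      set_integrable lebesgue S (\<lambda>z. \<beta> (u z) \<bullet> \<psi> z)"
proof -
  obtain C where C: "AE z in lebesgue_on S. norm (u z) \<le> C" using Linfty_AE_bounded[OF u] .
  have um [measurable]: "u \<in> borel_measurable (lebesgue_on S)" using u by (simp add: Linfty_def)
  have \<beta>m [measurable]: "\<beta> \<in> borel_measurable borel" using \<beta> by (rule borel_measurable_continuous_onI)
  have "bounded (\<beta> ` cball 0 C)"
    using \<beta> by (intro compact_imp_bounded compact_continuous_image) (auto intro: continuous_on_subset)
  then obtain D where D: "\<forall>u\<in>cball 0 C. norm (\<beta> u) \<le> D" unfolding bounded_iff by blast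
  have AE\<beta>: "AE z in lebesgue_on S. norm (\<beta> (u z)) \<le> D"
    using C by eventually_elim (use D in simp)
  show "set_integrable lebesgue S (\<lambda>z. \<beta> (u z))"
    by (rule bounded_set_integrable[OF S _ AE\<beta>]) measurable
  assume \<psi> [measurable]: "\<psi> \<in> borel_measurable (lebesgue_on S)" and B: "\<And>z. z \<in> S \<Longrightarrow> norm (\<psi> z) \<le> B"
  show "set_integrable lebesgue S (\<lambda>z. \<beta> (u z) \<bullet> \<psi> z)"
  proof (rule bounded_set_integrable[OF S])
    show "(\<lambda>z. \<beta> (u z) \<bullet> \<psi> z) \<in> borel_measurable (lebesgue_on S)" by measurable
    have "AE z in lebesgue_on S. z \<in> S" by (rule AE_I2) simp
    then show "AE z in lebesgue_on S. norm (\<beta> (u z) \<bullet> \<psi> z) \<le> D * B"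
      using AE\<beta>
    proof eventually_elim
      case (elim z)
      have "norm (\<beta> (u z) \<bullet> \<psi> z) \<le> norm (\<beta> (u z)) * norm (\<psi> z)" by (simp add: Cauchy_Schwarz_ineq2)
      also have "\<dots> \<le> D * B"
        by (rule mult_mono[OF elim(2) B[OF elim(1)] order_trans[OF norm_ge_zero elim(2)] norm_ge_zero])
      finally show ?case .
    qed
  qed
qed

section \<open>The discrete weak formulation\<close>

lemma piecewise_const_on_cell:
  assumes mesh: "mesh \<Omega> \<P> \<F>" and tp: "time_partition T N t"
    and P: "P \<in> \<P>" and n: "n < N" and z: "z \<in> P \<times> {t n<..<t (Suc n)}"
  shows "(\<Sum>n'<N. \<Sum>P'\<in>\<P>. indicator (P' \<times> {t n'<..<t (Suc n')}) z *\<^sub>R c P' n') = (c P n :: 'b::real_vector)"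
proof -
  have fin: "finite \<P>" and dis: "pairwise disjnt \<P>" using mesh by (auto simp: mesh_def)
  have time: "n' = n" if "n' < N" "snd z \<in> {t n'<..<t (Suc n')}" for n'
  proof (rule ccontr)
    assume "n' \<noteq> n"
    then consider "Suc n' \<le> n" | "Suc n \<le> n'" by linarith
    then show False
    proof cases
      case 1
      then have "t (Suc n') \<le> t n" using time_partition_mono[OF tp 1] n by simp
      then show False using that z by auto
    next
      case 2
      then have "t (Suc n) \<le> t n'" using time_partition_mono[OF tp 2] that by simp
      then show False using that z by auto
    qed
  qed
  have space: "P' = P" if "P' \<in> \<P>" "fst z \<in> P'" for P'
  proof (rule ccontr)
    assume "P' \<noteq> P"
    then have "disjnt P' P" using dis that(1) P unfolding pairwise_def by blast
    then show False using that(2) z by (auto simp: disjnt_iff)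
  qed
  have "(\<Sum>P'\<in>\<P>. indicator (P' \<times> {t n'<..<t (Suc n')}) z *\<^sub>R c P' n') = (if n' = n then c P n else 0)"
    if n': "n' < N" for n'
  proof -
    have "indicator (P' \<times> {t n'<..<t (Suc n')}) z *\<^sub>R c P' n' = (if P' = P then if n' = n then c P n else 0 else 0)"
      if P': "P' \<in> \<P>" for P'
    proof (cases "z \<in> P' \<times> {t n'<..<t (Suc n')}")
      case True
      then have "n' = n" "P' = P" using time[OF n'] space[OF P'] by (auto simp: mem_Times_iff)
      then show ?thesis using z by simp
    next
      case False
      then have "\<not> (n' = n \<and> P' = P)" using z by blast
      then show ?thesis using False by auto
    qed
    then show ?thesis using fin P by (simp add: sum.delta)
  qed
  then show ?thesis using n by (simp add: sum.delta)
qed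

lemma integral_conv_op_interpolate:
  assumes mesh: "mesh \<Omega> \<P> \<F>" and tp: "time_partition T N t"
  shows "(LINT z:\<Omega> \<times> {0<..<T}|lebesgue. conv_op \<P> \<F> N t b F z * interpolate \<P> N t \<phi> z)
    = (\<Sum>n<N. \<Sum>P\<in>\<P>. (t (Suc n) - t n) * conv_coeff \<F> t b F P n * (LINT x:P|lebesgue. \<phi> (x, t n)))"
proof -
  define c where "c P n = conv_coeff \<F> t b F P n * (1 / measure lebesgue P * (LINT x:P|lebesgue. \<phi> (x, t n)))" for P n
  define R where "R P n = P \<times> {t n<..<t (Suc n)}" for P :: "(real^'a) set" and n
  have dt: "t n < t (Suc n)" if "n < N" for n using tp that by (simp add: time_partition_def)
  have prod: "conv_op \<P> \<F> N t b F z * interpolate \<P> N t \<phi> z = (\<Sum>n<N. \<Sum>P\<in>\<P>. c P n * indicator (R P n) z)" for z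
  proof (cases "\<exists>n<N. \<exists>P\<in>\<P>. z \<in> R P n")
    case True
    then obtain n P where nP: "n < N" "P \<in> \<P>" "z \<in> P \<times> {t n<..<t (Suc n)}" by (auto simp: R_def)
    have "(\<Sum>n'<N. \<Sum>P'\<in>\<P>. k P' n' * indicator (P' \<times> {t n'<..<t (Suc n')}) z) = k P n" for k :: "(real^'a) set \<Rightarrow> nat \<Rightarrow> real"
      using piecewise_const_on_cell[OF mesh tp nP(2,1,3), of k] by (simp add: mult.commute)
    then show ?thesis by (simp only: conv_op_def interpolate_def piecewise_const_def R_def c_def)
  next
    case False
    then have "(\<Sum>n<N. \<Sum>P\<in>\<P>. k P n * indicator (R P n) z) = 0" for k :: "(real^'a) set \<Rightarrow> nat \<Rightarrow> real"
      by (intro sum.neutral ballI) auto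
    then show ?thesis by (simp add: conv_op_def piecewise_const_def R_def)
  qed
  have lm: "R P n \<in> lmeasurable" "measure lebesgue (R P n) = measure lebesgue P * (t (Suc n) - t n)"
    if "P \<in> \<P>" "n < N" for P n
    unfolding R_def using measure_cylinder[OF mesh_cell(3,4)[OF mesh that(1)]] dt[OF that(2)] by auto
  have sub: "R P n \<subseteq> \<Omega> \<times> {0<..<T}" if "P \<in> \<P>" "n < N" for P n
    using mesh_cell(2)[OF mesh that(1)] time_partition_range[OF tp, of n] time_partition_range[OF tp, of "Suc n"] that(2)
    by (auto simp: R_def)
  have ii: "integrable lebesgue (\<lambda>z. c P n * indicator (R P n) z)" if "P \<in> \<P>" "n < N" for P n
  proof -
    have "integrable lebesgue (indicator (R P n) :: _ \<Rightarrow> real)"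
      using lm(1)[OF that] by (simp only: lmeasurable_iff_integrable)
    then show ?thesis by (rule integrable_mult_right)
  qed
  have "(LINT z:\<Omega> \<times> {0<..<T}|lebesgue. conv_op \<P> \<F> N t b F z * interpolate \<P> N t \<phi> z)
      = (LINT z|lebesgue. (\<Sum>n<N. \<Sum>P\<in>\<P>. c P n * indicator (R P n) z))"
    unfolding set_lebesgue_integral_def
  proof (rule Bochner_Integration.integral_cong[OF refl])
    fix z
    show "indicator (\<Omega> \<times> {0<..<T}) z *\<^sub>R (conv_op \<P> \<F> N t b F z * interpolate \<P> N t \<phi> z)
        = (\<Sum>n<N. \<Sum>P\<in>\<P>. c P n * indicator (R P n) z)"
    proof (cases "z \<in> \<Omega> \<times> {0<..<T}")
      case False
      then have "(\<Sum>n<N. \<Sum>P\<in>\<P>. c P n * indicator (R P n) z) = 0"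
        using sub by (intro sum.neutral ballI) (auto simp: indicator_def)
      then show ?thesis using False by simp
    qed (simp add: prod)
  qed
  also have "\<dots> = (\<Sum>n<N. \<Sum>P\<in>\<P>. LINT z|lebesgue. c P n * indicator (R P n) z)"
    using ii by (subst Bochner_Integration.integral_sum, force, intro sum.cong refl Bochner_Integration.integral_sum) auto
  also have "\<dots> = (\<Sum>n<N. \<Sum>P\<in>\<P>. (t (Suc n) - t n) * conv_coeff \<F> t b F P n * (LINT x:P|lebesgue. \<phi> (x, t n)))"
  proof (intro sum.cong refl)
    fix n P assume nP: "n \<in> {..<N}" "P \<in> \<P>"
    have "(LINT z|lebesgue. c P n * indicator (R P n) z) = c P n * measure lebesgue (R P n)" by simp
    also have "\<dots> = (t (Suc n) - t n) * conv_coeff \<F> t b F P n * (LINT x:P|lebesgue. \<phi> (x, t n))"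
      using lm(2)[of P n] nP mesh_cell_measure(2)[OF mesh nP(2)] by (simp add: c_def)
    finally show "(LINT z|lebesgue. c P n * indicator (R P n) z)
      = (t (Suc n) - t n) * conv_coeff \<F> t b F P n * (LINT x:P|lebesgue. \<phi> (x, t n))" .
  qed
  finally show ?thesis .
qed

lemma summation_by_parts:
  fixes b \<Phi> :: "nat \<Rightarrow> real"
  shows "(\<Sum>n<N. (b (Suc n) - b n) * \<Phi> n)
    = b N * \<Phi> N - b 0 * \<Phi> 0 - (\<Sum>n=1..N. b n * (\<Phi> n - \<Phi> (n - 1)))"
  by (induction N) (simp_all add: algebra_simps)

definition flux_residual :: "(real^'d) set \<Rightarrow> (real^'d) set set \<Rightarrow> ((real^'d) set \<Rightarrow> (real^'d) set set) \<Rightarrow>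
    nat \<Rightarrow> (nat \<Rightarrow> real) \<Rightarrow> ((real^'d) set \<Rightarrow> nat \<Rightarrow> real^'d) \<Rightarrow> ((real^'d) \<times> real \<Rightarrow> real^'d) \<Rightarrow> real"
  where "flux_residual \<Omega> \<P> \<F> N t F V =
    (\<Sum>n<N. \<Sum>P\<in>interior_cells \<Omega> \<P> \<F>. diameter P / measure lebesgue P *
      (\<Sum>\<zeta>\<in>\<F> P. face_measure \<zeta> *
        (LINT z:P \<times> {t n<..<t (Suc n)}|lebesgue. \<bar>(F \<zeta> n - V z) \<bullet> outward_normal P \<zeta>\<bar>)))"

text \<open>The comparison field is the mean of \<open>V\<close> over the space-time cell. With it the gradient term
  becomes the integral of \<open>V\<close> against the mean of the gradient, and the deviation of a flux from the
  mean of \<open>V\<close> is at most the mean deviation from \<open>V\<close>.\<close>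

lemma cell_time_flux_estimate:
  fixes g :: "real^'d \<Rightarrow> real" and D :: "real^'d \<Rightarrow> real^'d" and f :: "real^'p \<Rightarrow> real^'d"
  assumes mesh: "mesh \<Omega> \<P> \<F>" and P: "P \<in> \<P>" and ab: "a < b"
    and V: "set_integrable lebesgue (P \<times> {a<..<b}) V"
    and g: "smooth g" and lip: "\<And>x y. \<bar>g x - g y\<bar> \<le> L * dist x y" and L: "0 \<le> L"
    and D: "continuous_on UNIV D" "\<And>x v. x \<in> P \<Longrightarrow> frechet_derivative g (at x) v = D x \<bullet> v"
  defines "k \<equiv> 1 / measure lebesgue P * (LINT x:P|lebesgue. g x)"
    and "\<psi> \<equiv> (1 / measure lebesgue P) *\<^sub>R (LINT x:P|lebesgue. D x)"
  shows "\<bar>(b - a) * (\<Sum>\<zeta>\<in>\<F> P. (k * face_measure \<zeta> - face_integral \<zeta> g) * (H \<zeta> \<bullet> outward_normal P \<zeta>))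
        + (LINT z:P \<times> {a<..<b}|lebesgue. V z \<bullet> \<psi>)\<bar>
    \<le> L * (diameter P / measure lebesgue P * (\<Sum>\<zeta>\<in>\<F> P. face_measure \<zeta> *
          (LINT z:P \<times> {a<..<b}|lebesgue. \<bar>(H \<zeta> - V z) \<bullet> outward_normal P \<zeta>\<bar>)))"
proof -
  define R where "R = P \<times> {a<..<b}"
  define \<delta> where "\<delta> = b - a"
  define \<mu> where "\<mu> = measure lebesgue P"
  define W where "W = (LINT z:R|lebesgue. V z)"
  define w where "w = (1 / (\<delta> * \<mu>)) *\<^sub>R W"
  have pos: "\<delta> > 0" "\<mu> > 0" using ab mesh_cell_measure(2)[OF mesh P] by (auto simp: \<delta>_def \<mu>_def)
  note cell = mesh_cell[OF mesh P]
  have Rm: "R \<in> lmeasurable" "measure lebesgue R = \<delta> * \<mu>"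
    using measure_cylinder[OF cell(3,4), of a b] ab by (auto simp: R_def \<delta>_def \<mu>_def)
  have V': "integrable lebesgue (\<lambda>z. indicator R z *\<^sub>R V z)" using V unfolding R_def set_integrable_def .
  have ind: "integrable lebesgue (indicator R :: _ \<Rightarrow> real)" using Rm(1) by (simp only: lmeasurable_iff_integrable)
  have grad: "\<delta> * (LINT x:P|lebesgue. frechet_derivative g (at x) w) = (LINT z:R|lebesgue. V z \<bullet> \<psi>)"
  proof -
    have "set_integrable lebesgue P D" using cell(3,4) D(1) by (intro continuous_set_integrable) auto
    then have iD: "integrable lebesgue (\<lambda>x. indicator P x *\<^sub>R D x)" unfolding set_integrable_def .
    have "(LINT x:P|lebesgue. frechet_derivative g (at x) w) = (LINT x|lebesgue. (indicator P x *\<^sub>R D x) \<bullet> w)"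
      unfolding set_lebesgue_integral_def
      by (intro Bochner_Integration.integral_cong refl) (auto simp: D(2) indicator_def)
    also have "\<dots> = (LINT x:P|lebesgue. D x) \<bullet> w"
      unfolding set_lebesgue_integral_def by (rule integral_inner_left) (rule iD)
    also have "(LINT x:P|lebesgue. D x) = \<mu> *\<^sub>R \<psi>" using pos(2) by (simp add: \<psi>_def \<mu>_def)
    finally have "\<delta> * (LINT x:P|lebesgue. frechet_derivative g (at x) w) = W \<bullet> \<psi>"
      using pos by (simp add: w_def inner_commute)
    also have "\<dots> = (LINT z|lebesgue. (indicator R z *\<^sub>R V z) \<bullet> \<psi>)"
      unfolding W_def set_lebesgue_integral_def by (rule integral_inner_left[symmetric]) (rule V')
    finally show ?thesis by (simp add: set_lebesgue_integral_def)
  qed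
  have dev: "\<delta> * \<bar>(H \<zeta> - w) \<bullet> n\<bar> \<le> (1 / \<mu>) * (LINT z:R|lebesgue. \<bar>(H \<zeta> - V z) \<bullet> n\<bar>)" for \<zeta> n
  proof -
    have iH: "integrable lebesgue (\<lambda>z. indicator R z *\<^sub>R H \<zeta>)" by (rule integrable_scaleR_left) (rule ind)
    have "(LINT z|lebesgue. (indicator R z *\<^sub>R H \<zeta> - indicator R z *\<^sub>R V z) \<bullet> n)
        = ((LINT z|lebesgue. indicator R z *\<^sub>R H \<zeta>) - W) \<bullet> n"
      using iH V' by (simp add: W_def set_lebesgue_integral_def)
    also have "(LINT z|lebesgue. indicator R z *\<^sub>R H \<zeta>) = (\<delta> * \<mu>) *\<^sub>R H \<zeta>"
      using ind Rm(2) by simp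
    also have "((\<delta> * \<mu>) *\<^sub>R H \<zeta> - W) \<bullet> n = \<delta> * \<mu> * ((H \<zeta> - w) \<bullet> n)"
      using pos by (simp add: w_def inner_diff_left algebra_simps)
    finally have "\<delta> * \<mu> * ((H \<zeta> - w) \<bullet> n) = (LINT z|lebesgue. (indicator R z *\<^sub>R H \<zeta> - indicator R z *\<^sub>R V z) \<bullet> n)" ..
    then have "\<delta> * \<mu> * \<bar>(H \<zeta> - w) \<bullet> n\<bar> = \<bar>LINT z|lebesgue. (indicator R z *\<^sub>R H \<zeta> - indicator R z *\<^sub>R V z) \<bullet> n\<bar>"
      using pos by (metis abs_mult abs_of_pos mult_pos_pos)
    also have "\<dots> \<le> (LINT z|lebesgue. \<bar>(indicator R z *\<^sub>R H \<zeta> - indicator R z *\<^sub>R V z) \<bullet> n\<bar>)"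
      by (rule integral_abs_bound)
    also have "\<dots> = (LINT z:R|lebesgue. \<bar>(H \<zeta> - V z) \<bullet> n\<bar>)"
      unfolding set_lebesgue_integral_def
      by (intro Bochner_Integration.integral_cong refl) (auto simp: indicator_def)
    finally show ?thesis using pos by (simp add: field_simps)
  qed
  define S where "S = (\<Sum>\<zeta>\<in>\<F> P. (k * face_measure \<zeta> - face_integral \<zeta> g) * (H \<zeta> \<bullet> outward_normal P \<zeta>))"
  have diam: "0 \<le> diameter P" using cell(4) by (rule diameter_ge_0)
  have "\<bar>\<delta> * S + (LINT z:R|lebesgue. V z \<bullet> \<psi>)\<bar> = \<delta> * \<bar>S + (LINT x:P|lebesgue. frechet_derivative g (at x) w)\<bar>"
    unfolding grad[symmetric] distrib_left[symmetric] abs_mult using pos by simp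
  also have "\<dots> \<le> \<delta> * (L * diameter P * (\<Sum>\<zeta>\<in>\<F> P. face_measure \<zeta> * \<bar>(H \<zeta> - w) \<bullet> outward_normal P \<zeta>\<bar>))"
    unfolding S_def k_def
    by (intro mult_left_mono cell_flux_consistency[OF cell(1,7) g lip L]) (use pos in simp)
  also have "\<dots> = L * diameter P * (\<Sum>\<zeta>\<in>\<F> P. face_measure \<zeta> * (\<delta> * \<bar>(H \<zeta> - w) \<bullet> outward_normal P \<zeta>\<bar>))"
    by (simp add: sum_distrib_left ac_simps)
  also have "\<dots> \<le> L * diameter P * (\<Sum>\<zeta>\<in>\<F> P. face_measure \<zeta> * ((1 / \<mu>) * (LINT z:R|lebesgue. \<bar>(H \<zeta> - V z) \<bullet> outward_normal P \<zeta>\<bar>)))"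
    using L diam by (intro mult_left_mono sum_mono dev face_measure_nonneg) auto
  also have "\<dots> = L * (diameter P / \<mu> * (\<Sum>\<zeta>\<in>\<F> P. face_measure \<zeta> * (LINT z:R|lebesgue. \<bar>(H \<zeta> - V z) \<bullet> outward_normal P \<zeta>\<bar>)))"
    by (simp add: sum_distrib_left ac_simps)
  finally show ?thesis by (simp add: S_def R_def \<delta>_def \<mu>_def)
qed

definition grad_mean :: "(real^'d) set set \<Rightarrow> nat \<Rightarrow> (nat \<Rightarrow> real) \<Rightarrow> ((real^'d) \<times> real \<Rightarrow> real) \<Rightarrow>
    (real^'d) \<times> real \<Rightarrow> real^'d"
  where "grad_mean \<P> N t \<phi> z = (\<Sum>n<N. \<Sum>P\<in>\<P>. indicator (P \<times> {t n<..<t (Suc n)}) z *\<^sub>R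
    ((1 / measure lebesgue P) *\<^sub>R (LINT x:P|lebesgue. space_grad \<phi> (x, t n))))"

lemma continuous_space_grad_slice:
  "smooth \<phi> \<Longrightarrow> continuous_on UNIV (\<lambda>x. space_grad \<phi> (x, s))"
  by (rule continuous_on_compose2[OF space_grad_continuous]) (auto intro!: continuous_intros)

lemma grad_mean_close:
  assumes mesh: "mesh \<Omega> \<P> \<F>" and tp: "time_partition T N t" and \<phi>: "smooth \<phi>"
    and P: "P \<in> \<P>" and n: "n < N" and z: "z \<in> P \<times> {t n<..<t (Suc n)}"
    and close: "\<And>y. y \<in> P \<Longrightarrow> norm (space_grad \<phi> (y, t n) - k) \<le> e"
  shows "norm (grad_mean \<P> N t \<phi> z - k) \<le> e"
  unfolding grad_mean_def piecewise_const_on_cell[OF mesh tp P n z]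
  by (rule mean_value_approx[OF mesh_cell(3,4,5)[OF mesh P] continuous_space_grad_slice[OF \<phi>] close])

lemma grad_mean_bound:
  assumes mesh: "mesh \<Omega> \<P> \<F>" and tp: "time_partition T N t" and \<phi>: "smooth \<phi>"
    and L: "0 \<le> L" "\<And>x s. x \<in> \<Omega> \<Longrightarrow> s \<in> {0..T} \<Longrightarrow> norm (space_grad \<phi> (x, s)) \<le> L"
  shows "norm (grad_mean \<P> N t \<phi> z) \<le> L"
proof (cases "\<exists>n<N. \<exists>P\<in>\<P>. z \<in> P \<times> {t n<..<t (Suc n)}")
  case True
  then obtain n P where nP: "n < N" "P \<in> \<P>" "z \<in> P \<times> {t n<..<t (Suc n)}" by blast
  have "norm (grad_mean \<P> N t \<phi> z - 0) \<le> L"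
    using time_partition_range[OF tp, of n] nP(1) mesh_cell(2)[OF mesh nP(2)]
    by (intro grad_mean_close[OF mesh tp \<phi> nP(2,1,3)]) (auto intro!: L(2))
  then show ?thesis by simp
next
  case False
  then have "grad_mean \<P> N t \<phi> z = 0" unfolding grad_mean_def by (intro sum.neutral ballI) auto
  then show ?thesis using L(1) by simp
qed

lemma grad_mean_measurable:
  assumes mesh: "mesh \<Omega> \<P> \<F>"
  shows "grad_mean \<P> N t \<phi> \<in> borel_measurable (lebesgue_on S)"
proof -
  have "P \<times> {t n<..<t (Suc n)} \<in> sets borel" if "P \<in> \<P>" for P n
    using mesh_cell(3)[OF mesh that] by (intro borel_open open_Times) auto
  then have "grad_mean \<P> N t \<phi> \<in> borel_measurable borel"
    unfolding grad_mean_def[abs_def] by (intro borel_measurable_sum borel_measurable_scaleR) auto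
  then have "grad_mean \<P> N t \<phi> \<in> borel_measurable lebesgue" by (intro measurable_completion) simp
  then show ?thesis by (rule measurable_restrict_space1)
qed

lemma spacetime_cylinder_lmeasurable:
  fixes \<Omega> :: "(real^'d) set" and T :: real
  assumes "mesh \<Omega> \<P> \<F>" "open \<Omega>" "0 \<le> T"
  shows "\<Omega> \<times> {0<..<T} \<in> lmeasurable"
  using measure_cylinder(1)[OF assms(2) mesh_bounded[OF assms(1)] assms(3)] .

text \<open>Summation by parts in time is exact, and the fluxes are replaced by \<open>f (U z)\<close> cell by
  cell. The size \<open>e\<close> below which the cells near the boundary miss the support, and the Lipschitz
  constant \<open>L\<close>, depend on the test function only, so that one estimate serves the whole sequence of
  meshes.\<close>

lemma discrete_weak_formulation:
  fixes \<phi> :: "(real^'d) \<times> real \<Rightarrow> real" and f :: "real^'p \<Rightarrow> real^'d"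
  assumes \<Omega>: "open \<Omega>" and T: "T > 0" and \<phi>: "\<phi> \<in> spacetime_test_functions \<Omega> T" and f: "continuous_on UNIV f"
  obtains e L where "0 < e" "0 \<le> L"
    "\<And>x s. x \<in> \<Omega> \<Longrightarrow> s \<in> {0..T} \<Longrightarrow> \<bar>time_deriv \<phi> (x, s)\<bar> \<le> L \<and> norm (space_grad \<phi> (x, s)) \<le> L"
    "\<And>\<P> \<F> P x s. mesh \<Omega> \<P> \<F> \<Longrightarrow> P \<in> \<P> - interior_cells \<Omega> \<P> \<F> \<Longrightarrow> diameter P < e \<Longrightarrow> x \<in> P \<Longrightarrow> s \<in> {0..T} \<Longrightarrow>
      \<phi> (x, s) = 0 \<and> time_deriv \<phi> (x, s) = 0"
    "\<And>\<P> \<F> N t b F (U :: (real^'d) \<times> real \<Rightarrow> real^'p).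
      mesh \<Omega> \<P> \<F> \<Longrightarrow> time_partition T N t \<Longrightarrow> (\<And>P. P \<in> \<P> \<Longrightarrow> diameter P < e) \<Longrightarrow>
      U \<in> Linfty (lebesgue_on (\<Omega> \<times> {0<..<T})) \<Longrightarrow>
      \<bar>(LINT z:\<Omega> \<times> {0<..<T}|lebesgue. conv_op \<P> \<F> N t b F z * interpolate \<P> N t \<phi> z)
        + (\<Sum>P\<in>interior_cells \<Omega> \<P> \<F>. b P 0 * (LINT x:P|lebesgue. \<phi> (x, 0)))
        + (\<Sum>n=1..N. \<Sum>P\<in>interior_cells \<Omega> \<P> \<F>. b P n * (LINT z:P \<times> {t (n - 1)<..<t n}|lebesgue. time_deriv \<phi> z))
        + (LINT z:\<Omega> \<times> {0<..<T}|lebesgue. f (U z) \<bullet> grad_mean \<P> N t \<phi> z)\<bar>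
      \<le> L * flux_residual \<Omega> \<P> \<F> N t F (\<lambda>z. f (U z))"
proof -
  define G where "G s x = (if x \<in> \<Omega> then \<phi> (x, s) else 0)" for s x
  have sm: "smooth \<phi>" using \<phi> by (simp add: spacetime_test_functions_def)
  obtain K L where K: "compact K" "K \<subseteq> \<Omega>" and L: "0 \<le> L"
    and Gt': "\<forall>s\<in>{0..T}. G s \<in> test_functions \<Omega>"
    and GT': "\<forall>x. G T x = 0"
    and G0': "\<forall>s\<in>{0..T}. \<forall>x. x \<notin> K \<longrightarrow> G s x = 0"
    and d0': "\<forall>s\<in>{0..T}. \<forall>x\<in>\<Omega> - K. time_deriv \<phi> (x, s) = 0 \<and> space_grad \<phi> (x, s) = 0"
    and bd': "\<forall>s\<in>{0..T}. \<forall>x\<in>\<Omega>. \<bar>time_deriv \<phi> (x, s)\<bar> \<le> L \<and> norm (space_grad \<phi> (x, s)) \<le> L"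
    and Gd': "\<forall>s\<in>{0..T}. \<forall>x v. frechet_derivative (G s) (at x) v = (if x \<in> \<Omega> then space_grad \<phi> (x, s) \<bullet> v else 0)"
    and lip': "\<forall>s\<in>{0..T}. \<forall>x y. \<bar>G s x - G s y\<bar> \<le> L * dist x y"
    unfolding G_def[abs_def] by (rule spacetime_test_function_slices[OF \<phi> \<Omega> T])
  note Gt = Gt'[rule_format] and GT = GT'[rule_format] and G0 = G0'[rule_format] and d0 = d0'[rule_format]
    and bd = bd'[rule_format] and Gd = Gd'[rule_format] and lip = lip'[rule_format]
  obtain e where e: "e > 0" "(\<Union>x\<in>K. ball x e) \<subseteq> \<Omega>"
    using compact_subset_open_imp_ball_epsilon_subset[OF K(1) \<Omega> K(2)] by blast
  have ball: "ball x e \<subseteq> \<Omega>" if "x \<in> K" for x using e(2) that by blast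
  have avoid: "closure P \<inter> K = {}"
    if "mesh \<Omega> \<P> \<F>" "P \<in> \<P> - interior_cells \<Omega> \<P> \<F>" "diameter P < e" for \<P> \<F> P
    using noninterior_cell_avoids[OF that(1) \<Omega> _ _ ball that(3)] that(2) by blast
  have cphi: "continuous_on UNIV \<phi>" by (rule smooth_continuous[OF sm])
  have cdt: "continuous_on UNIV (time_deriv \<phi>)"
    unfolding time_deriv_frechet(1)[OF sm] by (intro smooth_continuous smooth_frechet_derivative sm)
  show thesis
  proof (rule that[OF e(1) L], goal_cases)
    case (1 x s)
    then show ?case using bd by blast
  next
    case (2 \<P> \<F> P x s)
    have "x \<in> \<Omega>" using mesh_cell(2)[OF 2(1)] 2(2,4) by auto
    moreover have "x \<notin> K" using avoid[OF 2(1-3)] closure_subset[of P] 2(4) by auto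
    ultimately show ?case using G0[OF 2(5), of x] d0[OF 2(5), of x] by (simp add: G_def)
  next
    case (3 \<P> \<F> N t b F U)
    note mesh = 3(1) and tp = 3(2) and small = 3(3) and U = 3(4)
    define IC where "IC = interior_cells \<Omega> \<P> \<F>"
    define R where "R P n = P \<times> {t n<..<t (Suc n)}" for P :: "(real^'d) set" and n
    define Av where "Av P n = (LINT x:P|lebesgue. \<phi> (x, t n))" for P n
    define \<psi> where "\<psi> P n = (1 / measure lebesgue P) *\<^sub>R (LINT x:P|lebesgue. space_grad \<phi> (x, t n))" for P n
    define flux where "flux P n = (\<Sum>\<zeta>\<in>\<F> P. (Av P n / measure lebesgue P * face_measure \<zeta> - face_integral \<zeta> (G (t n))) *
        (F \<zeta> n \<bullet> outward_normal P \<zeta>))" for P n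
    define err where "err P n = diameter P / measure lebesgue P * (\<Sum>\<zeta>\<in>\<F> P. face_measure \<zeta> *
        (LINT z:R P n|lebesgue. \<bar>(F \<zeta> n - f (U z)) \<bullet> outward_normal P \<zeta>\<bar>))" for P n
    have fin: "finite \<P>" using mesh by (simp add: mesh_def)
    have ICP: "IC \<subseteq> \<P>" by (auto simp: IC_def interior_cells_def)
    have dt: "t n < t (Suc n)" if "n < N" for n using tp that by (simp add: time_partition_def)
    have tr: "t n \<in> {0..T}" if "n \<le> N" for n using time_partition_range[OF tp that] by simp
    have Gphi: "G s x = \<phi> (x, s)" if "P \<in> \<P>" "x \<in> P" for P x s
      using mesh_cell(2)[OF mesh that(1)] that(2) by (auto simp: G_def)
    have Qm: "\<Omega> \<times> {0<..<T} \<in> lmeasurable" using spacetime_cylinder_lmeasurable[OF mesh \<Omega>] T by simp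
    have smG: "smooth (G (t n))" if "n \<le> N" for n using Gt[OF tr[OF that]] by (simp add: test_functions_def)
    have Avg: "Av P n = (LINT x:P|lebesgue. G (t n) x)" if "P \<in> \<P>" for P n
      unfolding Av_def by (rule set_integral_cong) (simp add: Gphi[OF that])
    have far: "closure P \<inter> K = {}" if "P \<in> \<P> - IC" for P
      using avoid[OF mesh] that small by (auto simp: IC_def)
    have farP: "x \<in> \<Omega> - K" if "P \<in> \<P> - IC" "x \<in> P" for P x
      using far[OF that(1)] closure_subset[of P] mesh_cell(2)[OF mesh, of P] that by auto
    have Av0: "Av P n = 0" if "P \<in> \<P> - IC" "n \<le> N" for P n
      unfolding Avg[OF DiffD1[OF that(1)]]
      by (rule set_integral_eq_0) (use G0[OF tr[OF that(2)]] farP[OF that(1)] in blast)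
    have AvN: "Av P N = 0" if "P \<in> \<P>" for P
    proof -
      have "G (t N) = (\<lambda>x. 0)" using tp GT by (auto simp: time_partition_def)
      then show ?thesis unfolding Avg[OF that] by (simp add: set_lebesgue_integral_def)
    qed
    have Avdiff: "Av P n - Av P (n - 1) = (LINT z:P \<times> {t (n - 1)<..<t n}|lebesgue. time_deriv \<phi> z)"
      if "P \<in> \<P>" "n \<in> {1..N}" for P n
    proof -
      have "n - 1 < N" "Suc (n - 1) = n" using that by auto
      then have "t (n - 1) \<le> t n" using dt[of "n - 1"] by simp
      then show ?thesis unfolding Av_def
        by (intro integral_time_derivative[OF mesh_cell(3,4)[OF mesh that(1)] _ cphi cdt time_deriv_frechet(2)[OF sm], symmetric])
    qed
    (* The fluxes weighted by the face means of the test function cancel by conservativity. *)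
    have cons: "(\<Sum>P\<in>\<P>. (t (Suc n) - t n) * conv_coeff \<F> t b F P n * Av P n)
        = (\<Sum>P\<in>\<P>. (b P (Suc n) - b P n) * Av P n) + (\<Sum>P\<in>\<P>. (t (Suc n) - t n) * flux P n)" if n: "n < N" for n
    proof -
      have "(\<Sum>P\<in>\<P>. \<Sum>\<zeta>\<in>\<F> P. face_integral \<zeta> (G (t n)) * (F \<zeta> n \<bullet> outward_normal P \<zeta>)) = 0"
      proof (rule mesh_conservative[OF mesh \<Omega>])
        show "continuous_on UNIV (G (t n))" using smG n by (intro smooth_continuous) simp
        show "G (t n) x = 0" if "x \<notin> \<Omega>" for x using that by (simp add: G_def)
      qed
      moreover have "flux P n = Av P n * (1 / measure lebesgue P * (\<Sum>\<zeta>\<in>\<F> P. face_measure \<zeta> * (F \<zeta> n \<bullet> outward_normal P \<zeta>)))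
          - (\<Sum>\<zeta>\<in>\<F> P. face_integral \<zeta> (G (t n)) * (F \<zeta> n \<bullet> outward_normal P \<zeta>))" for P
        unfolding flux_def left_diff_distrib sum_subtractf by (simp add: sum_distrib_left ac_simps)
      ultimately have "(\<Sum>P\<in>\<P>. flux P n) = (\<Sum>P\<in>\<P>. Av P n * (1 / measure lebesgue P *
          (\<Sum>\<zeta>\<in>\<F> P. face_measure \<zeta> * (F \<zeta> n \<bullet> outward_normal P \<zeta>))))"
        by (simp add: sum_subtractf)
      then have "(\<Sum>P\<in>\<P>. (t (Suc n) - t n) * flux P n) = (\<Sum>P\<in>\<P>. (t (Suc n) - t n) * (Av P n * (1 / measure lebesgue P *
          (\<Sum>\<zeta>\<in>\<F> P. face_measure \<zeta> * (F \<zeta> n \<bullet> outward_normal P \<zeta>)))))"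
        by (simp only: sum_distrib_left[symmetric])
      moreover have "(t (Suc n) - t n) * conv_coeff \<F> t b F P n * Av P n = (b P (Suc n) - b P n) * Av P n
          + (t (Suc n) - t n) * (Av P n * (1 / measure lebesgue P *
          (\<Sum>\<zeta>\<in>\<F> P. face_measure \<zeta> * (F \<zeta> n \<bullet> outward_normal P \<zeta>))))" for P
        unfolding conv_coeff_def using dt[OF n] by (simp add: field_simps)
      ultimately show ?thesis by (simp add: sum.distrib)
    qed
    have time: "(\<Sum>n<N. \<Sum>P\<in>\<P>. (b P (Suc n) - b P n) * Av P n)
        = - (\<Sum>P\<in>IC. b P 0 * Av P 0)
          - (\<Sum>n=1..N. \<Sum>P\<in>IC. b P n * (LINT z:P \<times> {t (n - 1)<..<t n}|lebesgue. time_deriv \<phi> z))"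
    proof -
      have "(\<Sum>n<N. \<Sum>P\<in>\<P>. (b P (Suc n) - b P n) * Av P n) = (\<Sum>n<N. \<Sum>P\<in>IC. (b P (Suc n) - b P n) * Av P n)"
        by (intro sum.cong refl sum.mono_neutral_right fin ICP) (use Av0 in auto)
      also have "\<dots> = (\<Sum>P\<in>IC. \<Sum>n<N. (b P (Suc n) - b P n) * Av P n)" by (rule sum.swap)
      also have "\<dots> = (\<Sum>P\<in>IC. - (b P 0 * Av P 0) - (\<Sum>n=1..N. b P n * (Av P n - Av P (n - 1))))"
        by (intro sum.cong refl) (use AvN ICP in \<open>auto simp: summation_by_parts[of "b _"]\<close>)
      also have "\<dots> = - (\<Sum>P\<in>IC. b P 0 * Av P 0) - (\<Sum>n=1..N. \<Sum>P\<in>IC. b P n * (Av P n - Av P (n - 1)))"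
        unfolding sum_subtractf sum_negf by (subst sum.swap) simp
      also have "(\<Sum>n=1..N. \<Sum>P\<in>IC. b P n * (Av P n - Av P (n - 1)))
          = (\<Sum>n=1..N. \<Sum>P\<in>IC. b P n * (LINT z:P \<times> {t (n - 1)<..<t n}|lebesgue. time_deriv \<phi> z))"
        using Avdiff ICP by (intro sum.cong refl) auto
      finally show ?thesis .
    qed
    have Vint: "set_integrable lebesgue (R P n) (\<lambda>z. f (U z))" if "P \<in> \<P>" "n < N" for P n
    proof (rule set_integrable_subset[OF Linfty_comp_integrable(1)[OF Qm U f]])
      show "R P n \<in> sets lebesgue"
        using measure_cylinder(1)[OF mesh_cell(3,4)[OF mesh that(1)]] dt[OF that(2)] by (auto simp: R_def)
      show "R P n \<subseteq> \<Omega> \<times> {0<..<T}"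
        using mesh_cell(2)[OF mesh that(1)] tr[of n] tr[of "Suc n"] that(2) by (auto simp: R_def)
    qed
    have est: "\<bar>(t (Suc n) - t n) * flux P n + (LINT z:R P n|lebesgue. f (U z) \<bullet> \<psi> P n)\<bar> \<le> L * err P n"
      if P: "P \<in> \<P>" and n: "n < N" for P n
    proof -
      have n': "n \<le> N" using n by simp
      have D: "frechet_derivative (G (t n)) (at x) v = space_grad \<phi> (x, t n) \<bullet> v" if "x \<in> P" for x v
        using Gd[OF tr[OF n']] mesh_cell(2)[OF mesh P] that by auto
      show ?thesis
        using cell_time_flux_estimate[OF mesh P dt[OF n] Vint[OF P n, unfolded R_def] smG[OF n'] lip[OF tr[OF n']] L
            continuous_space_grad_slice[OF sm] D, of "\<lambda>\<zeta>. F \<zeta> n"]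
        unfolding flux_def err_def R_def \<psi>_def Avg[OF P] by simp
    qed
    have zero: "flux P n = 0 \<and> (LINT z:R P n|lebesgue. f (U z) \<bullet> \<psi> P n) = 0"
      if P: "P \<in> \<P> - IC" and n: "n < N" for P n
    proof
      have n': "n \<le> N" using n by simp
      have "face_integral \<zeta> (G (t n)) = 0" if "\<zeta> \<in> \<F> P" for \<zeta>
      proof (rule face_integral_zero)
        note ff = polyhedral_cell_face[OF mesh_cell(1)[OF mesh DiffD1[OF P]] that]
        show "flat_face \<zeta>" by (rule ff(1))
        show "continuous_on UNIV (G (t n))" using smG[OF n'] by (rule smooth_continuous)
        show "G (t n) x = 0" if "x \<in> \<zeta>" for x
          using ff(2) that far[OF P] by (intro G0[OF tr[OF n']]) (auto simp: frontier_def)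
      qed
      then show "flux P n = 0" unfolding flux_def using Av0[OF P n'] by simp
      have "(LINT x:P|lebesgue. space_grad \<phi> (x, t n)) = 0"
        by (rule set_integral_eq_0) (use d0[OF tr[OF n']] farP[OF P] in blast)
      then have "\<psi> P n = 0" by (simp add: \<psi>_def)
      then show "(LINT z:R P n|lebesgue. f (U z) \<bullet> \<psi> P n) = 0" by (simp add: set_lebesgue_integral_def)
    qed
    have lim: "(LINT z:\<Omega> \<times> {0<..<T}|lebesgue. f (U z) \<bullet> grad_mean \<P> N t \<phi> z)
        = (\<Sum>n<N. \<Sum>P\<in>\<P>. LINT z:R P n|lebesgue. f (U z) \<bullet> \<psi> P n)"
    proof -
      have "norm (grad_mean \<P> N t \<phi> z) \<le> L" for z using bd by (intro grad_mean_bound[OF mesh tp sm L]) blast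
      then have "set_integrable lebesgue (\<Omega> \<times> {0<..<T}) (\<lambda>z. f (U z) \<bullet> grad_mean \<P> N t \<phi> z)"
        by (intro Linfty_comp_integrable(2)[OF Qm U f] grad_mean_measurable[OF mesh])
      then have "(LINT z:\<Omega> \<times> {0<..<T}|lebesgue. f (U z) \<bullet> grad_mean \<P> N t \<phi> z)
          = (\<Sum>n<N. \<Sum>P\<in>\<P>. LINT z:R P n|lebesgue. f (U z) \<bullet> grad_mean \<P> N t \<phi> z)"
        unfolding R_def by (rule integral_spacetime_decomposition[OF mesh tp])
      also have "\<dots> = (\<Sum>n<N. \<Sum>P\<in>\<P>. LINT z:R P n|lebesgue. f (U z) \<bullet> \<psi> P n)"
      proof (intro sum.cong refl)
        fix n P assume nP: "n \<in> {..<N}" "P \<in> \<P>"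
        then have "n < N" by simp
        have "grad_mean \<P> N t \<phi> z = \<psi> P n" if "z \<in> R P n" for z
          unfolding grad_mean_def \<psi>_def
          by (rule piecewise_const_on_cell[OF mesh tp nP(2) \<open>n < N\<close> that[unfolded R_def]])
        then show "(LINT z:R P n|lebesgue. f (U z) \<bullet> grad_mean \<P> N t \<phi> z)
            = (LINT z:R P n|lebesgue. f (U z) \<bullet> \<psi> P n)"
          by (intro set_integral_cong) simp
      qed
      finally show ?thesis .
    qed
    have "(LINT z:\<Omega> \<times> {0<..<T}|lebesgue. conv_op \<P> \<F> N t b F z * interpolate \<P> N t \<phi> z)
        = (\<Sum>n<N. \<Sum>P\<in>\<P>. (b P (Suc n) - b P n) * Av P n) + (\<Sum>n<N. \<Sum>P\<in>\<P>. (t (Suc n) - t n) * flux P n)"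
    proof -
      have "(\<Sum>n<N. \<Sum>P\<in>\<P>. (t (Suc n) - t n) * conv_coeff \<F> t b F P n * Av P n)
          = (\<Sum>n<N. (\<Sum>P\<in>\<P>. (b P (Suc n) - b P n) * Av P n) + (\<Sum>P\<in>\<P>. (t (Suc n) - t n) * flux P n))"
        by (rule sum.cong[OF refl]) (rule cons, simp)
      then show ?thesis
        unfolding integral_conv_op_interpolate[OF mesh tp] Av_def[symmetric] by (simp only: sum.distrib)
    qed
    then have "\<bar>(LINT z:\<Omega> \<times> {0<..<T}|lebesgue. conv_op \<P> \<F> N t b F z * interpolate \<P> N t \<phi> z)
        + (\<Sum>P\<in>IC. b P 0 * Av P 0)
        + (\<Sum>n=1..N. \<Sum>P\<in>IC. b P n * (LINT z:P \<times> {t (n - 1)<..<t n}|lebesgue. time_deriv \<phi> z))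
        + (LINT z:\<Omega> \<times> {0<..<T}|lebesgue. f (U z) \<bullet> grad_mean \<P> N t \<phi> z)\<bar>
      = \<bar>\<Sum>n<N. \<Sum>P\<in>\<P>. (t (Suc n) - t n) * flux P n + (LINT z:R P n|lebesgue. f (U z) \<bullet> \<psi> P n)\<bar>"
      unfolding time lim by (simp add: sum.distrib)
    also have "(\<Sum>n<N. \<Sum>P\<in>\<P>. (t (Suc n) - t n) * flux P n + (LINT z:R P n|lebesgue. f (U z) \<bullet> \<psi> P n))
        = (\<Sum>n<N. \<Sum>P\<in>IC. (t (Suc n) - t n) * flux P n + (LINT z:R P n|lebesgue. f (U z) \<bullet> \<psi> P n))"
      by (intro sum.cong refl sum.mono_neutral_right fin ICP) (use zero in auto)
    also have "\<bar>\<dots>\<bar> \<le> (\<Sum>n<N. \<Sum>P\<in>IC. L * err P n)"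
    proof (rule order_trans[OF sum_abs sum_mono])
      fix n assume "n \<in> {..<N}"
      then show "\<bar>\<Sum>P\<in>IC. (t (Suc n) - t n) * flux P n + (LINT z:R P n|lebesgue. f (U z) \<bullet> \<psi> P n)\<bar>
          \<le> (\<Sum>P\<in>IC. L * err P n)"
        using est ICP by (intro order_trans[OF sum_abs sum_mono]) auto
    qed
    also have "\<dots> = L * (\<Sum>n<N. \<Sum>P\<in>IC. err P n)" by (simp add: sum_distrib_left)
    finally show ?case
      using tp by (simp add: flux_residual_def IC_def Av_def err_def R_def time_partition_def)
  qed
qed

section \<open>Convergence\<close>

lemma mesh_sizes_le:
  assumes "mesh \<Omega> \<P> \<F>" "P \<in> \<P>" shows "diameter P \<le> mesh_size \<P>"
  using assms unfolding mesh_size_def by (intro Max_ge) (auto simp: mesh_def)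

text \<open>Almost every point lies, for every mesh of the sequence, in some space-time cell, and these
  cells shrink to the point.\<close>

lemma grad_mean_tendsto:
  fixes \<phi> :: "(real^'d) \<times> real \<Rightarrow> real"
  assumes mesh: "\<And>m. mesh \<Omega> (\<P> m) (\<F> m)" and tp: "\<And>m. time_partition T (N m) (t m)"
    and h: "(\<lambda>m. mesh_size (\<P> m)) \<longlonglongrightarrow> 0" and dt: "(\<lambda>m. time_step (N m) (t m)) \<longlonglongrightarrow> 0"
    and \<phi>: "smooth \<phi>" and Q: "\<Omega> \<times> {0<..<T} \<in> lmeasurable"
  shows "AE z in lebesgue_on (\<Omega> \<times> {0<..<T}).
    (\<lambda>m. grad_mean (\<P> m) (N m) (t m) \<phi> z) \<longlonglongrightarrow> space_grad \<phi> z"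
proof -
  have "AE z in lebesgue. \<forall>m. fst z \<notin> skeleton (\<P> m) \<and> snd z \<notin> t m ` {..N m}"
    unfolding AE_all_countable by (intro allI AE_off_skeleton[OF mesh])
  then have "AE z in lebesgue. z \<in> \<Omega> \<times> {0<..<T} \<longrightarrow>
      (\<lambda>m. grad_mean (\<P> m) (N m) (t m) \<phi> z) \<longlonglongrightarrow> space_grad \<phi> z"
  proof eventually_elim
    case (elim z)
    show ?case
    proof
      assume z: "z \<in> \<Omega> \<times> {0<..<T}"
      show "(\<lambda>m. grad_mean (\<P> m) (N m) (t m) \<phi> z) \<longlonglongrightarrow> space_grad \<phi> z"
        unfolding tendsto_iff
      proof (intro allI impI)
        fix e :: real assume e: "e > 0"
        have "isCont (space_grad \<phi>) z"
          using space_grad_continuous[OF \<phi>] continuous_on_eq_continuous_at[OF open_UNIV] by blast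
        then obtain d where d: "d > 0" "\<And>y. dist y z < d \<Longrightarrow> dist (space_grad \<phi> y) (space_grad \<phi> z) < e / 2"
          unfolding continuous_at_eps_delta using e by (metis half_gt_zero)
        have "0 < d / 2" using d(1) by simp
        from order_tendstoD(2)[OF h this] order_tendstoD(2)[OF dt this] show "eventually (\<lambda>m. dist (grad_mean (\<P> m) (N m) (t m) \<phi> z) (space_grad \<phi> z) < e) sequentially"
        proof eventually_elim
          case (elim m)
          have "(\<Sum>n<N m. \<Sum>P\<in>\<P> m. indicator (P \<times> {t m n<..<t m (Suc n)}) z) = (1 :: real)"
            using spacetime_indicator[OF mesh tp, of z m] \<open>\<forall>m. fst z \<notin> skeleton (\<P> m) \<and> snd z \<notin> t m ` {..N m}\<close> z
            by simp
          moreover have "(\<Sum>n<N m. \<Sum>P\<in>\<P> m. indicator (P \<times> {t m n<..<t m (Suc n)}) z) = (0 :: real)"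
            if "\<not> (\<exists>n<N m. \<exists>P\<in>\<P> m. z \<in> P \<times> {t m n<..<t m (Suc n)})"
            using that by (intro sum.neutral ballI) auto
          ultimately obtain n P where nP: "n < N m" "P \<in> \<P> m" "z \<in> P \<times> {t m n<..<t m (Suc n)}" by fastforce
          have ts: "t m (Suc n) - t m n \<le> time_step (N m) (t m)"
            unfolding time_step_def using nP(1) by (intro Max_ge) auto
          have "norm (grad_mean (\<P> m) (N m) (t m) \<phi> z - space_grad \<phi> z) \<le> e / 2"
          proof (rule grad_mean_close[OF mesh tp \<phi> nP(2,1,3)])
            fix y assume y: "y \<in> P"
            have "dist (y, t m n) z \<le> dist y (fst z) + dist (t m n) (snd z)"
              by (cases z) (simp add: dist_Pair_Pair sqrt_sum_squares_le_sum)
            also have "dist y (fst z) \<le> diameter P"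
              using y nP(3) mesh_cell(4)[OF mesh nP(2)] by (intro diameter_bounded_bound) auto
            also have "diameter P \<le> mesh_size (\<P> m)" by (rule mesh_sizes_le[OF mesh nP(2)])
            also have "dist (t m n) (snd z) \<le> time_step (N m) (t m)"
              using nP(3) ts by (auto simp: dist_real_def)
            finally have "dist (y, t m n) z < d" using elim by simp
            then show "norm (space_grad \<phi> (y, t m n) - space_grad \<phi> z) \<le> e / 2"
              using d(2) by (simp add: dist_norm less_imp_le)
          qed
          then show ?case using e by (simp add: dist_norm)
        qed
      qed
    qed
  qed
  then show ?thesis using Q by (subst AE_restrict_space_iff) auto
qed

lemma set_integral_const_minus:
  fixes g u :: "'a \<Rightarrow> real"
  assumes "set_integrable M S g" "set_integrable M S (\<lambda>x. u x * g x)"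
  shows "(LINT x:S|M. (c - u x) * g x) = c * (LINT x:S|M. g x) - (LINT x:S|M. u x * g x)"
  using assms by (simp add: left_diff_distrib set_integral_diff(2) set_integrable_mult_right)

lemma integral_lebesgue_on:
  fixes h :: "'a::euclidean_space \<Rightarrow> 'b::euclidean_space"
  assumes "S \<in> lmeasurable"
  shows "(LINT z|lebesgue_on S. h z) = (LINT z:S|lebesgue. h z)"
  using assms by (simp add: integral_restrict_space set_lebesgue_integral_def fmeasurableD)

lemma continuous_measurable_lebesgue_on:
  fixes h :: "'a::euclidean_space \<Rightarrow> 'b::euclidean_space"
  assumes "continuous_on UNIV h"
  shows "h \<in> borel_measurable (lebesgue_on S)"
proof -
  have "h \<in> borel_measurable borel" using assms by (rule borel_measurable_continuous_onI)
  then have "h \<in> borel_measurable lebesgue" by (intro measurable_completion) simp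
  then show ?thesis by (rule measurable_restrict_space1)
qed

theorem theorem2p1:
  fixes \<Omega> :: "(real^'d) set" and T :: real
    and \<beta> :: "real^'p \<Rightarrow> real" and f :: "real^'p \<Rightarrow> real^'d"
    and \<P> :: "nat \<Rightarrow> (real^'d) set set" and \<F> :: "nat \<Rightarrow> (real^'d) set \<Rightarrow> (real^'d) set set"
    and N :: "nat \<Rightarrow> nat" and t :: "nat \<Rightarrow> nat \<Rightarrow> real"
    and U :: "nat \<Rightarrow> (real^'d) \<times> real \<Rightarrow> real^'p"
    and b :: "nat \<Rightarrow> (real^'d) set \<Rightarrow> nat \<Rightarrow> real"
    and F :: "nat \<Rightarrow> (real^'d) set \<Rightarrow> nat \<Rightarrow> real^'d"
    and Ubar :: "(real^'d) \<times> real \<Rightarrow> real^'p" and U0 :: "real^'d \<Rightarrow> real^'p"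
  assumes "CARD('d) \<in> {1, 2, 3}"
    and "open \<Omega>" and "T > 0"
    and "continuous_on UNIV \<beta>" and "continuous_on UNIV f"
    and "\<And>m. mesh \<Omega> (\<P> m) (\<F> m)" and "\<And>m. time_partition T (N m) (t m)"
    and "(\<lambda>m. mesh_size (\<P> m)) \<longlonglongrightarrow> 0" and "(\<lambda>m. time_step (N m) (t m)) \<longlonglongrightarrow> 0"
    and "\<And>m. U m \<in> Linfty (lebesgue_on (\<Omega> \<times> {0<..<T}))"
    and a: "\<exists>C>0. \<forall>m. Linfty_norm (lebesgue_on (\<Omega> \<times> {0<..<T})) (U m) \<le> ereal C"
    and b: "Ubar \<in> Linfty (lebesgue_on (\<Omega> \<times> {0<..<T}))"
      "(\<lambda>m. LINT z:\<Omega> \<times> {0<..<T}|lebesgue. norm (U m z - Ubar z)) \<longlonglongrightarrow> 0"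
    and c: "\<exists>C. \<forall>m. \<forall>P\<in>\<P> m. \<forall>n<N m. \<bar>b m P n\<bar> \<le> C"
    and d: "U0 \<in> Linfty (lebesgue_on \<Omega>)"
      "\<And>\<phi>. \<phi> \<in> test_functions \<Omega> \<Longrightarrow>
        (\<lambda>m. \<Sum>P\<in>interior_cells \<Omega> (\<P> m) (\<F> m).
           LINT x:P|lebesgue. (b m P 0 - \<beta> (U0 x)) * \<phi> x) \<longlonglongrightarrow> 0"
    and e: "\<And>\<phi>. \<phi> \<in> spacetime_test_functions \<Omega> T \<Longrightarrow>
        (\<lambda>m. \<Sum>n=1..N m. \<Sum>P\<in>interior_cells \<Omega> (\<P> m) (\<F> m).
           LINT z:P \<times> {t m (n - 1)<..<t m n}|lebesgue. (b m P n - \<beta> (U m z)) * \<phi> z) \<longlonglongrightarrow> 0"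
    and f: "(\<lambda>m. \<Sum>n<N m. \<Sum>P\<in>interior_cells \<Omega> (\<P> m) (\<F> m).
        diameter P / measure lebesgue P *
          (\<Sum>\<zeta>\<in>\<F> m P. face_measure \<zeta> *
             (LINT z:P \<times> {t m n<..<t m (Suc n)}|lebesgue.
                \<bar>(F m \<zeta> n - f (U m z)) \<bullet> outward_normal P \<zeta>\<bar>))) \<longlonglongrightarrow> 0"
  shows "\<forall>\<phi> \<in> spacetime_test_functions \<Omega> T.
    (\<lambda>m. LINT z:\<Omega> \<times> {0<..<T}|lebesgue.
       conv_op (\<P> m) (\<F> m) (N m) (t m) (b m) (F m) z *
       interpolate (\<P> m) (N m) (t m) \<phi> z)
    \<longlonglongrightarrow>
      - (LINT x:\<Omega>|lebesgue. \<beta> (U0 x) * \<phi> (x, 0))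
      - (LINT z:\<Omega> \<times> {0<..<T}|lebesgue.
           \<beta> (Ubar z) * time_deriv \<phi> z + f (Ubar z) \<bullet> space_grad \<phi> z)"
proof (intro ballI)
  fix \<phi> assume \<phi>: "\<phi> \<in> spacetime_test_functions \<Omega> T"
  note \<Omega> = assms(2) and T = assms(3) and \<beta> = assms(4) and cf = assms(5)
    and mesh = assms(6) and tp = assms(7) and U = assms(10)
  define Q where "Q = \<Omega> \<times> {0<..<T}"
  define IC where "IC m = interior_cells \<Omega> (\<P> m) (\<F> m)" for m
  define S0 where "S0 m = (\<Sum>P\<in>IC m. b m P 0 * (LINT x:P|lebesgue. \<phi> (x, 0)))" for m
  define S1 where "S1 m = (\<Sum>n=1..N m. \<Sum>P\<in>IC m. b m P n *
      (LINT z:P \<times> {t m (n - 1)<..<t m n}|lebesgue. time_deriv \<phi> z))" for m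
  define S2 where "S2 m = (LINT z:Q|lebesgue. f (U m z) \<bullet> grad_mean (\<P> m) (N m) (t m) \<phi> z)" for m
  define lhs where "lhs m = (LINT z:Q|lebesgue. conv_op (\<P> m) (\<F> m) (N m) (t m) (b m) (F m) z *
       interpolate (\<P> m) (N m) (t m) \<phi> z)" for m
  define err where "err m = flux_residual \<Omega> (\<P> m) (\<F> m) (N m) (t m) (F m) (\<lambda>z. f (U m z))" for m
  have sm: "smooth \<phi>" using \<phi> by (simp add: spacetime_test_functions_def)
  have cphi: "continuous_on UNIV \<phi>" by (rule smooth_continuous[OF sm])
  have cdt: "continuous_on UNIV (time_deriv \<phi>)"
    unfolding time_deriv_frechet(1)[OF sm] by (intro smooth_continuous smooth_frechet_derivative sm)
  have b\<Omega>: "bounded \<Omega>" by (rule mesh_bounded[OF mesh[of 0]])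
  have \<Omega>m: "\<Omega> \<in> lmeasurable" using b\<Omega> \<Omega> by (intro bounded_set_imp_lmeasurable) auto
  have Qm: "Q \<in> lmeasurable" unfolding Q_def using spacetime_cylinder_lmeasurable[OF mesh[of 0] \<Omega>] T by simp
  have fin: "finite (\<P> m)" for m using mesh[of m] by (simp add: mesh_def)
  have ICP: "IC m \<subseteq> \<P> m" for m by (auto simp: IC_def interior_cells_def)
  have dt: "t m n < t m (Suc n)" if "n < N m" for m n using tp[of m] that by (simp add: time_partition_def)
  have tr: "t m n \<in> {0..T}" if "n \<le> N m" for m n using time_partition_range[OF tp that] by simp
  have Uq: "U m \<in> Linfty (lebesgue_on Q)" for m using U by (simp add: Q_def)
  show "(\<lambda>m. LINT z:\<Omega> \<times> {0<..<T}|lebesgue.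
       conv_op (\<P> m) (\<F> m) (N m) (t m) (b m) (F m) z *
       interpolate (\<P> m) (N m) (t m) \<phi> z)
    \<longlonglongrightarrow>
      - (LINT x:\<Omega>|lebesgue. \<beta> (U0 x) * \<phi> (x, 0))
      - (LINT z:\<Omega> \<times> {0<..<T}|lebesgue.
           \<beta> (Ubar z) * time_deriv \<phi> z + f (Ubar z) \<bullet> space_grad \<phi> z)"
  proof (rule discrete_weak_formulation[OF \<Omega> T \<phi> cf], goal_cases)
    case (1 \<epsilon> L)
    note L = 1(2) and bd = 1(3) and far = 1(4) and weak = 1(5)
    have small: "eventually (\<lambda>m. \<forall>P\<in>\<P> m. diameter P < \<epsilon>) sequentially"
      using order_tendstoD(2)[OF assms(8) 1(1)]
      by eventually_elim (use mesh_sizes_le[OF mesh] in force)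
    have total: "(\<lambda>m. lhs m + S0 m + S1 m + S2 m) \<longlonglongrightarrow> 0"
    proof (rule Lim_null_comparison)
      show "eventually (\<lambda>m. norm (lhs m + S0 m + S1 m + S2 m) \<le> L * err m) sequentially"
        using small
      proof eventually_elim
        case (elim m)
        have "\<And>P. P \<in> \<P> m \<Longrightarrow> diameter P < \<epsilon>" using elim by blast
        from weak[OF mesh[of m] tp[of m] this U[of m]] show ?case
          by (simp only: lhs_def S0_def S1_def S2_def err_def IC_def Q_def real_norm_def)
      qed
      show "(\<lambda>m. L * err m) \<longlonglongrightarrow> 0"
        using tendsto_mult_right_zero[OF f, of L] by (simp only: err_def[abs_def] flux_residual_def)
    qed
    let ?h = "\<lambda>x. \<beta> (U0 x) * \<phi> (x, 0)"
    let ?k = "\<lambda>u z. \<beta> (u z) * time_deriv \<phi> z"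
    (* Cells with a face on the boundary miss the support, so that the sums over the interior cells
       are integrals over \<Omega>. *)
    have S0: "S0 \<longlonglongrightarrow> (LINT x:\<Omega>|lebesgue. ?h x)"
    proof -
      define G where "G x = (if x \<in> \<Omega> then \<phi> (x, 0) else 0)" for x
      have G: "G \<in> test_functions \<Omega>"
      proof (rule spacetime_test_function_slices[OF \<phi> \<Omega> T], goal_cases)
        case (1 K L)
        then show ?case using bspec[OF 1(4), of 0] T by (simp add: G_def[abs_def])
      qed
      have cphi0: "continuous_on UNIV (\<lambda>x. \<phi> (x, 0))"
        by (intro continuous_on_compose2[OF cphi] continuous_intros) auto
      have "bounded ((\<lambda>x. \<phi> (x, 0)) ` closure \<Omega>)"
        using b\<Omega> cphi0 by (intro compact_imp_bounded compact_continuous_image) (auto intro: continuous_on_subset)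
      then obtain B where B: "\<forall>x\<in>closure \<Omega>. norm (\<phi> (x, 0)) \<le> B" unfolding bounded_iff by blast
      have "set_integrable lebesgue \<Omega> (\<lambda>x. \<beta> (U0 x) \<bullet> \<phi> (x, 0))"
        by (rule Linfty_comp_integrable(2)[OF \<Omega>m d(1) \<beta> continuous_measurable_lebesgue_on[OF cphi0]])
          (use B closure_subset in blast)
      then have i\<beta>: "set_integrable lebesgue \<Omega> ?h" by simp
      have ev: "eventually (\<lambda>m. (\<Sum>P\<in>IC m. LINT x:P|lebesgue. (b m P 0 - \<beta> (U0 x)) * G x)
          + (LINT x:\<Omega>|lebesgue. ?h x) = S0 m) sequentially"
        using small
      proof eventually_elim
        case (elim m)
        have "(LINT x:\<Omega>|lebesgue. ?h x) = (\<Sum>P\<in>\<P> m. LINT x:P|lebesgue. ?h x)"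
          by (rule integral_mesh_decomposition[OF mesh i\<beta>])
        also have "\<dots> = (\<Sum>P\<in>IC m. LINT x:P|lebesgue. ?h x)"
        proof (rule sum.mono_neutral_right[OF fin ICP], rule ballI)
          fix P assume P: "P \<in> \<P> m - IC m"
          have "\<phi> (x, 0) = 0" if "x \<in> P" for x
            using far[OF mesh[of m], of P x 0] P elim that T by (auto simp: IC_def)
          then show "(LINT x:P|lebesgue. ?h x) = 0" by (intro set_integral_eq_0) simp
        qed
        finally have dec: "(LINT x:\<Omega>|lebesgue. ?h x) = (\<Sum>P\<in>IC m. LINT x:P|lebesgue. ?h x)" .
        have "(LINT x:P|lebesgue. (b m P 0 - \<beta> (U0 x)) * G x)
            = b m P 0 * (LINT x:P|lebesgue. \<phi> (x, 0)) - (LINT x:P|lebesgue. ?h x)" if "P \<in> IC m" for P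
        proof -
          have P: "P \<in> \<P> m" using that ICP by blast
          note c = mesh_cell[OF mesh P]
          have "(LINT x:P|lebesgue. (b m P 0 - \<beta> (U0 x)) * G x) = (LINT x:P|lebesgue. (b m P 0 - \<beta> (U0 x)) * \<phi> (x, 0))"
            by (rule set_integral_cong) (use c(2) in \<open>auto simp: G_def\<close>)
          also have "\<dots> = b m P 0 * (LINT x:P|lebesgue. \<phi> (x, 0)) - (LINT x:P|lebesgue. ?h x)"
          proof (rule set_integral_const_minus)
            show "set_integrable lebesgue P (\<lambda>x. \<phi> (x, 0))"
              using c(3,4) by (intro continuous_set_integrable(2) cphi0) auto
            show "set_integrable lebesgue P ?h"
              by (rule set_integrable_subset[OF i\<beta>]) (use c(2,3) in auto)
          qed
          finally show ?thesis .
        qed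
        then show ?case unfolding dec S0_def by (simp add: sum.distrib[symmetric])
      qed
      have "(\<lambda>m. (\<Sum>P\<in>IC m. LINT x:P|lebesgue. (b m P 0 - \<beta> (U0 x)) * G x)
          + (LINT x:\<Omega>|lebesgue. ?h x)) \<longlonglongrightarrow> 0 + (LINT x:\<Omega>|lebesgue. ?h x)"
        using d(2)[OF G] unfolding IC_def[symmetric] by (intro tendsto_add tendsto_const)
      from Lim_transform_eventually[OF this ev] show ?thesis by simp
    qed
    have finM: "finite_measure (lebesgue_on Q)" by (rule finite_measure_lebesgue_on[OF Qm])
    obtain C where C: "\<And>m. Linfty_norm (lebesgue_on (\<Omega> \<times> {0<..<T})) (U m) \<le> ereal C" using a by blast
    have UC: "AE z in lebesgue_on Q. norm (U m z) \<le> C" for m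
      unfolding Q_def by (rule Linfty_norm_le_AE[OF C])
    have Ub: "Ubar \<in> Linfty (lebesgue_on Q)" using b(1) by (simp add: Q_def)
    obtain C' where C': "AE z in lebesgue_on Q. norm (Ubar z) \<le> C'" using Linfty_AE_bounded[OF Ub] .
    have Um: "U m \<in> borel_measurable (lebesgue_on Q)" for m using Uq by (simp add: Linfty_def)
    have Ubm: "Ubar \<in> borel_measurable (lebesgue_on Q)" using Ub by (simp add: Linfty_def)
    have L1: "(\<lambda>m. LINT z|lebesgue_on Q. norm (U m z - Ubar z)) \<longlonglongrightarrow> 0"
      unfolding integral_lebesgue_on[OF Qm] using b(2) by (simp add: Q_def)
    have bQ: "\<bar>time_deriv \<phi> z\<bar> \<le> L \<and> norm (space_grad \<phi> z) \<le> L" if "z \<in> Q" for z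
      using bd[of "fst z" "snd z"] that by (auto simp: Q_def)
    have dtm: "time_deriv \<phi> \<in> borel_measurable (lebesgue_on Q)" by (rule continuous_measurable_lebesgue_on[OF cdt])
    have sgm: "space_grad \<phi> \<in> borel_measurable (lebesgue_on Q)"
      by (rule continuous_measurable_lebesgue_on[OF space_grad_continuous[OF sm]])
    have i1: "set_integrable lebesgue Q (?k u)" if "u \<in> Linfty (lebesgue_on Q)" for u
    proof -
      have "set_integrable lebesgue Q (\<lambda>z. \<beta> (u z) \<bullet> time_deriv \<phi> z)"
        by (rule Linfty_comp_integrable(2)[OF Qm that \<beta> dtm, of L]) (use bQ in simp)
      then show ?thesis by simp
    qed
    have i2: "set_integrable lebesgue Q (\<lambda>z. f (Ubar z) \<bullet> space_grad \<phi> z)"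
      by (rule Linfty_comp_integrable(2)[OF Qm Ub cf sgm, of L]) (use bQ in simp)
    have S2: "S2 \<longlonglongrightarrow> (LINT z:Q|lebesgue. f (Ubar z) \<bullet> space_grad \<phi> z)"
    proof -
      have "(\<lambda>m. LINT z|lebesgue_on Q. f (U m z) \<bullet> grad_mean (\<P> m) (N m) (t m) \<phi> z)
          \<longlonglongrightarrow> (LINT z|lebesgue_on Q. f (Ubar z) \<bullet> space_grad \<phi> z)"
      proof (rule tendsto_integral_composition[OF finM cf Um UC Ubm C' L1 _ _ sgm])
        show "grad_mean (\<P> m) (N m) (t m) \<phi> \<in> borel_measurable (lebesgue_on Q)" for m
          by (rule grad_mean_measurable[OF mesh])
        have "norm (grad_mean (\<P> m) (N m) (t m) \<phi> z) \<le> L" for m z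
          using bd by (intro grad_mean_bound[OF mesh tp sm L]) blast
        then show "AE z in lebesgue_on Q. norm (grad_mean (\<P> m) (N m) (t m) \<phi> z) \<le> L" for m by simp
        show "AE z in lebesgue_on Q. (\<lambda>m. grad_mean (\<P> m) (N m) (t m) \<phi> z) \<longlonglongrightarrow> space_grad \<phi> z"
          unfolding Q_def by (rule grad_mean_tendsto[OF mesh tp assms(8,9) sm Qm[unfolded Q_def]])
      qed
      then show ?thesis unfolding integral_lebesgue_on[OF Qm] S2_def[abs_def] .
    qed
    have S1: "S1 \<longlonglongrightarrow> (LINT z:Q|lebesgue. ?k Ubar z)"
    proof -
      have "(\<lambda>m. LINT z|lebesgue_on Q. \<beta> (U m z) \<bullet> time_deriv \<phi> z)
          \<longlonglongrightarrow> (LINT z|lebesgue_on Q. \<beta> (Ubar z) \<bullet> time_deriv \<phi> z)"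
      proof (rule tendsto_integral_composition[OF finM \<beta> Um UC Ubm C' L1 dtm _ dtm])
        show "AE z in lebesgue_on Q. norm (time_deriv \<phi> z) \<le> L" by (rule AE_I2) (use bQ in simp)
      qed simp
      then have lim: "(\<lambda>m. LINT z:Q|lebesgue. ?k (U m) z) \<longlonglongrightarrow> (LINT z:Q|lebesgue. ?k Ubar z)"
        unfolding integral_lebesgue_on[OF Qm] by simp
      have ev: "eventually (\<lambda>m. (\<Sum>n=1..N m. \<Sum>P\<in>IC m.
            LINT z:P \<times> {t m (n - 1)<..<t m n}|lebesgue. (b m P n - \<beta> (U m z)) * time_deriv \<phi> z)
          + (LINT z:Q|lebesgue. ?k (U m) z) = S1 m) sequentially"
        using small
      proof eventually_elim
        case (elim m)
        define R where "R P n = P \<times> {t m (n - 1)<..<t m n}" for P :: "(real^'d) set" and n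
        have "(LINT z:Q|lebesgue. ?k (U m) z)
            = (\<Sum>n<N m. \<Sum>P\<in>\<P> m. LINT z:R P (Suc n)|lebesgue. ?k (U m) z)"
          using integral_spacetime_decomposition[OF mesh tp i1[OF Uq, unfolded Q_def]] by (simp add: R_def Q_def)
        also have "\<dots> = (\<Sum>n<N m. \<Sum>P\<in>IC m. LINT z:R P (Suc n)|lebesgue. ?k (U m) z)"
        proof (rule sum.cong[OF refl], rule sum.mono_neutral_right[OF fin ICP], rule ballI)
          fix n P assume n: "n \<in> {..<N m}" and P: "P \<in> \<P> m - IC m"
          have "time_deriv \<phi> z = 0" if "z \<in> R P (Suc n)" for z
            using far[OF mesh[of m], of P "fst z" "snd z"] P elim that tr[of n m] tr[of "Suc n" m] n
            by (auto simp: IC_def R_def)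
          then show "(LINT z:R P (Suc n)|lebesgue. ?k (U m) z) = 0" by (intro set_integral_eq_0) simp
        qed
        also have "\<dots> = (\<Sum>n=1..N m. \<Sum>P\<in>IC m. LINT z:R P n|lebesgue. ?k (U m) z)"
          by (simp add: sum.atLeast1_atMost_eq)
        finally have dec: "(LINT z:Q|lebesgue. ?k (U m) z)
            = (\<Sum>n=1..N m. \<Sum>P\<in>IC m. LINT z:R P n|lebesgue. ?k (U m) z)" .
        have "(LINT z:R P n|lebesgue. (b m P n - \<beta> (U m z)) * time_deriv \<phi> z)
            = b m P n * (LINT z:R P n|lebesgue. time_deriv \<phi> z) - (LINT z:R P n|lebesgue. ?k (U m) z)"
          if n: "n \<in> {1..N m}" and P: "P \<in> IC m" for P n
        proof (rule set_integral_const_minus)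
          have P': "P \<in> \<P> m" using P ICP by blast
          note c = mesh_cell[OF mesh P']
          have n1: "n - 1 \<le> N m" "n \<le> N m" using n by auto
          have o: "open (R P n)" "bounded (R P n)" unfolding R_def using c by (auto intro: open_Times bounded_Times)
          show "set_integrable lebesgue (R P n) (time_deriv \<phi>)"
            using o by (intro continuous_set_integrable(2) cdt) auto
          show "set_integrable lebesgue (R P n) (?k (U m))"
            by (rule set_integrable_subset[OF i1[OF Uq]])
              (use o c(2) tr[OF n1(1)] tr[OF n1(2)] in \<open>auto simp: R_def Q_def\<close>)
        qed
        then show ?case unfolding dec S1_def R_def[symmetric] by (simp add: sum.distrib[symmetric])
      qed
      have "(\<lambda>m. (\<Sum>n=1..N m. \<Sum>P\<in>IC m.
            LINT z:P \<times> {t m (n - 1)<..<t m n}|lebesgue. (b m P n - \<beta> (U m z)) * time_deriv \<phi> z)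
          + (LINT z:Q|lebesgue. ?k (U m) z)) \<longlonglongrightarrow> 0 + (LINT z:Q|lebesgue. ?k Ubar z)"
        using e[OF time_deriv_test_function[OF \<phi> \<Omega> T]] unfolding IC_def[symmetric] by (intro tendsto_add lim)
      from Lim_transform_eventually[OF this ev] show ?thesis by simp
    qed
    have "(\<lambda>m. (lhs m + S0 m + S1 m + S2 m) - S0 m - S1 m - S2 m) \<longlonglongrightarrow>
        0 - (LINT x:\<Omega>|lebesgue. ?h x) - (LINT z:Q|lebesgue. ?k Ubar z)
          - (LINT z:Q|lebesgue. f (Ubar z) \<bullet> space_grad \<phi> z)"
      by (intro tendsto_diff total S0 S1 S2)
    moreover have "(LINT z:Q|lebesgue. ?k Ubar z + f (Ubar z) \<bullet> space_grad \<phi> z)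
        = (LINT z:Q|lebesgue. ?k Ubar z) + (LINT z:Q|lebesgue. f (Ubar z) \<bullet> space_grad \<phi> z)"
      by (rule set_integral_add(2)[OF i1[OF Ub] i2])
    ultimately have "lhs \<longlonglongrightarrow> - (LINT x:\<Omega>|lebesgue. ?h x)
        - (LINT z:Q|lebesgue. ?k Ubar z + f (Ubar z) \<bullet> space_grad \<phi> z)"
      by (simp add: algebra_simps)
    then show ?case by (simp only: lhs_def[abs_def] Q_def)
  qed
qed

end
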